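(* Let $\Gamma$ be a finitely generated group with finite generating system $Q$, let $Z\subset\mathrm{Sub}(\Gamma)$ be a uniformly recurrent subgroup and let $H\in Z$ be such that the Schreier graph $S^Q_\Gamma(H)$ has Property A. Then the $C^*$-algebra $C^*_r(Z)$ is exact.
   Context: $\mathrm{Sub}(\Gamma)$ is the compact space of subgroups of $\Gamma$, with $\Gamma$ acting by conjugation. A uniformly recurrent subgroup (URS) is a nonempty closed invariant $Z\subset\mathrm{Sub}(\Gamma)$ on which the action is minimal. Let $Q=\{\gamma_1,\dots,\gamma_n\}$. For $H\in\mathrm{Sub}(\Gamma)$ the Schreier graph $S=S^Q_\Gamma(H)$ has vertex set $\Gamma/H$, with a directed edge labeled $\gamma_i$ connecting $aH$ and $bH$ whenever $\gamma_i aH=bH$ (and one labeled $\gamma_i^{-1}$ if $\gamma_i bH=aH$); $d_S$ is the shortest path metric and $B_r(S,x)$ is the $r$-ball around $x$, as a rooted edge-labeled graph. A graph $G$ of bounded vertex degrees has Property A if there is a sequence of maps $\varsigma^n:V(G)\to\ell^2(V(G))$, $x\mapsto\varsigma^n_x$ ($n\ge1$), such that each $\varsigma^n_x$ has norm $1$; if $d_G(x,y)\le n$ then $\|\varsigma^n_x-\varsigma^n_y\|\le\frac1n$; and for each $n$ there is $R_n>0$ such that $\varsigma^n_x$ is supported in $B_{R_n}(G,x)$ for all $x$. Fix $H\in Z$ and $S=S^Q_\Gamma(H)$. A local kernel is a function $K:\Gamma/H\times\Gamma/H\to\mathbb{C}$ for which there is an integer $R>0$ such that (1) $K(x,y)=0$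 if $d_S(x,y)>R$; (2) if $\theta:B_R(S,y)\to B_R(S,z)$ is a rooted-labeled isomorphism, then $K(y,w)=K(z,\theta(w))$ for all $w\in B_R(S,y)$. Local kernels form a unital $*$-algebra $\mathbb{C}Z$ with pointwise addition, $KL(x,y)=\sum_{z}K(x,z)L(z,y)$, and $K^*(x,y)=\overline{K(y,x)}$. It acts by bounded operators on $\ell^2(\Gamma/H)$ by $(Kf)(x)=\sum_y K(x,y)f(y)$, and $C^*_r(Z)$ is the norm closure of $\mathbb{C}Z$ in $B(\ell^2(\Gamma/H))$. (Up to canonical isomorphism this does not depend on the choice of $H\in Z$ or of $Q$.) *)

theory Defs
  imports "HOL-Analysis.Analysis" "HOL-Algebra.Left_Coset" "HOL-Algebra.Generated_Groups" "HOL-Library.Extended_Nat"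
begin

section \<open>The Hilbert space of square-summable functions on a type\<close>

typedef 'a ell2 = "{f :: 'a \<Rightarrow> complex. (\<lambda>x. (cmod (f x))\<^sup>2) summable_on UNIV}"
  by (rule exI[of _ "\<lambda>_. 0"]) simp

setup_lifting type_definition_ell2

lemma ell2_summable: "(\<lambda>x. (cmod (Rep_ell2 f x))\<^sup>2) summable_on UNIV"
  using Rep_ell2[of f] by simp

lemma ell2_add_closed:
  fixes f g :: "'a \<Rightarrow> complex"
  assumes f: "(\<lambda>x. (cmod (f x))\<^sup>2) summable_on UNIV"
    and g: "(\<lambda>x. (cmod (g x))\<^sup>2) summable_on UNIV"
  shows "(\<lambda>x. (cmod (f x + g x))\<^sup>2) summable_on UNIV"
proof (rule summable_on_comparison_test)
  show "(\<lambda>x. 2 * (cmod (f x))\<^sup>2 + 2 * (cmod (g x))\<^sup>2) summable_on UNIV"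
    by (intro summable_on_add summable_on_cmult_right f g)
  fix x
  have "(cmod (f x + g x))\<^sup>2 \<le> (cmod (f x) + cmod (g x))\<^sup>2"
    by (intro power_mono norm_triangle_ineq) simp
  also have "\<dots> \<le> 2 * (cmod (f x))\<^sup>2 + 2 * (cmod (g x))\<^sup>2"
    using zero_le_power2[of "cmod (f x) - cmod (g x)"]
    by (simp add: power2_eq_square algebra_simps)
  finally show "(cmod (f x + g x))\<^sup>2 \<le> 2 * (cmod (f x))\<^sup>2 + 2 * (cmod (g x))\<^sup>2" .
qed simp

lemma ell2_scale_closed:
  fixes f :: "'a \<Rightarrow> complex"
  assumes "(\<lambda>x. (cmod (f x))\<^sup>2) summable_on UNIV"
  shows "(\<lambda>x. (cmod (c * f x))\<^sup>2) summable_on UNIV"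
  using summable_on_cmult_right[OF assms, of "(cmod c)\<^sup>2"]
  by (simp add: norm_mult power_mult_distrib)

lemma ell2_tensor_closed:
  fixes f :: "'a \<Rightarrow> complex" and g :: "'b \<Rightarrow> complex"
  assumes f: "(\<lambda>x. (cmod (f x))\<^sup>2) summable_on UNIV"
    and g: "(\<lambda>x. (cmod (g x))\<^sup>2) summable_on UNIV"
  shows "(\<lambda>z. (cmod (f (fst z) * g (snd z)))\<^sup>2) summable_on UNIV"
proof -
  have "(\<lambda>z. (cmod (f (fst z) * g (snd z)))\<^sup>2) summable_on (SIGMA x:UNIV. UNIV)"
  proof (rule summable_on_SigmaI)
    fix x
    show "((\<lambda>y. (cmod (f (fst (x, y)) * g (snd (x, y))))\<^sup>2)
            has_sum (cmod (f x))\<^sup>2 * infsum (\<lambda>y. (cmod (g y))\<^sup>2) UNIV) UNIV"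
      using has_sum_cmult_right[OF has_sum_infsum[OF g], of "(cmod (f x))\<^sup>2"]
      by (simp add: norm_mult power_mult_distrib)
  next
    show "(\<lambda>x. (cmod (f x))\<^sup>2 * infsum (\<lambda>y. (cmod (g y))\<^sup>2) UNIV) summable_on UNIV"
      by (rule summable_on_cmult_left[OF f])
  qed simp
  then show ?thesis by simp
qed

lemma ell2_inner_summable:
  "(\<lambda>x. inner (Rep_ell2 f x) (Rep_ell2 g x)) summable_on UNIV"
proof -
  let ?h = "\<lambda>x. (cmod (Rep_ell2 f x))\<^sup>2 + (cmod (Rep_ell2 g x))\<^sup>2"
  have "(\<lambda>x. norm (inner (Rep_ell2 f x) (Rep_ell2 g x))) summable_on UNIV"
  proof (rule Infinite_Sum.abs_summable_on_comparison_test')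
    show "?h summable_on UNIV"
      by (intro summable_on_add ell2_summable)
    fix x
    have "norm (inner (Rep_ell2 f x) (Rep_ell2 g x)) \<le> cmod (Rep_ell2 f x) * cmod (Rep_ell2 g x)"
      using Cauchy_Schwarz_ineq2[of "Rep_ell2 f x" "Rep_ell2 g x"] by simp
    also have "\<dots> \<le> ?h x"
    proof -
      have "2 * (cmod (Rep_ell2 f x) * cmod (Rep_ell2 g x)) \<le> ?h x"
        using sum_squares_bound[of "cmod (Rep_ell2 f x)" "cmod (Rep_ell2 g x)"] by simp
      moreover have "0 \<le> cmod (Rep_ell2 f x) * cmod (Rep_ell2 g x)" by simp
      ultimately show ?thesis by linarith
    qed
    finally show "norm (inner (Rep_ell2 f x) (Rep_ell2 g x)) \<le> ?h x" .
  qed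
  then show ?thesis by (rule Infinite_Sum.abs_summable_summable)
qed

text \<open>
  The real Hilbert space structure of \<open>\<ell>\<^sup>2\<close>, which gives access to the library's bounded
  operators with their operator norm.  Its inner product is the real part of \<open>cinner\<close> below,
  so the norm is the usual one.
\<close>

instantiation ell2 :: (type) real_inner
begin

lift_definition zero_ell2 :: "'a ell2" is "\<lambda>_. 0" by simp
lift_definition plus_ell2 :: "'a ell2 \<Rightarrow> 'a ell2 \<Rightarrow> 'a ell2" is "\<lambda>f g x. f x + g x"
  by (rule ell2_add_closed)
lift_definition uminus_ell2 :: "'a ell2 \<Rightarrow> 'a ell2" is "\<lambda>f x. - f x" by simp
lift_definition minus_ell2 :: "'a ell2 \<Rightarrow> 'a ell2 \<Rightarrow> 'a ell2" is "\<lambda>f g x. f x - g x"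
  using ell2_add_closed[of _ "\<lambda>x. - _ x"] by simp
lift_definition scaleR_ell2 :: "real \<Rightarrow> 'a ell2 \<Rightarrow> 'a ell2" is "\<lambda>r f x. complex_of_real r * f x"
  by (rule ell2_scale_closed)

definition inner_ell2 :: "'a ell2 \<Rightarrow> 'a ell2 \<Rightarrow> real" where
  "inner_ell2 f g = (\<Sum>\<^sub>\<infinity>x. inner (Rep_ell2 f x) (Rep_ell2 g x))"
definition norm_ell2 :: "'a ell2 \<Rightarrow> real" where
  "norm_ell2 f = sqrt (inner f f)"
definition sgn_ell2 :: "'a ell2 \<Rightarrow> 'a ell2" where
  "sgn_ell2 f = inverse (norm f) *\<^sub>R f"
definition dist_ell2 :: "'a ell2 \<Rightarrow> 'a ell2 \<Rightarrow> real" where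
  "dist_ell2 f g = norm (f - g)"
definition uniformity_ell2 :: "('a ell2 \<times> 'a ell2) filter" where
  "uniformity_ell2 = (INF e\<in>{0 <..}. principal {(f, g). dist f g < e})"
definition open_ell2 :: "'a ell2 set \<Rightarrow> bool" where
  "open_ell2 U \<longleftrightarrow> (\<forall>f\<in>U. \<forall>\<^sub>F (f', g) in uniformity. f' = f \<longrightarrow> g \<in> U)"

instance
proof
  fix f g h :: "'a ell2" and r s :: real
  show "f + g + h = f + (g + h)" by transfer (simp add: add.assoc)
  show "f + g = g + f" by transfer (simp add: add.commute)
  show "0 + f = f" by transfer simp
  show "- f + f = 0" by transfer simp
  show "f - g = f + - g" by transfer simp
  show "r *\<^sub>R (f + g) = r *\<^sub>R f + r *\<^sub>R g" by transfer (simp add: distrib_left)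
  show "(r + s) *\<^sub>R f = r *\<^sub>R f + s *\<^sub>R f" by transfer (simp add: distrib_right)
  show "r *\<^sub>R s *\<^sub>R f = (r * s) *\<^sub>R f" by transfer (simp add: mult.assoc)
  show "1 *\<^sub>R f = f" by transfer simp
  show "dist f g = norm (f - g)" by (rule dist_ell2_def)
  show "sgn f = inverse (norm f) *\<^sub>R f" by (rule sgn_ell2_def)
  show "uniformity = (INF e\<in>{0 <..}. principal {(f, g :: 'a ell2). dist f g < e})"
    by (rule uniformity_ell2_def)
  show "open U \<longleftrightarrow> (\<forall>f\<in>U. \<forall>\<^sub>F (f', g) in uniformity. f' = f \<longrightarrow> g \<in> U)" for U :: "'a ell2 set"
    by (rule open_ell2_def)
  show "inner f g = inner g f"
    by (simp add: inner_ell2_def inner_commute)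
  show "inner (f + g) h = inner f h + inner g h"
    by (simp add: inner_ell2_def plus_ell2.rep_eq inner_add_left infsum_add ell2_inner_summable)
  have "inner (complex_of_real r * z) w = r * inner z w" for z w
    by (simp add: inner_complex_def algebra_simps)
  then show "inner (r *\<^sub>R f) g = r * inner f g"
    by (simp add: inner_ell2_def scaleR_ell2.rep_eq infsum_cmult_right')
  show "0 \<le> inner f f"
    by (simp add: inner_ell2_def infsum_nonneg)
  show "inner f f = 0 \<longleftrightarrow> f = 0"
  proof
    assume "inner f f = 0"
    then have "Rep_ell2 f x = 0" for x
      using nonneg_infsum_le_0D[of "\<lambda>x. inner (Rep_ell2 f x) (Rep_ell2 f x)" UNIV x]
      by (simp add: inner_ell2_def ell2_inner_summable)
    then show "f = 0" by transfer auto
  qed (simp add: inner_ell2_def zero_ell2.rep_eq)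
  show "norm f = sqrt (inner f f)" by (rule norm_ell2_def)
qed

end

lift_definition scaleC :: "complex \<Rightarrow> 'a ell2 \<Rightarrow> 'a ell2" is "\<lambda>c f x. c * f x"
  by (rule ell2_scale_closed)

definition cinner :: "'a ell2 \<Rightarrow> 'a ell2 \<Rightarrow> complex" where
  "cinner f g = (\<Sum>\<^sub>\<infinity>x. Rep_ell2 f x * cnj (Rep_ell2 g x))"

text \<open>\<open>\<ell>\<^sup>2(I \<times> J)\<close> serves as the Hilbert space tensor product of \<open>\<ell>\<^sup>2(I)\<close> and \<open>\<ell>\<^sup>2(J)\<close>.\<close>

lift_definition tensor_vec :: "'i ell2 \<Rightarrow> 'j ell2 \<Rightarrow> ('i \<times> 'j) ell2" is
  "\<lambda>f g z. f (fst z) * g (snd z)"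
  by (rule ell2_tensor_closed)


section \<open>Concrete C*-algebras\<close>

text \<open>
  Since every Hilbert space is isomorphic to \<open>\<ell>\<^sup>2(I)\<close> for some index set, every C*-algebra has a
  faithful representation on an \<open>\<ell>\<^sup>2\<close> space (add an index if the Hilbert space is zero).
  The library type \<open>\<Rightarrow>\<^sub>L\<close> consists of real-linear operators, hence
  complex linearity is required separately.
\<close>

type_synonym 'a op = "'a ell2 \<Rightarrow>\<^sub>L 'a ell2"

definition op_clinear :: "'a op \<Rightarrow> bool" where
  "op_clinear T \<longleftrightarrow> (\<forall>c f. blinfun_apply T (scaleC c f) = scaleC c (blinfun_apply T f))"

definition op_scaleC :: "complex \<Rightarrow> 'a op \<Rightarrow> 'a op" where
  "op_scaleC c T = Blinfun (\<lambda>f. scaleC c (blinfun_apply T f))"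

definition op_adj :: "'a op \<Rightarrow> 'a op" where
  "op_adj T = (THE S. \<forall>f g. cinner (blinfun_apply T f) g = cinner f (blinfun_apply S g))"

definition op_tensor :: "'i op \<Rightarrow> 'j op \<Rightarrow> ('i \<times> 'j) op" where
  "op_tensor T S = (THE R. \<forall>f g. blinfun_apply R (tensor_vec f g) =
     tensor_vec (blinfun_apply T f) (blinfun_apply S g))"

definition cstar_algebra :: "'a op set \<Rightarrow> bool" where
  "cstar_algebra A \<longleftrightarrow>
     (\<forall>T\<in>A. op_clinear T) \<and> 0 \<in> A \<and>
     (\<forall>S\<in>A. \<forall>T\<in>A. S + T \<in> A) \<and> (\<forall>c. \<forall>T\<in>A. op_scaleC c T \<in> A) \<and>
     (\<forall>S\<in>A. \<forall>T\<in>A. S o\<^sub>L T \<in> A) \<and> (\<forall>T\<in>A. op_adj T \<in> A) \<and> closed A"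

definition closed_ideal :: "'a op set \<Rightarrow> 'a op set \<Rightarrow> bool" where
  "closed_ideal J B \<longleftrightarrow>
     J \<subseteq> B \<and> 0 \<in> J \<and>
     (\<forall>S\<in>J. \<forall>T\<in>J. S + T \<in> J) \<and> (\<forall>c. \<forall>T\<in>J. op_scaleC c T \<in> J) \<and>
     (\<forall>S\<in>B. \<forall>T\<in>J. S o\<^sub>L T \<in> J \<and> T o\<^sub>L S \<in> J) \<and> closed J"

definition star_hom :: "'a op set \<Rightarrow> 'b op set \<Rightarrow> ('a op \<Rightarrow> 'b op) \<Rightarrow> bool" where
  "star_hom A B \<phi> \<longleftrightarrow>
     \<phi> ` A \<subseteq> B \<and>
     (\<forall>S\<in>A. \<forall>T\<in>A. \<phi> (S + T) = \<phi> S + \<phi> T) \<and> (\<forall>c. \<forall>T\<in>A. \<phi> (op_scaleC c T) = op_scaleC c (\<phi> T)) \<and>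
     (\<forall>S\<in>A. \<forall>T\<in>A. \<phi> (S o\<^sub>L T) = \<phi> S o\<^sub>L \<phi> T) \<and> (\<forall>T\<in>A. \<phi> (op_adj T) = op_adj (\<phi> T))"

text \<open>
  The spatial (minimal) tensor product.  The real span is already a complex subspace, because
  one may move a scalar into the first factor, which ranges over a complex subspace.
\<close>

definition min_tensor :: "'i op set \<Rightarrow> 'j op set \<Rightarrow> ('i \<times> 'j) op set" where
  "min_tensor B A = closure (span {op_tensor S T | S T. S \<in> B \<and> T \<in> A})"

text \<open>
  Exactness of \<open>A\<close>: tensoring with \<open>A\<close> turns each short exact sequence
  \<open>0 \<rightarrow> J \<rightarrow> B \<rightarrow> C \<rightarrow> 0\<close> of C*-algebras, i.e. \<open>J\<close> is a closed two-sided ideal of \<open>B\<close> and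
  \<open>q\<close> identifies \<open>B/J\<close> with \<open>C\<close>, into a short exact sequence
  \<open>0 \<rightarrow> J \<otimes> A \<rightarrow> B \<otimes> A \<rightarrow> C \<otimes> A \<rightarrow> 0\<close>, where \<open>F\<close> is the map induced by \<open>q\<close>.
  Exactness at \<open>J \<otimes> A\<close> is built in, as \<open>J \<otimes> A\<close> is a set of operators contained in \<open>B \<otimes> A\<close>.

  Here \<open>B\<close> and \<open>C\<close> act on \<open>\<ell>\<^sup>2\<close> spaces over the types \<open>'i\<close> and \<open>'j\<close>.  HOL cannot
  quantify over types inside a formula, so these are parameters: exactness is the statement
  with \<open>'i\<close> and \<open>'j\<close> left as free (universally quantified) type variables.
\<close>

definition exact_cstar_algebra :: "'i itself \<Rightarrow> 'j itself \<Rightarrow> 'a op set \<Rightarrow> bool" where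
  "exact_cstar_algebra _ _ A \<longleftrightarrow>
     cstar_algebra A \<and>
     (\<forall>(B :: 'i op set) J (C :: 'j op set) q.
        cstar_algebra B \<longrightarrow> closed_ideal J B \<longrightarrow> cstar_algebra C \<longrightarrow>
        star_hom B C q \<longrightarrow> q ` B = C \<longrightarrow> {S \<in> B. q S = 0} = J \<longrightarrow>
        (\<exists>F. star_hom (min_tensor B A) (min_tensor C A) F \<and>
             (\<forall>S\<in>B. \<forall>T\<in>A. F (op_tensor S T) = op_tensor (q S) T) \<and>
             F ` min_tensor B A = min_tensor C A \<and>
             {T \<in> min_tensor B A. F T = 0} = min_tensor J A))"


section \<open>Property A\<close>

text \<open>A graph is given by its vertex set \<open>V\<close> and a symmetric adjacency relation \<open>E\<close>.\<close>

definition graph_dist :: "('v \<times> 'v) set \<Rightarrow> 'v \<Rightarrow> 'v \<Rightarrow> enat" where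
  "graph_dist E x y = (INF n\<in>{n. (x, y) \<in> E ^^ n}. enat n)"

definition graph_ball :: "'v set \<Rightarrow> ('v \<times> 'v) set \<Rightarrow> nat \<Rightarrow> 'v \<Rightarrow> 'v set" where
  "graph_ball V E r x = {y \<in> V. graph_dist E x y \<le> enat r}"

text \<open>\<open>\<ell>\<^sup>2(V)\<close> is the space of those elements of \<open>'v ell2\<close> that vanish outside \<open>V\<close>.\<close>

definition property_A :: "'v set \<Rightarrow> ('v \<times> 'v) set \<Rightarrow> bool" where
  "property_A V E \<longleftrightarrow>
     (\<exists>\<sigma> :: nat \<Rightarrow> 'v \<Rightarrow> 'v ell2. \<forall>n\<ge>1.
        (\<forall>x\<in>V. norm (\<sigma> n x) = 1) \<and>
        (\<forall>x\<in>V. \<forall>y\<in>V. graph_dist E x y \<le> enat n \<longrightarrow> norm (\<sigma> n x - \<sigma> n y) \<le> 1 / real n) \<and>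
        (\<exists>R>0. \<forall>x\<in>V. {y. Rep_ell2 (\<sigma> n x) y \<noteq> 0} \<subseteq> graph_ball V E R x))"


section \<open>Uniformly recurrent subgroups\<close>

text \<open>The topology of \<open>{0,1}\<^sup>\<Gamma>\<close>, restricted to the indicator functions of subgroups.\<close>

definition sub_topology :: "('g, 'm) monoid_scheme \<Rightarrow> 'g set topology" where
  "sub_topology G = pullback_topology {H. subgroup H G} (\<lambda>H. \<lambda>g\<in>carrier G. g \<in> H)
     (product_topology (\<lambda>_. discrete_topology (UNIV :: bool set)) (carrier G))"

definition conj_subgroup :: "('g, 'm) monoid_scheme \<Rightarrow> 'g \<Rightarrow> 'g set \<Rightarrow> 'g set" where
  "conj_subgroup G g H = (\<lambda>h. g \<otimes>\<^bsub>G\<^esub> h \<otimes>\<^bsub>G\<^esub> inv\<^bsub>G\<^esub> g) ` H"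

definition closed_invariant :: "('g, 'm) monoid_scheme \<Rightarrow> 'g set set \<Rightarrow> bool" where
  "closed_invariant G Z \<longleftrightarrow>
     closedin (sub_topology G) Z \<and> (\<forall>g\<in>carrier G. \<forall>H\<in>Z. conj_subgroup G g H \<in> Z)"

definition urs :: "('g, 'm) monoid_scheme \<Rightarrow> 'g set set \<Rightarrow> bool" where
  "urs G Z \<longleftrightarrow> Z \<noteq> {} \<and> closed_invariant G Z \<and>
     (\<forall>Y\<subseteq>Z. Y \<noteq> {} \<longrightarrow> closed_invariant G Y \<longrightarrow> Y = Z)"


section \<open>Schreier graphs and local kernels\<close>

text \<open>Vertices of the Schreier graph are the left cosets \<open>lcosets\<^bsub>G\<^esub> H\<close>.\<close>

definition schreier_edge ::
  "('g, 'm) monoid_scheme \<Rightarrow> 'g set \<Rightarrow> 'g set \<Rightarrow> 'g \<Rightarrow> 'g set \<Rightarrow> 'g set \<Rightarrow> bool" where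
  "schreier_edge G Q H s x y \<longleftrightarrow>
     x \<in> lcosets\<^bsub>G\<^esub> H \<and> y \<in> lcosets\<^bsub>G\<^esub> H \<and>
     (\<exists>\<gamma>\<in>Q. (s = \<gamma> \<and> \<gamma> <#\<^bsub>G\<^esub> x = y) \<or> (s = inv\<^bsub>G\<^esub> \<gamma> \<and> \<gamma> <#\<^bsub>G\<^esub> y = x))"

definition schreier_adj ::
  "('g, 'm) monoid_scheme \<Rightarrow> 'g set \<Rightarrow> 'g set \<Rightarrow> ('g set \<times> 'g set) set" where
  "schreier_adj G Q H = {(x, y). \<exists>s. schreier_edge G Q H s x y \<or> schreier_edge G Q H s y x}"

abbreviation schreier_ball ::
  "('g, 'm) monoid_scheme \<Rightarrow> 'g set \<Rightarrow> 'g set \<Rightarrow> nat \<Rightarrow> 'g set \<Rightarrow> 'g set set" where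
  "schreier_ball G Q H \<equiv> graph_ball (lcosets\<^bsub>G\<^esub> H) (schreier_adj G Q H)"

definition ball_iso ::
  "('g, 'm) monoid_scheme \<Rightarrow> 'g set \<Rightarrow> 'g set \<Rightarrow> nat \<Rightarrow> 'g set \<Rightarrow> 'g set \<Rightarrow> ('g set \<Rightarrow> 'g set) \<Rightarrow> bool" where
  "ball_iso G Q H r y z \<theta> \<longleftrightarrow>
     bij_betw \<theta> (schreier_ball G Q H r y) (schreier_ball G Q H r z) \<and> \<theta> y = z \<and>
     (\<forall>s. \<forall>u\<in>schreier_ball G Q H r y. \<forall>v\<in>schreier_ball G Q H r y.
        schreier_edge G Q H s u v \<longleftrightarrow> schreier_edge G Q H s (\<theta> u) (\<theta> v))"

text \<open>Only the values of \<open>K\<close> on \<open>\<Gamma>/H \<times> \<Gamma>/H\<close> matter, here and in \<open>kernel_op\<close>.\<close>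

definition local_kernel ::
  "('g, 'm) monoid_scheme \<Rightarrow> 'g set \<Rightarrow> 'g set \<Rightarrow> ('g set \<Rightarrow> 'g set \<Rightarrow> complex) \<Rightarrow> bool" where
  "local_kernel G Q H K \<longleftrightarrow>
     (\<exists>R>0.
        (\<forall>x\<in>lcosets\<^bsub>G\<^esub> H. \<forall>y\<in>lcosets\<^bsub>G\<^esub> H.
           graph_dist (schreier_adj G Q H) x y > enat R \<longrightarrow> K x y = 0) \<and>
        (\<forall>y\<in>lcosets\<^bsub>G\<^esub> H. \<forall>z\<in>lcosets\<^bsub>G\<^esub> H. \<forall>\<theta>.
           ball_iso G Q H R y z \<theta> \<longrightarrow> (\<forall>w\<in>schreier_ball G Q H R y. K y w = K z (\<theta> w))))"

text \<open>
  An operator on \<open>\<ell>\<^sup>2(V)\<close> is identified with its extension by zero on the orthogonal complement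
  of \<open>\<ell>\<^sup>2(V)\<close> in \<open>'v ell2\<close>; this is an isometric *-isomorphism onto a corner.
\<close>

definition kernel_op :: "'v set \<Rightarrow> ('v \<Rightarrow> 'v \<Rightarrow> complex) \<Rightarrow> 'v op \<Rightarrow> bool" where
  "kernel_op V K T \<longleftrightarrow>
     (\<forall>f x. Rep_ell2 (blinfun_apply T f) x =
        (if x \<in> V then \<Sum>\<^sub>\<infinity>y\<in>V. K x y * Rep_ell2 f y else 0))"

text \<open>
  The algebra \<open>C\<^sub>r\<^sup>*(Z)\<close> computed with the point \<open>H\<close> of the uniformly recurrent subgroup \<open>Z\<close> and
  the generating system \<open>Q\<close>.
\<close>

definition cstar_r :: "('g, 'm) monoid_scheme \<Rightarrow> 'g set \<Rightarrow> 'g set \<Rightarrow> 'g set op set" where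
  "cstar_r G Q H = closure {T. \<exists>K. local_kernel G Q H K \<and> kernel_op (lcosets\<^bsub>G\<^esub> H) K T}"

end

theory Submission
  imports Defs
begin

text \<open>
  Let \<open>A\<close> be the closure of the local operators.  Tensoring a surjective homomorphism \<open>q : B \<rightarrow> C\<close> with
  kernel \<open>J\<close> by \<open>A\<close> gives a contractive homomorphism \<open>F\<close>, because \<open>q\<close> acts contractively on matrices
  over \<open>B\<close>; its range is closed, so it is onto.  The point is that \<open>F X = 0\<close> forces \<open>X \<in> J \<otimes> A\<close>.
  The matrix entries of \<open>X\<close> then form a totally bounded subset of \<open>J\<close>, so some \<open>u \<in> J\<close> acts on all of
  them almost as a unit, and the operator \<open>Z = X - (u \<otimes> 1) X\<close> has uniformly small entries.  Property A
  provides positive definite kernels of finite propagation tending to \<open>1\<close> near the diagonal.  Schur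
  multiplication by such a kernel is contractive and hardly changes \<open>Z\<close>, which is close to an operator
  of finite propagation, while it truncates \<open>Z\<close> to a bounded neighbourhood of the diagonal, where small
  entries give a small norm.  Hence \<open>X\<close> is a limit of elements \<open>(u \<otimes> 1) X\<close> of \<open>J \<otimes> A\<close>.
\<close>


section \<open>Square-summable functions and adjoints\<close>

text \<open>No spectral theory enters. The two functions of operators that are needed, a square root
  and \<open>h (1 + h)^-1\<close>, are fixed points of contractions inside the given algebra. Hence
  they belong to it, and the equations that characterise them survive any homomorphism;
  contractivity and closed range of homomorphisms come from this.

  The delicate point in the kernel argument is the order of choices. The unit \<open>u\<close> can
  be chosen only once it is known how small the entries of \<open>Z\<close> must be; that threshold
  depends on the propagation of an approximant, yet the approximant of \<open>Z\<close> involves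
  \<open>u\<close>. The circle is broken because \<open>(1 - u) \<otimes> 1\<close> acts on the
  first factor alone: it multiplies each matrix entry on the left, so it increases neither the
  propagation nor, being a contraction, the norm of an approximant of \<open>X\<close>. The
  threshold can therefore be fixed before \<open>u\<close>.

  That finitely many elements control all entries, however many indices there are, is special to the
  tensor product: the entries of \<open>S \<otimes> T\<close> are bounded scalar multiples of
  \<open>S\<close>.\<close>

lemma has_sum_complexI:
  assumes "((\<lambda>x. Re (f x)) has_sum Re s) A" "((\<lambda>x. Im (f x)) has_sum Im s) A"
  shows "(f has_sum s) A"
  using assms by (simp add: has_sum_def tendsto_complex_iff)

lemma norm_ell2_square: "(norm f)\<^sup>2 = (\<Sum>\<^sub>\<infinity>x. (cmod (Rep_ell2 f x))\<^sup>2)"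
  by (simp add: power2_norm_eq_inner inner_ell2_def)

lemma ell2_eqI: "(\<And>x. Rep_ell2 f x = Rep_ell2 g x) \<Longrightarrow> f = g"
  by (metis Rep_ell2_inject ext)

lemma sum_le_norm_ell2: "finite F \<Longrightarrow> (\<Sum>x\<in>F. (cmod (Rep_ell2 f x))\<^sup>2) \<le> (norm f)\<^sup>2"
  unfolding norm_ell2_square by (rule finite_sum_le_infsum[OF ell2_summable]) auto

lemma cmod_le_norm_ell2: "cmod (Rep_ell2 f x) \<le> norm f"
  using sum_le_norm_ell2[of "{x}" f] by (simp add: power2_le_iff_abs_le)

text \<open>Finite partial sums control summability and the norm at once. Vectors are produced below
  by this device: limits of Cauchy sequences, representing vectors of functionals, images under
  amplified operators.\<close>

lemma ell2_bounded_ex: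
  assumes "\<And>F. finite F \<Longrightarrow> (\<Sum>x\<in>F. (cmod (f x))\<^sup>2) \<le> b\<^sup>2" and "0 \<le> b"
  obtains g where "Rep_ell2 g = f" "norm g \<le> b"
proof -
  have *: "(\<lambda>x. (cmod (f x))\<^sup>2) summable_on UNIV"
    by (rule nonneg_bdd_above_summable_on) (use assms(1) in \<open>auto simp: bdd_above_def\<close>)
  then obtain g where g: "Rep_ell2 g = f" by (metis Abs_ell2_inverse mem_Collect_eq)
  have "(norm g)\<^sup>2 \<le> b\<^sup>2"
    unfolding norm_ell2_square g by (rule infsum_le_finite_sums[OF *]) (use assms(1) in auto)
  with g that \<open>0 \<le> b\<close> show ?thesis by (auto simp: power2_le_iff_abs_le)
qed

lemma norm_ell2_leI:
  assumes "\<And>F. finite F \<Longrightarrow> (\<Sum>x\<in>F. (cmod (Rep_ell2 f x))\<^sup>2) \<le> b\<^sup>2" and "0 \<le> b"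
  shows "norm f \<le> b"
  using ell2_bounded_ex[OF assms] by (metis Rep_ell2_inject)

instance ell2 :: (type) banach
proof
  fix X :: "nat \<Rightarrow> 'a ell2"
  assume X: "Cauchy X"
  have "Cauchy (\<lambda>n. Rep_ell2 (X n) x)" for x
  proof (rule metric_CauchyI)
    fix e :: real assume "0 < e"
    with X obtain N where N: "\<forall>m\<ge>N. \<forall>n\<ge>N. dist (X m) (X n) < e" by (meson metric_CauchyD)
    have "dist (Rep_ell2 (X m) x) (Rep_ell2 (X n) x) \<le> dist (X m) (X n)" for m n
      using cmod_le_norm_ell2[of "X m - X n" x] by (simp add: dist_norm minus_ell2.rep_eq)
    then have "\<forall>m\<ge>N. \<forall>n\<ge>N. dist (Rep_ell2 (X m) x) (Rep_ell2 (X n) x) < e"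
      using N le_less_trans by blast
    then show "\<exists>N. \<forall>m\<ge>N. \<forall>n\<ge>N. dist (Rep_ell2 (X m) x) (Rep_ell2 (X n) x) < e" ..
  qed
  then have "\<And>x. convergent (\<lambda>n. Rep_ell2 (X n) x)"
    by (simp add: Cauchy_convergent)
  then obtain l where l: "\<And>x. (\<lambda>n. Rep_ell2 (X n) x) \<longlonglongrightarrow> l x"
    unfolding convergent_def by metis
  \<comment> \<open>The coordinatewise limit is compared with \<open>X n\<close> on finite sets
    only, where the limit may be taken under the sum.\<close>
  have bd: "\<exists>N. \<forall>n\<ge>N. \<forall>F. finite F \<longrightarrow> (\<Sum>x\<in>F. (cmod (Rep_ell2 (X n) x - l x))\<^sup>2) \<le> e\<^sup>2"
    if "0 < e" for e :: real
  proof -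
    from that X obtain N where N: "\<forall>m\<ge>N. \<forall>n\<ge>N. dist (X m) (X n) < e" by (meson metric_CauchyD)
    have "(\<Sum>x\<in>F. (cmod (Rep_ell2 (X n) x - l x))\<^sup>2) \<le> e\<^sup>2" if "finite F" "n \<ge> N" for n F
    proof (rule tendsto_upperbound)
      show "(\<lambda>m. \<Sum>x\<in>F. (cmod (Rep_ell2 (X n) x - Rep_ell2 (X m) x))\<^sup>2)
          \<longlonglongrightarrow> (\<Sum>x\<in>F. (cmod (Rep_ell2 (X n) x - l x))\<^sup>2)"
        by (intro tendsto_intros l)
      have "(\<Sum>x\<in>F. (cmod (Rep_ell2 (X n) x - Rep_ell2 (X m) x))\<^sup>2) \<le> e\<^sup>2" if "m \<ge> N" for m
      proof -
        have "(\<Sum>x\<in>F. (cmod (Rep_ell2 (X n) x - Rep_ell2 (X m) x))\<^sup>2) \<le> (norm (X n - X m))\<^sup>2"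
          using sum_le_norm_ell2[OF \<open>finite F\<close>, of "X n - X m"] by (simp add: minus_ell2.rep_eq)
        also have "\<dots> \<le> e\<^sup>2"
          using N \<open>n \<ge> N\<close> \<open>m \<ge> N\<close> by (intro power_mono) (auto simp: dist_norm less_imp_le)
        finally show ?thesis .
      qed
      then show "\<forall>\<^sub>F m in sequentially. (\<Sum>x\<in>F. (cmod (Rep_ell2 (X n) x - Rep_ell2 (X m) x))\<^sup>2) \<le> e\<^sup>2"
        by (auto simp: eventually_sequentially)
    qed simp
    then show ?thesis by blast
  qed
  obtain N where N: "\<And>F. finite F \<Longrightarrow> (\<Sum>x\<in>F. (cmod (Rep_ell2 (X N) x - l x))\<^sup>2) \<le> 1\<^sup>2"
    using bd[of 1] by auto
  obtain d where d: "Rep_ell2 d = (\<lambda>x. Rep_ell2 (X N) x - l x)"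
    by (rule ell2_bounded_ex[OF N]) auto
  \<comment> \<open>The limit is square summable because it differs from \<open>X N\<close> by the
    square-summable \<open>d\<close>.\<close>
  define L where "L = X N - d"
  have L: "Rep_ell2 L x = l x" for x by (simp add: L_def minus_ell2.rep_eq d)
  have "X \<longlonglongrightarrow> L"
  proof (rule LIMSEQ_I)
    fix e :: real assume "0 < e"
    then obtain N where N: "\<forall>n\<ge>N. \<forall>F. finite F \<longrightarrow> (\<Sum>x\<in>F. (cmod (Rep_ell2 (X n) x - l x))\<^sup>2) \<le> (e/2)\<^sup>2"
      using bd[of "e/2"] by auto
    have "norm (X n - L) \<le> e/2" if "n \<ge> N" for n
      by (rule norm_ell2_leI) (use N that \<open>0 < e\<close> in \<open>auto simp: minus_ell2.rep_eq L\<close>)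
    then have "\<forall>n\<ge>N. norm (X n - L) < e" using \<open>0 < e\<close> by fastforce
    then show "\<exists>no. \<forall>n\<ge>no. norm (X n - L) < e" ..
  qed
  then show "convergent X" by (rule convergentI)
qed

section \<open>Coordinate vectors, density and Riesz representation\<close>

lift_definition ket :: "'a \<Rightarrow> complex \<Rightarrow> 'a ell2" is "\<lambda>x c y. if y = x then c else 0"
proof -
  fix x :: 'a and c
  have "(\<lambda>y. (cmod (if y = x then c else 0))\<^sup>2) summable_on {x}" by simp
  then show "(\<lambda>y. (cmod (if y = x then c else 0))\<^sup>2) summable_on UNIV"
    by (rule summable_on_cong_neutral[THEN iffD1, rotated -1]) auto
qed

lemma inner_ket: "inner f (ket x c) = inner (Rep_ell2 f x) c"
proof -
  have "inner f (ket x c) = (\<Sum>\<^sub>\<infinity>y\<in>{x}. inner (Rep_ell2 f y) (Rep_ell2 (ket x c) y))"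
    unfolding inner_ell2_def by (rule infsum_cong_neutral) (auto simp: ket.rep_eq)
  then show ?thesis by (simp add: ket.rep_eq)
qed

lemma norm_ket: "norm (ket x c) = cmod c"
  by (simp add: norm_eq_sqrt_inner inner_ket ket.rep_eq)

lemma ket_add: "ket x (c + d) = ket x c + ket x d"
  by (rule ell2_eqI) (simp add: ket.rep_eq plus_ell2.rep_eq)

lemma ket_scaleR: "ket x (r *\<^sub>R c) = r *\<^sub>R ket x c"
  by (rule ell2_eqI) (simp add: ket.rep_eq scaleR_ell2.rep_eq scaleR_conv_of_real)

lemma Rep_ell2_sum: "Rep_ell2 (\<Sum>i\<in>I. f i) x = (\<Sum>i\<in>I. Rep_ell2 (f i) x)"
  by (induction I rule: infinite_finite_induct) (auto simp: zero_ell2.rep_eq plus_ell2.rep_eq)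

lemma norm_sum_ket:
  assumes "finite F"
  shows "(norm (\<Sum>x\<in>F. ket x (f x)))\<^sup>2 = (\<Sum>x\<in>F. (cmod (f x))\<^sup>2)"
proof -
  have "Rep_ell2 (\<Sum>x\<in>F. ket x (f x)) y = (if y \<in> F then f y else 0)" for y
    using assms by (simp add: Rep_ell2_sum ket.rep_eq)
  then show ?thesis
    by (simp add: power2_norm_eq_inner inner_sum_right inner_ket)
qed

text \<open>Truncating \<open>f\<close> to a finite set is an orthogonal projection, so the squared
  error is a tail of the convergent sum for \<open>norm f\<close>. Real subspaces suffice because
  \<open>ket\<close> takes complex coefficients.\<close>

lemma ell2_dense:
  assumes "closed S" "subspace S" "\<And>x c. ket x c \<in> S"
  shows "f \<in> S"
proof -
  have "\<exists>g\<in>S. dist g f < e" if "0 < e" for e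
  proof -
    have "((\<lambda>x. (cmod (Rep_ell2 f x))\<^sup>2) has_sum (norm f)\<^sup>2) UNIV"
      using ell2_summable[of f] norm_ell2_square[of f] by simp
    then have "\<forall>\<^sub>F F in finite_subsets_at_top UNIV. dist (\<Sum>x\<in>F. (cmod (Rep_ell2 f x))\<^sup>2) ((norm f)\<^sup>2) < e\<^sup>2"
      unfolding has_sum_def using that by (intro tendstoD) auto
    then obtain F where F: "finite F" "dist (\<Sum>x\<in>F. (cmod (Rep_ell2 f x))\<^sup>2) ((norm f)\<^sup>2) < e\<^sup>2"
      by (auto simp: eventually_finite_subsets_at_top)
    define g where "g = (\<Sum>x\<in>F. ket x (Rep_ell2 f x))"
    have "inner f g = (\<Sum>x\<in>F. (cmod (Rep_ell2 f x))\<^sup>2)"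
      by (simp add: g_def inner_sum_right inner_ket power2_norm_eq_inner)
    moreover have "(norm g)\<^sup>2 = (\<Sum>x\<in>F. (cmod (Rep_ell2 f x))\<^sup>2)"
      by (simp add: g_def norm_sum_ket F)
    ultimately have "(dist g f)\<^sup>2 = (norm f)\<^sup>2 - (\<Sum>x\<in>F. (cmod (Rep_ell2 f x))\<^sup>2)"
      by (simp add: dist_norm power2_norm_eq_inner inner_diff inner_commute)
    also have "\<dots> < e\<^sup>2" using F(2) by (simp add: dist_real_def)
    finally have "dist g f < e" using that by (meson less_imp_le power_less_imp_less_base)
    moreover have "g \<in> S" unfolding g_def by (intro subspace_sum assms)
    ultimately show ?thesis by blast
  qed
  then show ?thesis using \<open>closed S\<close> by (metis closed_approachable)
qed

text \<open>A real functional determines a complex coordinate through its values at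
  \<open>ket x 1\<close> and \<open>ket x \<i>\<close>. Testing \<open>\<phi>\<close> on the
  truncated candidate \<open>v\<close> itself gives
  \<open>(norm v)^2 = \<phi> v \<le> norm v * K\<close>, which bounds all truncations at
  once.\<close>

lemma ell2_riesz:
  fixes \<phi> :: "'a ell2 \<Rightarrow> real"
  assumes "bounded_linear \<phi>"
  obtains g where "\<And>f. \<phi> f = inner f g"
proof -
  interpret bounded_linear \<phi> by fact
  define G where "G x = Complex (\<phi> (ket x 1)) (\<phi> (ket x \<i>))" for x
  have k: "\<phi> (ket x c) = inner c (G x)" for x c
  proof -
    have "c = Re c *\<^sub>R 1 + Im c *\<^sub>R \<i>" by (simp add: complex_eq_iff)
    then have "ket x c = Re c *\<^sub>R ket x 1 + Im c *\<^sub>R ket x \<i>" by (metis ket_add ket_scaleR)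
    then show ?thesis by (simp add: add scale G_def inner_complex_def)
  qed
  obtain K where K: "K > 0" "\<And>f. norm (\<phi> f) \<le> norm f * K" using pos_bounded by auto
  have "(\<Sum>x\<in>F. (cmod (G x))\<^sup>2) \<le> K\<^sup>2" if "finite F" for F
  proof -
    define v where "v = (\<Sum>x\<in>F. ket x (G x))"
    have v: "(\<Sum>x\<in>F. (cmod (G x))\<^sup>2) = (norm v)\<^sup>2" by (simp add: v_def norm_sum_ket that)
    have "\<phi> v = (norm v)\<^sup>2" unfolding v[symmetric] by (simp add: v_def sum k power2_norm_eq_inner)
    with K(2)[of v] have "norm v * norm v \<le> norm v * K" by (simp add: power2_eq_square)
    then have "norm v \<le> K" using \<open>K > 0\<close> by (cases "norm v = 0") auto
    then show ?thesis unfolding v by (intro power_mono) auto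
  qed
  from ell2_bounded_ex[OF this] K(1) obtain g where g: "Rep_ell2 g = G" by auto
  have "f \<in> {f. \<phi> f = inner f g}" for f
  proof (rule ell2_dense)
    show "closed {f. \<phi> f = inner f g}"
      by (intro closed_Collect_eq linear_continuous_on assms) (simp add: bounded_linear_inner_left)
    show "subspace {f. \<phi> f = inner f g}"
      by (auto simp: subspace_def add scale zero inner_add_left)
  qed (simp add: k inner_commute[of _ g] inner_ket g, simp add: inner_commute)
  with that show ?thesis by blast
qed

text \<open>The adjoint for the real inner product. It makes sense between different index types,
  which turns \<open>emb\<close> into \<open>slice\<close> below; \<open>op_adj_eq\<close>
  identifies it with \<open>op_adj\<close> on complex linear operators.\<close>

definition adj :: "('a ell2 \<Rightarrow>\<^sub>L 'b ell2) \<Rightarrow> ('b ell2 \<Rightarrow>\<^sub>L 'a ell2)" where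
  "adj T = (SOME S. \<forall>f g. inner (blinfun_apply T f) g = inner f (blinfun_apply S g))"

lemma adj_inner: "inner (blinfun_apply T f) g = inner f (blinfun_apply (adj T) g)"
proof -
  have "\<exists>h. \<forall>f. inner (T f) g = inner f h" for g
    by (rule ell2_riesz[of "\<lambda>f. inner (T f) g"])
       (auto intro!: bounded_linear_compose[OF bounded_linear_inner_left] blinfun.bounded_linear_right)
  then obtain S where S: "\<And>f g. inner (T f) g = inner f (S g)" by metis
  have "bounded_linear S"
  proof (rule bounded_linear_intro)
    show "S (x + y) = S x + S y" for x y
      by (rule vector_eq_ldot[THEN iffD1]) (simp add: S[symmetric] inner_add_right)
    show "S (r *\<^sub>R x) = r *\<^sub>R S x" for r x
      by (rule vector_eq_ldot[THEN iffD1]) (simp add: S[symmetric])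
    show "norm (S x) \<le> norm x * norm T" for x
    proof -
      have "norm (S x) * norm (S x) = inner (T (S x)) x"
        by (simp add: S power2_norm_eq_inner flip: power2_eq_square)
      also have "\<dots> \<le> norm (T (S x)) * norm x" by (rule norm_cauchy_schwarz)
      also have "\<dots> \<le> (norm T * norm (S x)) * norm x"
        by (intro mult_right_mono norm_blinfun) auto
      finally show ?thesis by (cases "norm (S x) = 0") (auto simp: mult_ac)
    qed
  qed
  then have "\<forall>f g. inner (T f) g = inner f (Blinfun S g)"
    by (simp add: bounded_linear_Blinfun_apply S)
  then have "\<forall>f g. inner (T f) g = inner f (adj T g)"
    unfolding adj_def by (rule someI)
  then show ?thesis by blast
qed

lemma adj_eqI: "(\<And>f g. inner (blinfun_apply T f) g = inner f (blinfun_apply S g)) \<Longrightarrow> adj T = S"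
  by (rule blinfun_eqI, rule vector_eq_ldot[THEN iffD1]) (simp add: adj_inner[symmetric])

lemma adj_adj [simp]: "adj (adj T) = T"
  by (rule adj_eqI) (metis adj_inner inner_commute)

lemma adj_add: "adj (S + T) = adj S + adj T"
  by (rule adj_eqI) (simp add: blinfun.add_left inner_add adj_inner)

lemma adj_scaleR: "adj (r *\<^sub>R T) = r *\<^sub>R adj T"
  by (rule adj_eqI) (simp add: blinfun.scaleR_left adj_inner)

lemma adj_compose: "adj (S o\<^sub>L T) = adj T o\<^sub>L adj S"
  by (rule adj_eqI) (simp add: adj_inner)

lemma adj_id [simp]: "adj id_blinfun = id_blinfun"
  by (rule adj_eqI) simp

lemma adj_0 [simp]: "adj 0 = 0"
  by (rule adj_eqI) simp

lemma adj_diff: "adj (S - T) = adj S - adj T"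
  by (rule adj_eqI) (simp add: blinfun.diff_left inner_diff adj_inner)

lemma adj_sum: "adj (\<Sum>i\<in>I. f i) = (\<Sum>i\<in>I. adj (f i))"
  by (induction I rule: infinite_finite_induct) (auto simp: adj_add)

lemma norm_adj_le: "norm (adj T) \<le> norm T"
proof (rule norm_blinfun_bound)
  fix x
  have "norm (adj T x) * norm (adj T x) = inner (T (adj T x)) x"
    by (simp add: adj_inner power2_norm_eq_inner flip: power2_eq_square)
  also have "\<dots> \<le> norm (T (adj T x)) * norm x" by (rule norm_cauchy_schwarz)
  also have "\<dots> \<le> (norm T * norm (adj T x)) * norm x"
    by (intro mult_right_mono norm_blinfun) auto
  finally show "norm (adj T x) \<le> norm T * norm x" by (cases "norm (adj T x) = 0") (auto simp: mult_ac)
qed simp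

lemma norm_adj [simp]: "norm (adj T) = norm T"
  by (metis adj_adj antisym norm_adj_le)

lemma bounded_linear_adj: "bounded_linear adj"
  by (rule bounded_linear_intro[where K = 1]) (auto simp: adj_add adj_scaleR)

lemma blinfun_eq_on_ket:
  fixes S T :: "'a ell2 \<Rightarrow>\<^sub>L 'b ell2"
  assumes "\<And>x c. blinfun_apply S (ket x c) = blinfun_apply T (ket x c)"
  shows "S = T"
proof (rule blinfun_eqI)
  fix f
  have "f \<in> {f. S f = T f}"
    by (rule ell2_dense)
       (auto simp: subspace_def blinfun.add_right blinfun.scaleR_right assms
         intro!: closed_Collect_eq continuous_intros)
  then show "S f = T f" by simp
qed

section \<open>Complex scalars and complex linearity\<close>

lemma scaleC_add_right: "scaleC c (f + g) = scaleC c f + scaleC c g"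
  by (rule ell2_eqI) (simp add: scaleC.rep_eq plus_ell2.rep_eq algebra_simps)

lemma scaleC_add_left: "scaleC (c + d) f = scaleC c f + scaleC d f"
  by (rule ell2_eqI) (simp add: scaleC.rep_eq plus_ell2.rep_eq algebra_simps)

lemma scaleC_scaleR_right: "scaleC c (r *\<^sub>R f) = r *\<^sub>R scaleC c f"
  by (rule ell2_eqI) (simp add: scaleC.rep_eq scaleR_ell2.rep_eq)

lemma scaleC_of_real: "scaleC (complex_of_real r) f = r *\<^sub>R f"
  by (rule ell2_eqI) (simp add: scaleC.rep_eq scaleR_ell2.rep_eq)

lemma scaleC_scaleC: "scaleC c (scaleC d f) = scaleC (c * d) f"
  by (rule ell2_eqI) (simp add: scaleC.rep_eq)

lemma scaleC_ket: "scaleC c (ket x d) = ket x (c * d)"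
  by (rule ell2_eqI) (simp add: scaleC.rep_eq ket.rep_eq)

lemma inner_scaleC: "inner (scaleC c f) g = inner f (scaleC (cnj c) g)"
  by (simp add: inner_ell2_def scaleC.rep_eq inner_complex_def algebra_simps)

lemma norm_scaleC: "norm (scaleC c f) = cmod c * norm f"
proof -
  have "(norm (scaleC c f))\<^sup>2 = (cmod c * norm f)\<^sup>2"
    by (simp add: norm_ell2_square scaleC.rep_eq norm_mult power_mult_distrib infsum_cmult_right')
  then show ?thesis by (simp add: power2_eq_iff_nonneg)
qed

lemma bounded_linear_scaleC: "bounded_linear (scaleC c)"
  by (rule bounded_linear_intro[where K = "cmod c"])
     (auto simp: scaleC_add_right scaleC_scaleR_right norm_scaleC mult.commute)

definition scal :: "complex \<Rightarrow> 'a op" where "scal c = Blinfun (scaleC c)"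

lemma scal_apply [simp]: "blinfun_apply (scal c) f = scaleC c f"
  by (simp add: scal_def bounded_linear_Blinfun_apply bounded_linear_scaleC)

lemma op_scaleC_eq: "op_scaleC c T = scal c o\<^sub>L T"
proof -
  have "(\<lambda>f. scaleC c (T f)) = blinfun_apply (scal c o\<^sub>L T)" by auto
  then show ?thesis by (simp add: op_scaleC_def blinfun_apply_inverse)
qed

lemma op_scaleC_apply [simp]: "blinfun_apply (op_scaleC c T) f = scaleC c (blinfun_apply T f)"
  by (simp add: op_scaleC_eq)

lemma op_scaleC_of_real: "op_scaleC (complex_of_real r) T = r *\<^sub>R T"
  by (rule blinfun_eqI) (simp add: scaleC_of_real blinfun.scaleR_left)

lemma bounded_linear_op_scaleC: "bounded_linear (op_scaleC c)"
  unfolding op_scaleC_eq[abs_def]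
  by (rule bounded_bilinear.bounded_linear_right[OF bounded_bilinear_blinfun_compose])

lemma norm_op_scaleC_le: "norm (op_scaleC c T) \<le> cmod c * norm T"
  by (rule norm_blinfun_bound) (auto simp: norm_scaleC mult.assoc intro!: mult_left_mono norm_blinfun)

lemma op_clinearD: "op_clinear T \<Longrightarrow> blinfun_apply T (scaleC c f) = scaleC c (blinfun_apply T f)"
  by (simp add: op_clinear_def)

lemma op_clinear_adj: "op_clinear T \<Longrightarrow> op_clinear (adj T)"
  unfolding op_clinear_def[of "adj T"]
proof (intro allI, rule vector_eq_ldot[THEN iffD1], rule allI)
  fix c f z assume T: "op_clinear T"
  have "inner z (adj T (scaleC c f)) = inner (T (scaleC (cnj c) z)) f"
    unfolding op_clinearD[OF T] inner_scaleC adj_inner[symmetric] by simp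
  also have "\<dots> = inner z (scaleC c (adj T f))"
    unfolding adj_inner inner_scaleC by simp
  finally show "inner z (adj T (scaleC c f)) = inner z (scaleC c (adj T f))" .
qed

text \<open>The imaginary part is a real inner product after rotating one argument, so both parts
  are summable by \<open>ell2_inner_summable\<close>.\<close>

lemma Re_cinner: "Re (cinner f g) = inner f g"
  and Im_cinner: "Im (cinner f g) = inner (scaleC (- \<i>) f) g"
proof -
  let ?h = "\<lambda>x. Rep_ell2 f x * cnj (Rep_ell2 g x)"
  have re: "Re (?h x) = inner (Rep_ell2 f x) (Rep_ell2 g x)" for x
    by (simp add: inner_complex_def)
  have im: "Im (?h x) = inner (Rep_ell2 (scaleC (-\<i>) f) x) (Rep_ell2 g x)" for x
    by (simp add: inner_complex_def scaleC.rep_eq)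
  have "(\<lambda>x. Re (?h x)) summable_on UNIV" unfolding re by (rule ell2_inner_summable)
  moreover have "(\<lambda>x. Im (?h x)) summable_on UNIV" unfolding im by (rule ell2_inner_summable)
  ultimately have *: "?h summable_on UNIV"
    unfolding summable_on_def by (metis has_sum_complexI complex.sel)
  show "Re (cinner f g) = inner f g"
    using infsum_Re[OF *] unfolding cinner_def re by (simp add: inner_ell2_def)
  show "Im (cinner f g) = inner (scaleC (- \<i>) f) g"
    using infsum_Im[OF *] unfolding cinner_def im by (simp add: inner_ell2_def)
qed

lemma op_adj_eq:
  assumes "op_clinear T"
  shows "op_adj T = adj T"
  unfolding op_adj_def
proof (rule the_equality)
  show "\<forall>f g. cinner (T f) g = cinner f (adj T g)"
    by (simp add: complex_eq_iff Re_cinner Im_cinner adj_inner flip: op_clinearD[OF assms])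
  fix S assume "\<forall>f g. cinner (blinfun_apply T f) g = cinner f (blinfun_apply S g)"
  then have "inner (T f) g = inner f (blinfun_apply S g)" for f g by (metis Re_cinner)
  then show "S = adj T" by (metis adj_eqI)
qed

lemma op_clinear_simps:
  "op_clinear (0 :: 'b op)" "op_clinear id_blinfun" "op_clinear S \<Longrightarrow> op_clinear T \<Longrightarrow> op_clinear (S + T)"
  "op_clinear S \<Longrightarrow> op_clinear T \<Longrightarrow> op_clinear (S o\<^sub>L T)" "op_clinear T \<Longrightarrow> op_clinear (op_scaleC c T)"
  "op_clinear T \<Longrightarrow> op_clinear (r *\<^sub>R T)"
proof -
  have "scaleC c 0 = (0 :: 'b ell2)" for c by (rule ell2_eqI) (simp add: scaleC.rep_eq zero_ell2.rep_eq)
  then show "op_clinear (0 :: 'b op)" by (simp add: op_clinear_def)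
qed (auto simp: op_clinear_def blinfun.add_left blinfun.scaleR_left scaleC_add_right scaleC_scaleR_right
      scaleC_scaleC mult.commute)

text \<open>Complex linearity means commuting with every \<open>scal c\<close>, and commutants are
  closed.\<close>

lemma closed_op_clinear: "closed {T. op_clinear T}"
proof -
  have "{T :: 'a op. op_clinear T} = (\<Inter>c. {T. T o\<^sub>L scal c = scal c o\<^sub>L T})"
    by (auto simp: op_clinear_def intro!: blinfun_eqI) (metis blinfun_apply_blinfun_compose scal_apply)
  moreover have "closed {T :: 'a op. T o\<^sub>L scal c = scal c o\<^sub>L T}" for c
    by (intro closed_Collect_eq continuous_intros
        bounded_bilinear.continuous_on[OF bounded_bilinear_blinfun_compose])
  ultimately show ?thesis by auto
qed

text \<open>Row \<open>x\<close> of \<open>T\<close> is encoded by the vectors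
  \<open>adj T (ket x c)\<close>, so the series is an inner product and converges;
  \<open>c = 1\<close> and \<open>c = \<i>\<close> give its real and imaginary parts.\<close>

lemma op_apply_has_sum:
  assumes "op_clinear T"
  shows "((\<lambda>y. Rep_ell2 (T (ket y 1)) x * Rep_ell2 f y) has_sum Rep_ell2 (T f) x) UNIV"
proof -
  define h where "h c = adj T (ket x c)" for c
  have h: "inner (Rep_ell2 f y) (Rep_ell2 (h c) y) = inner (Rep_ell2 (T (ket y 1)) x * Rep_ell2 f y) c" for c y
  proof -
    have "inner (Rep_ell2 f y) (Rep_ell2 (h c) y) = inner (ket y (Rep_ell2 f y)) (h c)"
      by (metis inner_commute inner_ket)
    also have "\<dots> = inner (T (scaleC (Rep_ell2 f y) (ket y 1))) (ket x c)"
      by (simp add: h_def scaleC_ket adj_inner)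
    also have "\<dots> = inner (Rep_ell2 (T (ket y 1)) x * Rep_ell2 f y) c"
      by (simp add: op_clinearD[OF assms] inner_ket scaleC.rep_eq mult.commute)
    finally show ?thesis .
  qed
  have s: "((\<lambda>y. inner (Rep_ell2 (T (ket y 1)) x * Rep_ell2 f y) c) has_sum inner (Rep_ell2 (T f) x) c) UNIV" for c
  proof -
    have "inner (Rep_ell2 (T f) x) c = inner f (h c)"
      by (simp add: h_def inner_ket flip: adj_inner)
    then show ?thesis
      using has_sum_infsum[OF ell2_inner_summable[of f "h c"]] by (simp add: h inner_ell2_def)
  qed
  show ?thesis using s[of 1] s[of \<i>] by (intro has_sum_complexI) (simp_all add: inner_complex_def)
qed

section \<open>Closed spans under bounded linear and bilinear maps\<close>

lemma subspace_closure:
  fixes S :: "'a::real_normed_vector set"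
  assumes "subspace S"
  shows "subspace (closure S)"
  unfolding subspace_def
proof (intro conjI ballI allI)
  show "0 \<in> closure S" using assms closure_subset subspace_0 by blast
  show "x + y \<in> closure S" if "x \<in> closure S" "y \<in> closure S" for x y
  proof -
    from that obtain f g where "\<And>n::nat. f n \<in> S" "f \<longlonglongrightarrow> x" "\<And>n::nat. g n \<in> S" "g \<longlonglongrightarrow> y"
      by (meson closure_sequential)
    then have "(\<lambda>n. f n + g n) \<longlonglongrightarrow> x + y" "\<And>n. f n + g n \<in> S"
      using assms by (auto intro: tendsto_add subspace_add)
    then show ?thesis by (metis closure_sequential)
  qed
  show "c *\<^sub>R x \<in> closure S" if "x \<in> closure S" for c x
  proof -
    from that obtain f where "\<And>n::nat. f n \<in> S" "f \<longlonglongrightarrow> x" by (meson closure_sequential)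
    then have "(\<lambda>n. c *\<^sub>R f n) \<longlonglongrightarrow> c *\<^sub>R x" "\<And>n. c *\<^sub>R f n \<in> S"
      using assms by (auto intro: tendsto_intros subspace_scale)
    then show ?thesis by (metis closure_sequential)
  qed
qed

text \<open>The preimage of a closed subspace under a bounded linear map is a closed subspace.
  Closure properties of minimal tensor products and of \<open>cstar_r\<close> are later checked on
  generators in this way.\<close>

lemma bounded_linear_closure_subset:
  assumes "bounded_linear u" "\<And>a. a \<in> S \<Longrightarrow> u a \<in> closure (span S')" "a \<in> closure (span S)"
  shows "u a \<in> closure (span S')"
proof -
  interpret bounded_linear u by fact
  have cl: "closed {a. u a \<in> closure (span S')}"
    using continuous_closed_vimage[of "closure (span S')" u] assms(1)
    by (simp add: vimage_def linear_continuous_at)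
  have "subspace (closure (span S'))" by (intro subspace_closure subspace_span)
  then have "subspace {a. u a \<in> closure (span S')}"
    by (auto simp: subspace_def add scale zero)
  then have "span S \<subseteq> {a. u a \<in> closure (span S')}" using assms(2) by (intro span_minimal) auto
  then have "closure (span S) \<subseteq> {a. u a \<in> closure (span S')}" using cl by (rule closure_minimal)
  with assms(3) show ?thesis by auto
qed

lemma bounded_bilinear_closure_subset:
  assumes "bounded_bilinear p" "\<And>a b. a \<in> S \<Longrightarrow> b \<in> S' \<Longrightarrow> p a b \<in> closure (span U)"
    and "a \<in> closure (span S)" "b \<in> closure (span S')"
  shows "p a b \<in> closure (span U)"
proof -
  interpret bounded_bilinear p by fact
  have *: "p a b \<in> closure (span U)" if "a \<in> S" for a
    by (rule bounded_linear_closure_subset[OF bounded_linear_right _ assms(4)]) (use assms(2) that in auto)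
  show ?thesis
    by (rule bounded_linear_closure_subset[OF bounded_linear_left _ assms(3)]) (use * in auto)
qed


section \<open>Homomorphisms of concrete C*-algebras\<close>

text \<open>Closed real self-adjoint algebras: general enough to cover kernels of homomorphisms and
  finite matrices over a C*-algebra, strong enough for the fixed point arguments below.\<close>

locale star_subalgebra =
  fixes A :: "'a op set"
  assumes closed: "closed A" and subspace: "subspace A"
    and compose: "S \<in> A \<Longrightarrow> T \<in> A \<Longrightarrow> S o\<^sub>L T \<in> A"
    and adj: "T \<in> A \<Longrightarrow> adj T \<in> A"

locale star_subalgebra_hom = star_subalgebra +
  fixes \<phi> :: "'a op \<Rightarrow> 'b op"
  assumes hom_add: "S \<in> A \<Longrightarrow> T \<in> A \<Longrightarrow> \<phi> (S + T) = \<phi> S + \<phi> T"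
    and hom_scaleR: "T \<in> A \<Longrightarrow> \<phi> (r *\<^sub>R T) = r *\<^sub>R \<phi> T"
    and hom_compose: "S \<in> A \<Longrightarrow> T \<in> A \<Longrightarrow> \<phi> (S o\<^sub>L T) = \<phi> S o\<^sub>L \<phi> T"
    and hom_adj: "T \<in> A \<Longrightarrow> \<phi> (adj T) = adj (\<phi> T)"

lemma norm_compose_diff_le:
  fixes d d' :: "'a::real_normed_vector \<Rightarrow>\<^sub>L 'a"
  assumes "norm d \<le> r" "norm d' \<le> r"
  shows "norm ((d o\<^sub>L d) - (d' o\<^sub>L d')) \<le> 2 * r * norm (d - d')"
proof -
  have "(d o\<^sub>L d) - (d' o\<^sub>L d') = (d o\<^sub>L (d - d')) + ((d - d') o\<^sub>L d')"
    by (simp add: bounded_bilinear.diff_left[OF bounded_bilinear_blinfun_compose]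
        bounded_bilinear.diff_right[OF bounded_bilinear_blinfun_compose])
  also have "norm \<dots> \<le> norm (d o\<^sub>L (d - d')) + norm ((d - d') o\<^sub>L d')" by (rule norm_triangle_ineq)
  also have "\<dots> \<le> norm d * norm (d - d') + norm (d - d') * norm d'"
    by (intro add_mono norm_blinfun_compose)
  also have "\<dots> \<le> r * norm (d - d') + norm (d - d') * r"
    by (intro add_mono mult_right_mono mult_left_mono assms norm_ge_zero)
  finally show ?thesis by simp
qed

lemma norm_adj_compose_le: "norm (adj T o\<^sub>L T) \<le> (norm T)\<^sup>2"
  using norm_blinfun_compose[of "adj T" T] by (simp add: power2_eq_square)

text \<open>Unit-free form of \<open>(1 - d)^2 = 1 - adj T o\<^sub>L T\<close>, since
  \<open>A\<close> may lack a unit. Half of \<open>(adj T o\<^sub>L T) + (d o\<^sub>L d)\<close>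
  maps the self-adjoint elements of norm at most \<open>norm T\<close> to themselves and contracts
  distances there by the factor \<open>norm T\<close>; as \<open>A\<close> is closed, the fixed
  point lies in it.\<close>

lemma (in star_subalgebra) sqrt_fixpoint:
  assumes "T \<in> A" "norm T < 1"
  obtains d where "d \<in> A" "adj d = d" "2 *\<^sub>R d = (adj T o\<^sub>L T) + (d o\<^sub>L d)"
proof -
  define r where "r = norm T"
  define h where "h = adj T o\<^sub>L T"
  define s where "s = {d \<in> A. adj d = d \<and> norm d \<le> r}"
  define f where "f d = (1/2) *\<^sub>R (h + (d o\<^sub>L d))" for d
  have r: "0 \<le> r" "r < 1" using assms by (auto simp: r_def)
  have hA: "h \<in> A" unfolding h_def by (intro compose adj assms)
  have hr: "norm h \<le> r * r" using norm_adj_compose_le[of T] by (simp add: h_def r_def power2_eq_square)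
  have "s = A \<inter> {d. adj d = d} \<inter> cball 0 r" by (auto simp: s_def)
  moreover have "closed {d :: 'a op. adj d = d}"
    by (intro closed_Collect_eq linear_continuous_on bounded_linear_adj continuous_intros)
  ultimately have "closed s" by (auto intro!: closed_Int closed)
  then have "complete s" by (simp add: complete_eq_closed)
  moreover have "s \<noteq> {}" using r subspace by (auto simp: s_def subspace_0 intro!: exI[of _ 0])
  moreover have "f ` s \<subseteq> s"
  proof (safe)
    fix d assume d: "d \<in> s"
    have "norm (h + (d o\<^sub>L d)) \<le> norm h + norm d * norm d"
      by (meson norm_triangle_le add_left_mono norm_blinfun_compose)
    also have "\<dots> \<le> r * r + r * r" using d hr r by (intro add_mono mult_mono) (auto simp: s_def)
    also have "\<dots> \<le> r + r" using r by (intro add_mono) (auto simp: mult_left_le)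
    finally show "f d \<in> s"
      using d hA by (auto simp: s_def f_def adj_add adj_scaleR adj_compose h_def
          intro!: subspace_scale[OF subspace] subspace_add[OF subspace] compose)
  qed
  moreover have "dist (f d) (f d') \<le> r * dist d d'" if "d \<in> s" "d' \<in> s" for d d'
  proof -
    have "f d - f d' = (1/2) *\<^sub>R ((d o\<^sub>L d) - (d' o\<^sub>L d'))" by (simp add: f_def algebra_simps)
    then show ?thesis
      using norm_compose_diff_le[of d r d'] that by (simp add: dist_norm s_def)
  qed
  ultimately obtain d where d: "d \<in> s" "f d = d"
    using Banach_fix[of s r f] r by blast
  then have "2 *\<^sub>R f d = 2 *\<^sub>R d" by simp
  then have "2 *\<^sub>R d = h + (d o\<^sub>L d)" by (simp add: f_def)
  with d that show ?thesis by (auto simp: s_def h_def)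
qed

context star_subalgebra_hom begin

lemma hom_0: "\<phi> 0 = 0"
  using hom_scaleR[of 0 0] subspace_0[OF subspace] by simp

lemma hom_diff: "S \<in> A \<Longrightarrow> T \<in> A \<Longrightarrow> \<phi> (S - T) = \<phi> S - \<phi> T"
  using hom_add[of S "- T"] hom_scaleR[of T "-1"] subspace_neg[OF subspace, of T] by simp

lemma hom_sum: "(\<And>i. i \<in> I \<Longrightarrow> f i \<in> A) \<Longrightarrow> \<phi> (\<Sum>i\<in>I. f i) = (\<Sum>i\<in>I. \<phi> (f i))"
  by (induction I rule: infinite_finite_induct) (auto simp: hom_0 hom_add subspace_sum[OF subspace])

text \<open>
  For \<open>norm T < 1\<close>, \<open>1 - T\<^sup>*T\<close> is the square of a self-adjoint element \<open>1 - d\<close> of the unitization,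
  and this is preserved by homomorphisms.
\<close>

lemma hom_norm_le:
  assumes "T \<in> A"
  shows "norm (\<phi> T) \<le> norm T"
proof -
  have *: "norm (\<phi> T) \<le> 1" if T: "T \<in> A" "norm T < 1" for T
  proof (rule norm_blinfun_bound)
    fix v
    obtain d where d: "d \<in> A" "adj d = d" "2 *\<^sub>R d = (adj T o\<^sub>L T) + (d o\<^sub>L d)"
      using sqrt_fixpoint[OF T] by blast
    have "\<phi> (2 *\<^sub>R d) = \<phi> ((adj T o\<^sub>L T) + (d o\<^sub>L d))" by (simp add: d)
    then have e: "2 *\<^sub>R \<phi> d = (adj (\<phi> T) o\<^sub>L \<phi> T) + (\<phi> d o\<^sub>L \<phi> d)"
      using T d(1) by (simp add: hom_scaleR hom_add hom_compose hom_adj compose adj)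
    have sa: "adj (\<phi> d) = \<phi> d" using d(1,2) by (metis hom_adj)
    have "2 * inner v (\<phi> d v) = inner v ((2 *\<^sub>R \<phi> d) v)" by (simp add: blinfun.scaleR_left)
    also have "\<dots> = inner v (adj (\<phi> T) (\<phi> T v)) + inner v (\<phi> d (\<phi> d v))"
      unfolding e by (simp add: blinfun.add_left inner_add_right)
    also have "\<dots> = (norm (\<phi> T v))\<^sup>2 + (norm (\<phi> d v))\<^sup>2"
      by (simp add: power2_norm_eq_inner adj_inner sa)
    \<comment> \<open>With the next two facts this says that
      \<open>(norm v)^2 - (norm (\<phi> T v))^2\<close> equals
      \<open>(norm (v - \<phi> d v))^2\<close>, which is nonnegative.\<close>
    finally have "(norm (\<phi> T v))\<^sup>2 = 2 * inner v (\<phi> d v) - (norm (\<phi> d v))\<^sup>2" by simp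
    moreover have "0 \<le> (norm (v - \<phi> d v))\<^sup>2" by simp
    moreover have "(norm (v - \<phi> d v))\<^sup>2 = (norm v)\<^sup>2 - 2 * inner v (\<phi> d v) + (norm (\<phi> d v))\<^sup>2"
      by (simp add: power2_norm_eq_inner inner_diff inner_commute)
    ultimately have "(norm (\<phi> T v))\<^sup>2 \<le> (norm v)\<^sup>2" by linarith
    then show "norm (\<phi> T v) \<le> 1 * norm v" by (simp add: power2_le_iff_abs_le)
  qed simp
  show ?thesis
  proof (rule field_le_epsilon)
    fix e :: real assume "0 < e"
    \<comment> \<open>Scaling by a number strictly above \<open>norm T\<close> gives norm below 1,
      and also covers \<open>T = 0\<close>.\<close>
    define t where "t = norm T + e"
    have t: "t > 0" "norm T < t" using \<open>0 < e\<close> by (auto simp: t_def add_nonneg_pos)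
    have "norm (\<phi> ((1/t) *\<^sub>R T)) \<le> 1"
      using t assms by (intro * subspace_scale[OF subspace]) auto
    then show "norm (\<phi> T) \<le> norm T + e"
      using t assms by (simp add: hom_scaleR t_def[symmetric] divide_simps)
  qed
qed

lemma hom_dist_le: "S \<in> A \<Longrightarrow> T \<in> A \<Longrightarrow> dist (\<phi> S) (\<phi> T) \<le> dist S T"
  using hom_norm_le[of "S - T"] subspace_diff[OF subspace] by (simp add: dist_norm hom_diff)

lemma hom_tendsto:
  assumes "f \<longlonglongrightarrow> T" "\<And>n. f n \<in> A"
  shows "(\<lambda>n. \<phi> (f n)) \<longlonglongrightarrow> \<phi> T"
proof -
  have T: "T \<in> A" using assms closed closed_sequentially by blast
  have "(\<lambda>n. dist (f n) T) \<longlonglongrightarrow> 0" using assms(1) tendsto_dist_iff by blast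
  then have "(\<lambda>n. dist (\<phi> (f n)) (\<phi> T)) \<longlonglongrightarrow> 0"
    by (rule Lim_null_comparison[rotated]) (use hom_dist_le assms(2) T in auto)
  then show ?thesis using tendsto_dist_iff by blast
qed

lemma kernel_star_subalgebra: "star_subalgebra {T \<in> A. \<phi> T = 0}"
proof
  show "closed {T \<in> A. \<phi> T = 0}"
    unfolding closed_sequential_limits
  proof safe
    fix f T assume f: "\<forall>n. f n \<in> {T \<in> A. \<phi> T = 0}" "f \<longlonglongrightarrow> T"
    then show "T \<in> A" using closed closed_sequentially by blast
    have "(\<lambda>n. \<phi> (f n)) \<longlonglongrightarrow> \<phi> T" by (rule hom_tendsto) (use f in auto)
    then show "\<phi> T = 0" using f(1) by (simp add: LIMSEQ_const_iff)
  qed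
qed (auto simp: subspace_def hom_0 hom_add hom_scaleR hom_compose hom_adj compose adj
      subspace_0[OF subspace] subspace_add[OF subspace] subspace_scale[OF subspace])

end

text \<open>The quasi-inverse \<open>e = h (1 + h)\<^sup>-\<^sup>1\<close> of a positive element.\<close>

lemma (in star_subalgebra) resolvent:
  assumes h: "h \<in> A" and pos: "\<And>v. 0 \<le> inner (h v) v"
  obtains e where "e \<in> A" "e + (h o\<^sub>L e) = h"
proof -
  \<comment> \<open>A fixed point of \<open>f\<close> satisfies
    \<open>(1 + c) e = h + c e - h e\<close>, that is \<open>e + h e = h\<close>; the shift by
    \<open>c\<close> only serves contractivity. Positivity gives
    \<open>(norm (c w - h w))^2 \<le> (c^2 + c) * (norm w)^2\<close>, where
    \<open>c = (norm h)^2\<close> bounds the term in \<open>h w\<close>, so \<open>f\<close>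
    contracts by \<open>k = sqrt (c^2 + c) / (1 + c)\<close>, which is below 1.\<close>
  define c where "c = (norm h)\<^sup>2"
  define k where "k = sqrt (c / (1 + c))"
  define f where "f e = (1 / (1 + c)) *\<^sub>R (h + c *\<^sub>R e - (h o\<^sub>L e))" for e
  have c: "0 \<le> c" by (simp add: c_def)
  have k: "0 \<le> k" "k < 1" using c by (auto simp: k_def)
  have kc: "k * (1 + c) = sqrt (c\<^sup>2 + c)"
  proof -
    have "k * (1 + c) = sqrt (c / (1 + c) * (1 + c)\<^sup>2)" unfolding k_def real_sqrt_mult using c by simp
    also have "c / (1 + c) * (1 + c)\<^sup>2 = c\<^sup>2 + c"
    proof -
      have "1 + c \<noteq> 0" using c by simp
      then show ?thesis by (simp add: divide_simps) (simp add: power2_eq_square algebra_simps)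
    qed
    finally show ?thesis .
  qed
  have nb: "norm (c *\<^sub>R e - (h o\<^sub>L e)) \<le> k * (1 + c) * norm e" for e
  proof (rule norm_blinfun_bound)
    show "0 \<le> k * (1 + c) * norm e" using k c by simp
    fix v
    define w where "w = e v"
    have "(norm (c *\<^sub>R w - h w))\<^sup>2 = c\<^sup>2 * (norm w)\<^sup>2 - 2 * c * inner (h w) w + (norm (h w))\<^sup>2"
      by (simp only: power2_norm_eq_inner) (simp add: inner_diff inner_commute power2_eq_square algebra_simps)
    also have "\<dots> \<le> c\<^sup>2 * (norm w)\<^sup>2 - 0 + (norm h * norm w)\<^sup>2"
      using pos[of w] c by (intro add_mono diff_mono power_mono norm_blinfun) auto
    also have "\<dots> = (sqrt (c\<^sup>2 + c) * norm w)\<^sup>2"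
      using c by (simp add: c_def power_mult_distrib algebra_simps)
    finally have "norm (c *\<^sub>R w - h w) \<le> k * (1 + c) * norm w"
      unfolding kc using c by (simp add: power2_le_iff_abs_le)
    also have "\<dots> \<le> k * (1 + c) * (norm e * norm v)"
      unfolding w_def using k c by (intro mult_left_mono norm_blinfun) auto
    finally show "norm ((c *\<^sub>R e - (h o\<^sub>L e)) v) \<le> k * (1 + c) * norm e * norm v"
      by (simp add: blinfun.diff_left blinfun.scaleR_left w_def mult_ac)
  qed
  have "complete A" using closed by (simp add: complete_eq_closed)
  moreover have "A \<noteq> {}" using h by auto
  moreover have "f ` A \<subseteq> A"
    unfolding f_def by (auto intro!: subspace_scale[OF subspace] subspace_diff[OF subspace]
        subspace_add[OF subspace] compose h)
  moreover have "dist (f e) (f e') \<le> k * dist e e'" for e e'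
  proof -
    have eq: "f e - f e' = (1 / (1 + c)) *\<^sub>R (c *\<^sub>R (e - e') - (h o\<^sub>L (e - e')))"
      unfolding f_def bounded_bilinear.diff_right[OF bounded_bilinear_blinfun_compose]
      by (simp add: algebra_simps)
    have "norm (f e - f e') \<le> (1 / (1 + c)) * (k * (1 + c) * norm (e - e'))"
      unfolding eq norm_scaleR using c nb[of "e - e'"] by (intro mult_mono) auto
    also have "\<dots> = k * norm (e - e')" using c by simp
    finally show ?thesis by (simp add: dist_norm)
  qed
  ultimately obtain e where e: "e \<in> A" "f e = e"
    using Banach_fix[of A k f] k by blast
  have "(1 + c) *\<^sub>R f e = (1 + c) *\<^sub>R e" by (simp add: e)
  then have "h + c *\<^sub>R e - (h o\<^sub>L e) = (1 + c) *\<^sub>R e" using c by (simp add: f_def)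
  then have "e + (h o\<^sub>L e) = h" by (simp add: algebra_simps)
  with e that show ?thesis by blast
qed

text \<open>Here \<open>w\<close> is \<open>(1 + h)^-1 v\<close>, so \<open>v = w + h w\<close>. All
  three terms of the expanded square are nonnegative, hence each is at most
  \<open>(norm v)^2\<close>.\<close>

lemma resolvent_bounds:
  fixes e h :: "'a op" and v :: "'a ell2"
  assumes e: "e + (h o\<^sub>L e) = h" and pos: "\<And>v. 0 \<le> inner (h v) v"
  defines "w \<equiv> v - blinfun_apply e v"
  shows "blinfun_apply h w = blinfun_apply e v"
    and "(norm w)\<^sup>2 + 2 * inner (h w) w + (norm (h w))\<^sup>2 = (norm v)\<^sup>2"
proof -
  have "e v + h (e v) = h v" using e by (metis blinfun.add_left blinfun_apply_blinfun_compose)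
  then show hw: "h w = e v" by (simp add: w_def blinfun.diff_right algebra_simps)
  then have "v = w + h w" by (simp add: w_def)
  then have "(norm v)\<^sup>2 = (norm (w + h w))\<^sup>2" by simp
  then show "(norm w)\<^sup>2 + 2 * inner (h w) w + (norm (h w))\<^sup>2 = (norm v)\<^sup>2"
    by (simp add: power2_norm_eq_inner inner_add inner_commute)
qed

text \<open>Take \<open>e = h (1 + h)^-1\<close> for a large multiple \<open>h\<close> of the sum of
  the \<open>j o\<^sub>L adj j\<close>. With \<open>w = v - e v\<close>, each
  \<open>t * (norm (adj j w))^2\<close> is at most \<open>inner (h w) w\<close>, hence at most half
  of \<open>(norm v)^2\<close>; the choice \<open>t = 1 / (2 * \<epsilon>^2)\<close> turns this into
  the required bound.\<close>

lemma (in star_subalgebra) approximate_unit: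
  assumes "finite K" "K \<subseteq> A" "0 < \<epsilon>"
  obtains e where "e \<in> A" "norm (id_blinfun - e) \<le> 1" "\<And>j. j \<in> K \<Longrightarrow> norm (j - (e o\<^sub>L j)) \<le> \<epsilon>"
proof -
  define t where "t = 1 / (2 * \<epsilon>\<^sup>2)"
  define h where "h = t *\<^sub>R (\<Sum>j\<in>K. j o\<^sub>L adj j)"
  have t: "0 < t" using \<open>0 < \<epsilon>\<close> by (simp add: t_def)
  have hin: "inner (h v) v = t * (\<Sum>j\<in>K. (norm (adj j v))\<^sup>2)" for v
    by (simp add: h_def blinfun.scaleR_left blinfun.sum_left inner_sum_left adj_inner power2_norm_eq_inner)
  then have pos: "0 \<le> inner (h v) v" for v using t by (simp add: sum_nonneg)
  have "h \<in> A" unfolding h_def using assms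
    by (intro subspace_scale[OF subspace] subspace_sum[OF subspace] compose adj) auto
  then obtain e where e: "e \<in> A" "e + (h o\<^sub>L e) = h" using resolvent pos by blast
  have *: "norm (v - e v) \<le> norm v" "j \<in> K \<Longrightarrow> norm (adj j (v - e v)) \<le> \<epsilon> * norm v" for v j
  proof -
    let ?w = "v - e v"
    note b = resolvent_bounds[OF e(2) pos, of v]
    have "(norm ?w)\<^sup>2 \<le> (norm v)\<^sup>2" using b(2) pos[of ?w] zero_le_power2[of "norm (h ?w)"] by linarith
    then show "norm ?w \<le> norm v" by (simp add: power2_le_iff_abs_le)
    assume "j \<in> K"
    then have "(norm (adj j ?w))\<^sup>2 \<le> (\<Sum>j\<in>K. (norm (adj j ?w))\<^sup>2)"
      using \<open>finite K\<close> by (intro member_le_sum) auto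
    then have "t * (norm (adj j ?w))\<^sup>2 \<le> inner (h ?w) ?w" using t by (simp add: hin)
    then have "2 * (t * (norm (adj j ?w))\<^sup>2) \<le> (norm v)\<^sup>2"
      using b(2) zero_le_power2[of "norm (h ?w)"] zero_le_power2[of "norm ?w"] by linarith
    then have "(norm (adj j ?w))\<^sup>2 \<le> (\<epsilon> * norm v)\<^sup>2"
      using \<open>0 < \<epsilon>\<close> by (simp add: t_def field_simps power_mult_distrib)
    then show "norm (adj j ?w) \<le> \<epsilon> * norm v"
      using \<open>0 < \<epsilon>\<close> by (simp add: power2_le_iff_abs_le)
  qed
  show ?thesis
  \<comment> \<open>The estimates so far concern \<open>adj j\<close> applied after
    \<open>1 - e\<close>; taking adjoints moves the approximate unit to the left of
    \<open>j\<close>.\<close>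
  proof (rule that[of "adj e"])
    show "adj e \<in> A" by (intro adj e)
    have "norm (adj (id_blinfun - e)) \<le> 1"
      unfolding norm_adj by (rule norm_blinfun_bound) (use *(1) in \<open>auto simp: blinfun.diff_left\<close>)
    then show "norm (id_blinfun - adj e) \<le> 1" by (simp add: adj_diff)
    fix j assume j: "j \<in> K"
    have "adj (j - (adj e o\<^sub>L j)) = adj j - (adj j o\<^sub>L e)" by (simp add: adj_diff adj_compose)
    then have "norm (j - (adj e o\<^sub>L j)) = norm (adj j - (adj j o\<^sub>L e))" by (metis norm_adj)
    also have "\<dots> \<le> \<epsilon>"
      by (rule norm_blinfun_bound) (use *(2)[OF j] \<open>0 < \<epsilon>\<close> in \<open>auto simp: blinfun.diff_left blinfun.diff_right\<close>)
    finally show "norm (j - (adj e o\<^sub>L j)) \<le> \<epsilon>" .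
  qed
qed

context star_subalgebra_hom begin

text \<open>With \<open>h = X\<^sup>*X\<close>, the element \<open>X (1 + h)\<^sup>-\<^sup>1\<close> is a contraction whose image approximates \<open>\<phi> X\<close>.\<close>

lemma approximate_lift:
  assumes X: "X \<in> A" "norm (\<phi> X) \<le> 1"
  obtains X' where "X' \<in> A" "norm X' \<le> 1" "norm (\<phi> X - \<phi> X') \<le> 3/5"
proof -
  define h where "h = adj X o\<^sub>L X"
  have hA: "h \<in> A" unfolding h_def by (intro compose adj X)
  have hin: "inner (h v) v = (norm (X v))\<^sup>2" for v
    by (simp add: h_def power2_norm_eq_inner) (metis adj_inner inner_commute)
  have pos: "0 \<le> inner (h v) v" for v by (simp add: hin)
  obtain e where e: "e \<in> A" "e + (h o\<^sub>L e) = h" using resolvent[OF hA pos] by blast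
  have e': "\<phi> e + (\<phi> h o\<^sub>L \<phi> e) = \<phi> h"
    using e hA by (metis hom_add hom_compose compose)
  have \<phi>h: "\<phi> h = adj (\<phi> X) o\<^sub>L \<phi> X" using X by (simp add: h_def hom_compose hom_adj adj)
  have hin': "inner (\<phi> h v) v = (norm (\<phi> X v))\<^sup>2" for v
    by (simp add: \<phi>h power2_norm_eq_inner) (metis adj_inner inner_commute)
  have pos': "0 \<le> inner (\<phi> h v) v" for v by (simp add: hin')
  show ?thesis
  proof (rule that[of "X - (X o\<^sub>L e)"])
    show "X - (X o\<^sub>L e) \<in> A" by (intro subspace_diff[OF subspace] compose X e)
    show "norm (X - (X o\<^sub>L e)) \<le> 1"
    proof (rule norm_blinfun_bound)
      fix v
      let ?w = "v - e v"
      have "(norm (X ?w))\<^sup>2 \<le> (norm v)\<^sup>2"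
        using resolvent_bounds(2)[OF e(2) pos, of v] hin[of ?w] zero_le_power2[of "norm (h ?w)"]
          zero_le_power2[of "norm ?w"] zero_le_power2[of "norm (X ?w)"] by linarith
      then have "norm (X ?w) \<le> norm v" by (simp add: power2_le_iff_abs_le)
      then show "norm ((X - (X o\<^sub>L e)) v) \<le> 1 * norm v" by (simp add: blinfun.diff_left blinfun.diff_right)
    qed simp
    have eq: "\<phi> X - \<phi> (X - (X o\<^sub>L e)) = (\<phi> X o\<^sub>L \<phi> e)" using X e by (simp add: hom_diff hom_compose compose)
    show "norm (\<phi> X - \<phi> (X - (X o\<^sub>L e))) \<le> 3/5"
      unfolding eq
    proof (rule norm_blinfun_bound)
      fix v
      define w where "w = v - \<phi> e v"
      note b = resolvent_bounds[OF e' pos', of v, folded w_def]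
      have c: "norm (\<phi> X u) \<le> norm u" for u
      proof -
        have "norm (\<phi> X u) \<le> norm (\<phi> X) * norm u" by (rule norm_blinfun)
        also have "\<dots> \<le> 1 * norm u" by (intro mult_right_mono X) auto
        finally show ?thesis by simp
      qed
      have "norm (adj (\<phi> X) u) \<le> norm u" for u
      proof -
        have "norm (adj (\<phi> X) u) \<le> norm (adj (\<phi> X)) * norm u" by (rule norm_blinfun)
        also have "\<dots> \<le> 1 * norm u" using X by (intro mult_right_mono) auto
        finally show ?thesis by simp
      qed
      then have "norm (\<phi> h w) \<le> norm (\<phi> X w)" by (simp add: \<phi>h)
      then have "(norm (\<phi> h w))\<^sup>2 \<le> (norm (\<phi> X w))\<^sup>2" by (intro power_mono) auto
      \<comment> \<open>Since \<open>inner (\<phi> h w) w = (norm (\<phi> X w))^2\<close> is at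
        least \<open>(norm (\<phi> h w))^2\<close>, the resolvent identity dominates three copies of
        the latter. Thus \<open>\<phi> e v = \<phi> h w\<close> has norm at most
        \<open>norm v / sqrt 3\<close>, and 3/5 is a rational number above
        \<open>1 / sqrt 3\<close>.\<close>
      then have "3 * (norm (\<phi> h w))\<^sup>2 \<le> (norm v)\<^sup>2"
        using b(2) hin'[of w] zero_le_power2[of "norm w"] by linarith
      moreover have "(3/5 * norm v)\<^sup>2 = 9/25 * (norm v)\<^sup>2" by (simp add: power_mult_distrib power_divide)
      ultimately have "(norm (\<phi> e v))\<^sup>2 \<le> (3/5 * norm v)\<^sup>2"
        unfolding b(1) using zero_le_power2[of "norm v"] by linarith
      then have "norm (\<phi> e v) \<le> 3/5 * norm v" by (simp add: power2_le_iff_abs_le)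
      then show "norm ((\<phi> X o\<^sub>L \<phi> e) v) \<le> 3/5 * norm v"
        using c[of "\<phi> e v"] by simp
    qed simp
  qed
qed

lemma approximate_lift_scaled:
  assumes "X \<in> A"
  obtains X' where "X' \<in> A" "norm X' \<le> norm (\<phi> X)" "norm (\<phi> X - \<phi> X') \<le> 3/5 * norm (\<phi> X)"
proof (cases "\<phi> X = 0")
  case True
  then show ?thesis using that[of 0] subspace_0[OF subspace] by (simp add: hom_0)
next
  case False
  define n where "n = norm (\<phi> X)"
  have n: "n > 0" using False by (simp add: n_def)
  have "(1/n) *\<^sub>R X \<in> A" "norm (\<phi> ((1/n) *\<^sub>R X)) \<le> 1"
    using n assms by (auto simp: hom_scaleR n_def subspace_scale[OF subspace])
  then obtain X' where X': "X' \<in> A" "norm X' \<le> 1" "norm (\<phi> ((1/n) *\<^sub>R X) - \<phi> X') \<le> 3/5"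
    using approximate_lift by blast
  have "\<phi> X - \<phi> (n *\<^sub>R X') = n *\<^sub>R (\<phi> ((1/n) *\<^sub>R X) - \<phi> X')"
    using X' n assms by (simp add: hom_scaleR scaleR_diff_right)
  then have "norm (\<phi> X - \<phi> (n *\<^sub>R X')) = n * norm (\<phi> ((1/n) *\<^sub>R X) - \<phi> X')" using n by simp
  also have "\<dots> \<le> n * (3/5)" using X' n by (intro mult_left_mono) auto
  finally show ?thesis
    using X' n that[of "n *\<^sub>R X'"] by (auto simp: subspace_scale[OF subspace] n_def[symmetric])
qed

lemma range_subspace: "subspace (\<phi> ` A)"
  unfolding subspace_def
proof (intro conjI ballI allI)
  show "0 \<in> \<phi> ` A" using hom_0 subspace_0[OF subspace] by (metis image_eqI)
  show "x + y \<in> \<phi> ` A" if "x \<in> \<phi> ` A" "y \<in> \<phi> ` A" for x y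
    using that subspace_add[OF subspace] by (auto simp: hom_add[symmetric])
  show "c *\<^sub>R x \<in> \<phi> ` A" if "x \<in> \<phi> ` A" for x c
    using that subspace_scale[OF subspace] by (auto simp: hom_scaleR[symmetric])
qed

text \<open>Successive approximation: a lift of controlled norm that shrinks the residual by a fixed
  factor is repeated on the residuals, and the lifts sum to an exact preimage.\<close>

lemma range_closed: "closed (\<phi> ` A)"
proof -
  have "Y \<in> \<phi> ` A" if Y: "Y \<in> closure (\<phi> ` A)" for Y
  proof -
    \<comment> \<open>A range element within a tenth of \<open>norm Y\<close> has norm at most
      \<open>1.1 * norm Y\<close>, so its approximate lift leaves a residual of at most
      \<open>0.1 + 0.6 * 1.1 = 0.76\<close> times \<open>norm Y\<close>.\<close>
    have step: "\<exists>X\<in>A. norm X \<le> 2 * norm Y \<and> norm (Y - \<phi> X) \<le> 4/5 * norm Y" if Y: "Y \<in> closure (\<phi> ` A)" for Y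
    proof (cases "Y = 0")
      case True
      then show ?thesis using subspace_0[OF subspace] hom_0 by (intro bexI[of _ 0]) auto
    next
      case False
      then obtain X where X: "X \<in> A" "dist (\<phi> X) Y < norm Y / 10"
        using Y unfolding closure_approachable by (metis imageE zero_less_divide_iff zero_less_norm_iff zero_less_numeral)
      obtain X' where X': "X' \<in> A" "norm X' \<le> norm (\<phi> X)" "norm (\<phi> X - \<phi> X') \<le> 3/5 * norm (\<phi> X)"
        using approximate_lift_scaled[OF X(1)] by blast
      have "norm (\<phi> X) \<le> norm Y + dist (\<phi> X) Y" by (metis dist_norm norm_triangle_sub)
      moreover have "norm (Y - \<phi> X') \<le> dist (\<phi> X) Y + norm (\<phi> X - \<phi> X')"
        using norm_triangle_ineq[of "Y - \<phi> X" "\<phi> X - \<phi> X'"] by (simp add: dist_norm norm_minus_commute)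
      ultimately show ?thesis using X X' by (intro bexI[of _ X'] conjI) (use norm_ge_zero[of Y] in linarith)+
    qed
    then obtain g where g: "\<And>Y. Y \<in> closure (\<phi> ` A) \<Longrightarrow>
        g Y \<in> A \<and> norm (g Y) \<le> 2 * norm Y \<and> norm (Y - \<phi> (g Y)) \<le> 4/5 * norm Y" by metis
    define u where "u = rec_nat Y (\<lambda>_ Y. Y - \<phi> (g Y))"
    have u0: "u 0 = Y" and uS: "u (Suc n) = u n - \<phi> (g (u n))" for n by (simp_all add: u_def)
    have u: "u n \<in> closure (\<phi> ` A)" "norm (u n) \<le> (4/5)^n * norm Y" for n
    proof (induction n)
      case (Suc n)
      show "u (Suc n) \<in> closure (\<phi> ` A)"
        unfolding uS using Suc g[of "u n"] closure_subset[of "\<phi> ` A"]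
        by (intro subspace_diff[OF subspace_closure[OF range_subspace]]) auto
      show "norm (u (Suc n)) \<le> (4/5) ^ Suc n * norm Y"
        unfolding uS using Suc g[of "u n"] by auto
    qed (auto simp: u0 Y)
    define s where "s n = (\<Sum>k<n. g (u k))" for n
    have sA: "s n \<in> A" for n unfolding s_def using u g by (intro subspace_sum[OF subspace]) auto
    have "summable (\<lambda>k. g (u k))"
    proof (rule summable_comparison_test)
      have "norm (g (u k)) \<le> 2 * ((4/5)^k * norm Y)" for k
        using u[of k] g[of "u k"] by linarith
      then show "\<exists>N. \<forall>k\<ge>N. norm (g (u k)) \<le> 2 * ((4/5)^k * norm Y)" by blast
      show "summable (\<lambda>k. 2 * ((4/5)^k * norm Y))"
        by (intro summable_mult summable_mult2 summable_geometric) simp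
    qed
    then obtain X where X: "s \<longlonglongrightarrow> X" unfolding s_def by (metis summable_LIMSEQ)
    have "X \<in> A" using X sA closed closed_sequentially by blast
    have "\<phi> (s n) = Y - u n" for n
      unfolding s_def using u g by (induction n) (simp_all add: u0 uS hom_0 hom_add[OF sA[unfolded s_def]])
    then have "(\<lambda>n. Y - u n) \<longlonglongrightarrow> \<phi> X" using hom_tendsto[OF X sA] by simp
    moreover have "(\<lambda>n. Y - u n) \<longlonglongrightarrow> Y - 0"
    proof (intro tendsto_intros)
      have "(\<lambda>n. (4/5)^n * norm Y) \<longlonglongrightarrow> 0 * norm Y"
        by (intro tendsto_mult tendsto_const LIMSEQ_realpow_zero) auto
      then show "u \<longlonglongrightarrow> 0" by (intro Lim_null_comparison[of u]) (use u in auto)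
    qed
    ultimately have "\<phi> X = Y" by (metis LIMSEQ_unique diff_zero)
    with \<open>X \<in> A\<close> show ?thesis by blast
  qed
  then show ?thesis by (metis closure_subset_eq subsetI)
qed

end


section \<open>Operators on tensor products as matrices of operators\<close>

lemma Rep_tensor_vec: "Rep_ell2 (tensor_vec f g) (i, j) = Rep_ell2 f i * Rep_ell2 g j"
  by (simp add: tensor_vec.rep_eq)

lemma tensor_vec_add_left: "tensor_vec (f + f') g = tensor_vec f g + tensor_vec f' g"
  by (rule ell2_eqI) (auto simp: tensor_vec.rep_eq plus_ell2.rep_eq algebra_simps)

lemma tensor_vec_add_right: "tensor_vec f (g + g') = tensor_vec f g + tensor_vec f g'"
  by (rule ell2_eqI) (auto simp: tensor_vec.rep_eq plus_ell2.rep_eq algebra_simps)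

lemma tensor_vec_scaleR_left: "tensor_vec (r *\<^sub>R f) g = r *\<^sub>R tensor_vec f g"
  by (rule ell2_eqI) (auto simp: tensor_vec.rep_eq scaleR_ell2.rep_eq)

lemma tensor_vec_scaleC_left: "tensor_vec (scaleC c f) g = scaleC c (tensor_vec f g)"
  by (rule ell2_eqI) (auto simp: tensor_vec.rep_eq scaleC.rep_eq)

lemma ket_tensor: "ket z c = tensor_vec (ket (fst z) c) (ket (snd z) 1)"
  by (rule ell2_eqI) (auto simp: tensor_vec.rep_eq ket.rep_eq prod_eq_iff)

lemma norm_tensor_ket: "norm (tensor_vec f (ket y 1)) = norm f"
proof -
  have "(norm (tensor_vec f (ket y 1)))\<^sup>2 = (\<Sum>\<^sub>\<infinity>z\<in>range (\<lambda>i. (i, y)). (cmod (Rep_ell2 (tensor_vec f (ket y 1)) z))\<^sup>2)"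
    unfolding norm_ell2_square
    by (rule infsum_cong_neutral) (auto simp: tensor_vec.rep_eq ket.rep_eq image_iff split: if_splits)
  also have "\<dots> = (norm f)\<^sup>2"
    unfolding norm_ell2_square
    by (subst infsum_reindex) (auto simp: inj_on_def o_def tensor_vec.rep_eq ket.rep_eq)
  finally show ?thesis by simp
qed

section \<open>Fibres of a product space and finite block projections\<close>

definition emb :: "'j \<Rightarrow> 'i ell2 \<Rightarrow>\<^sub>L ('i \<times> 'j) ell2" where
  "emb y = Blinfun (\<lambda>f. tensor_vec f (ket y 1))"

lemma emb_apply:
  fixes f :: "'i ell2" and y :: 'j
  shows "blinfun_apply (emb y) f = tensor_vec f (ket y 1)"
proof -
  have "bounded_linear (\<lambda>f :: 'i ell2. tensor_vec f (ket y 1))"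
    by (rule bounded_linear_intro[where K = 1])
       (auto simp: tensor_vec_add_left tensor_vec_scaleR_left norm_tensor_ket)
  then show ?thesis by (simp add: emb_def bounded_linear_Blinfun_apply)
qed

definition slice :: "'j \<Rightarrow> ('i \<times> 'j) ell2 \<Rightarrow>\<^sub>L 'i ell2" where
  "slice y = adj (emb y)"

lemma Rep_slice: "Rep_ell2 (blinfun_apply (slice y) F) i = Rep_ell2 F (i, y)"
proof -
  have "inner (Rep_ell2 (slice y F) i) c = inner (Rep_ell2 F (i, y)) c" for c
  proof -
    have "inner (Rep_ell2 (slice y F) i) c = inner (slice y F) (ket i c)" by (simp add: inner_ket)
    also have "\<dots> = inner F (emb y (ket i c))" unfolding slice_def by (metis adj_inner inner_commute)
    also have "emb y (ket i c) = ket (i, y) c" by (simp add: emb_apply ket_tensor[of "(i, y)"])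
    finally show ?thesis by (simp add: inner_ket)
  qed
  then show ?thesis by (metis vector_eq_rdot)
qed

lemma slice_eqI: "(\<And>y. blinfun_apply (slice y) F = blinfun_apply (slice y) G) \<Longrightarrow> F = G"
  by (rule ell2_eqI) (metis Rep_slice surj_pair)

lemma slice_tensor: "blinfun_apply (slice y) (tensor_vec f g) = scaleC (Rep_ell2 g y) f"
  by (rule ell2_eqI) (simp add: Rep_slice Rep_tensor_vec scaleC.rep_eq mult.commute)

lemma scaleC_0_1 [simp]: "scaleC 0 f = 0" "scaleC 1 f = f"
  using scaleC_of_real[of 0 f] scaleC_of_real[of 1 f] by simp_all

lemma slice_emb: "blinfun_apply (slice x) (blinfun_apply (emb y) f) = (if x = y then f else 0)"
  by (simp add: emb_apply slice_tensor ket.rep_eq)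

text \<open>The orthogonal projection onto the fibres over \<open>W\<close>. For infinite
  \<open>W\<close> the sum defaults to 0, so finiteness is assumed wherever this reading
  matters.\<close>

definition block :: "'j set \<Rightarrow> ('i \<times> 'j) op" where
  "block W = (\<Sum>y\<in>W. emb y o\<^sub>L slice y)"

lemma slice_block: "finite W \<Longrightarrow> blinfun_apply (slice x) (blinfun_apply (block W) F) = (if x \<in> W then blinfun_apply (slice x) F else 0)"
  by (simp add: block_def blinfun.sum_left blinfun.sum_right slice_emb)

lemma block_block: "finite W \<Longrightarrow> finite W' \<Longrightarrow> blinfun_apply (block W) (blinfun_apply (block W') F) = blinfun_apply (block (W \<inter> W')) F"
  by (rule slice_eqI) (simp add: slice_block)

lemma adj_block: "adj (block W) = block W"
  by (simp add: block_def adj_sum adj_compose slice_def)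

lemma norm_block: "finite W \<Longrightarrow> (norm (blinfun_apply (block W) F))\<^sup>2 = (\<Sum>y\<in>W. (norm (blinfun_apply (slice y) F))\<^sup>2)"
proof -
  assume W: "finite W"
  have "(norm (block W F))\<^sup>2 = inner (block W (block W F)) F"
    by (metis adj_block adj_inner inner_commute power2_norm_eq_inner)
  also have "block W (block W F) = block W F" by (simp add: block_block W)
  also have "inner (block W F) F = (\<Sum>y\<in>W. (norm (slice y F))\<^sup>2)"
    unfolding block_def blinfun.sum_left inner_sum_left
    by (simp add: adj_inner slice_def[symmetric] power2_norm_eq_inner)
  finally show ?thesis .
qed

lemma norm_block_le: "finite W \<Longrightarrow> norm (block W) \<le> 1"
proof (rule norm_blinfun_bound)
  fix F assume W: "finite W"
  have "norm (block W F) * norm (block W F) = inner (block W F) F"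
    using W by (metis adj_block adj_inner block_block inf.idem inner_commute power2_eq_square power2_norm_eq_inner)
  also have "\<dots> \<le> norm (block W F) * norm F" by (rule norm_cauchy_schwarz)
  finally show "norm (block W F) \<le> 1 * norm F" by (cases "norm (block W F) = 0") auto
qed simp

lemma sum_slice_le:
  fixes F :: "('i \<times> 'j) ell2"
  assumes "finite W"
  shows "(\<Sum>y\<in>W. (norm (blinfun_apply (slice y) F))\<^sup>2) \<le> (norm F)\<^sup>2"
proof -
  have "norm (block W F) \<le> norm (block W :: ('i \<times> 'j) op) * norm F" by (rule norm_blinfun)
  also have "\<dots> \<le> 1 * norm F" by (intro mult_right_mono norm_block_le assms) auto
  finally show ?thesis by (subst norm_block[OF assms, symmetric]) (auto intro: power_mono)
qed

text \<open>Vectors supported over finitely many fibres form a subspace containing every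
  \<open>ket\<close>, so they are dense.\<close>

lemma block_dense:
  assumes "closed S" "\<And>W F. finite W \<Longrightarrow> blinfun_apply (block W) F \<in> S"
  shows "F \<in> S"
proof -
  define D where "D = {F :: ('a \<times> 'b) ell2. \<exists>W. finite W \<and> block W F = F}"
  have mono: "block W' F = F" if "block W F = F" "finite W" "finite W'" "W \<subseteq> W'"
    for W W' and F :: "('a \<times> 'b) ell2"
    using that by (metis block_block inf.absorb_iff2)
  have "subspace D"
    unfolding subspace_def
  proof (intro conjI ballI allI)
    show "0 \<in> D" unfolding D_def by (intro CollectI exI[of _ "{}"]) simp
    show "c *\<^sub>R F \<in> D" if "F \<in> D" for c F
      using that by (auto simp: D_def blinfun.scaleR_right)
    show "F + G \<in> D" if "F \<in> D" "G \<in> D" for F G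
    proof -
      from that obtain W W' where "finite W" "block W F = F" "finite W'" "block W' G = G"
        by (auto simp: D_def)
      then have "block (W \<union> W') (F + G) = F + G"
        using mono[of W F "W \<union> W'"] mono[of W' G "W \<union> W'"] by (simp add: blinfun.add_right)
      then show ?thesis using \<open>finite W\<close> \<open>finite W'\<close> by (auto simp: D_def)
    qed
  qed
  moreover have "ket z c \<in> D" for z c
    unfolding D_def
    by (intro CollectI exI[of _ "{snd z}"] conjI slice_eqI)
       (auto simp: slice_block ket_tensor[of z] slice_tensor ket.rep_eq)
  ultimately have "F \<in> closure D"
    using closure_subset[of D] subspace_closure[of D] by (rule_tac ell2_dense[of "closure D"]) auto
  moreover have "D \<subseteq> S"
  proof
    fix F assume "F \<in> D"
    then obtain W where "finite W" "block W F = F" by (auto simp: D_def)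
    then show "F \<in> S" using assms(2)[of W F] by simp
  qed
  ultimately show ?thesis using closure_minimal[OF _ assms(1)] by blast
qed

text \<open>Reduces operator norms to finite sums over matrix entries. A one-sided bound is enough
  because \<open>G\<close> may be taken to be \<open>Y F\<close>.\<close>

lemma norm_block_boundI:
  fixes Y :: "('i \<times> 'j) op"
  assumes "\<And>W F G. finite W \<Longrightarrow> inner (Y (block W F)) (block W G) \<le> c * norm F * norm G" "0 \<le> c"
  shows "norm Y \<le> c"
proof -
  \<comment> \<open>The union of the two sets allows different supports, and inserting projected
    vectors replaces \<open>norm F\<close> and \<open>norm G\<close> by their norms, which makes the
    bound pass to limits in each argument separately.\<close>
  have 1: "inner (Y (block W F)) (block W' G) \<le> c * norm (block W F) * norm (block W' G)"
    if "finite W" "finite W'" for W W' F G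
    using assms(1)[of "W \<union> W'" "block W F" "block W' G"] that
    by (simp add: block_block Int_absorb1)
  have 2: "inner (Y (block W F)) G \<le> c * norm (block W F) * norm G" if "finite W" for W F G
  proof -
    have "G \<in> {G. inner (Y (block W F)) G \<le> c * norm (block W F) * norm G}"
      by (rule block_dense) (use 1 that in \<open>auto intro!: closed_Collect_le continuous_intros\<close>)
    then show ?thesis by simp
  qed
  have 3: "inner (Y F) G \<le> c * norm F * norm G" for F G
  proof -
    have "F \<in> {F. inner (Y F) G \<le> c * norm F * norm G}"
      by (rule block_dense) (use 2 in \<open>auto intro!: closed_Collect_le continuous_intros\<close>)
    then show ?thesis by simp
  qed
  show ?thesis
  proof (rule norm_blinfun_bound)
    fix F
    have "norm (Y F) * norm (Y F) \<le> c * norm F * norm (Y F)"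
      using 3[of F "Y F"] by (simp add: power2_norm_eq_inner flip: power2_eq_square)
    then show "norm (Y F) \<le> c * norm F"
      using assms(2) by (cases "norm (Y F) = 0") auto
  qed fact
qed

section \<open>Operator-valued matrix entries\<close>

definition entry :: "('i \<times> 'j) op \<Rightarrow> 'j \<Rightarrow> 'j \<Rightarrow> 'i op" where
  "entry X x y = slice x o\<^sub>L X o\<^sub>L emb y"

lemma inner_entry: "inner (blinfun_apply (entry X x y) f) g = inner (blinfun_apply X (blinfun_apply (emb y) f)) (blinfun_apply (emb x) g)"
  by (simp add: entry_def slice_def) (metis adj_inner inner_commute)

lemma inner_block_entry:
  "inner (blinfun_apply X (blinfun_apply (block W) F)) (blinfun_apply (block W) G)
    = (\<Sum>x\<in>W. \<Sum>y\<in>W. inner (blinfun_apply (entry X x y) (blinfun_apply (slice y) F)) (blinfun_apply (slice x) G))"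
  unfolding block_def blinfun.sum_left blinfun.sum_right inner_sum_left inner_sum_right
  by (simp add: inner_entry)

lemma blinfun_compose_assoc: "(S o\<^sub>L T) o\<^sub>L U = S o\<^sub>L (T o\<^sub>L U)"
  by (rule blinfun_eqI) simp

lemma bounded_linear_entry: "bounded_linear (\<lambda>X. entry X x y)"
  unfolding entry_def
  by (intro bounded_linear_compose[OF bounded_bilinear.bounded_linear_left[OF bounded_bilinear_blinfun_compose]]
      bounded_bilinear.bounded_linear_right[OF bounded_bilinear_blinfun_compose])

lemmas entry_add = bounded_linear.linear[OF bounded_linear_entry, THEN linear_add]
lemmas entry_diff = bounded_linear.linear[OF bounded_linear_entry, THEN linear_diff]
lemmas entry_scaleR = bounded_linear.linear[OF bounded_linear_entry, THEN linear_scale]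
lemmas entry_0 = bounded_linear.linear[OF bounded_linear_entry, THEN linear_0]

lemma entry_adj: "entry (adj X) x y = adj (entry X y x)"
  by (simp add: entry_def adj_compose slice_def blinfun_compose_assoc)

lemma norm_emb_slice: "norm (emb y) \<le> 1" "norm (slice y) \<le> 1"
  by (simp_all add: slice_def) (rule norm_blinfun_bound; simp add: emb_apply norm_tensor_ket)+

lemma norm_entry_le:
  fixes X :: "('i \<times> 'j) op"
  shows "norm (entry X x y) \<le> norm X"
proof -
  let ?s = "slice x :: ('i \<times> 'j) ell2 \<Rightarrow>\<^sub>L 'i ell2" and ?e = "emb y :: 'i ell2 \<Rightarrow>\<^sub>L ('i \<times> 'j) ell2"
  have "norm (entry X x y) \<le> norm (?s o\<^sub>L X) * norm (?e)"
    unfolding entry_def by (rule norm_blinfun_compose)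
  also have "\<dots> \<le> (norm (?s) * norm X) * norm (?e)"
    by (intro mult_right_mono norm_blinfun_compose) auto
  also have "\<dots> \<le> (1 * norm X) * 1"
    by (intro mult_mono norm_emb_slice) auto
  finally show ?thesis by simp
qed

lemma entry_eqI:
  assumes "\<And>x y. entry X x y = entry Y x y"
  shows "X = Y"
proof -
  have "norm (X - Y) \<le> 0"
    by (rule norm_block_boundI) (auto simp: inner_block_entry entry_diff assms)
  then show ?thesis by simp
qed

text \<open>\<open>X\<close> reads only the fibres over \<open>W\<close>, so the matrix product is a
  finite sum and no convergence of operator series is involved.\<close>

lemma entry_compose_block:
  assumes "X o\<^sub>L block W = X"
  shows "entry (X o\<^sub>L Y) x y = (\<Sum>z\<in>W. entry X x z o\<^sub>L entry Y z y)"
proof (rule blinfun_eqI)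
  fix f
  have "entry (X o\<^sub>L Y) x y f = slice x ((X o\<^sub>L block W) (Y (emb y f)))"
    unfolding assms by (simp add: entry_def)
  also have "\<dots> = (\<Sum>z\<in>W. entry X x z o\<^sub>L entry Y z y) f"
    by (simp add: block_def blinfun.sum_left blinfun.sum_right entry_def)
  finally show "entry (X o\<^sub>L Y) x y f = (\<Sum>z\<in>W. entry X x z o\<^sub>L entry Y z y) f" .
qed

lemma entry_block_block:
  fixes X :: "('i \<times> 'j) op"
  shows "finite W \<Longrightarrow> entry (block W o\<^sub>L X o\<^sub>L block W) x y = (if x \<in> W \<and> y \<in> W then entry X x y else 0)"
proof (rule blinfun_eqI)
  fix f :: "'i ell2" assume W: "finite W"
  have "block W (emb y f) = (if y \<in> W then emb y f else 0)"
    by (rule slice_eqI) (auto simp: slice_block W slice_emb)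
  then show "entry (block W o\<^sub>L X o\<^sub>L block W) x y f = (if x \<in> W \<and> y \<in> W then entry X x y else 0) f"
    by (simp add: entry_def slice_block W)
qed

text \<open>For finite \<open>W\<close>, the matrices over \<open>B\<close> indexed by
  \<open>W\<close>, extended by zero to the full product space so that the type does not change with
  \<open>W\<close>.\<close>

definition matrices :: "'j set \<Rightarrow> 'i op set \<Rightarrow> ('i \<times> 'j) op set" where
  "matrices W B = {X. (\<forall>x y. entry X x y \<in> B) \<and> block W o\<^sub>L X o\<^sub>L block W = X}"

definition matrix_map :: "'j set \<Rightarrow> ('i op \<Rightarrow> 'k op) \<Rightarrow> ('i \<times> 'j) op \<Rightarrow> ('k \<times> 'j) op" where
  "matrix_map W q X = (\<Sum>x\<in>W. \<Sum>y\<in>W. emb x o\<^sub>L q (entry X x y) o\<^sub>L slice y)"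

lemma entry_matrix_map:
  "finite W \<Longrightarrow> entry (matrix_map W q X) x y = (if x \<in> W \<and> y \<in> W then q (entry X x y) else 0)"
proof (rule blinfun_eqI)
  fix f assume W: "finite W"
  have "entry (matrix_map W q X) x y f =
      (\<Sum>x'\<in>W. \<Sum>y'\<in>W. if x = x' then if y' = y then q (entry X x y) f else 0 else 0)"
    by (auto simp: entry_def matrix_map_def blinfun.sum_left blinfun.sum_right slice_emb intro!: sum.cong)
  also have "\<dots> = (if x \<in> W \<and> y \<in> W then q (entry X x y) else 0) f"
  proof -
    have "(\<Sum>y'\<in>W. if x = x' then if y' = y then q (entry X x y) f else 0 else 0) =
      (if x = x' then if y \<in> W then q (entry X x y) f else 0 else 0)" for x'
      using W by (cases "x = x'") (auto simp: sum.delta)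
    then show ?thesis using W by (simp add: sum.delta')
  qed
  finally show "entry (matrix_map W q X) x y f = (if x \<in> W \<and> y \<in> W then q (entry X x y) else 0) f" .
qed

lemma matrices_block:
  assumes "X \<in> matrices W B" "finite W"
  shows "X o\<^sub>L block W = X" "x \<notin> W \<or> y \<notin> W \<Longrightarrow> entry X x y = 0"
proof -
  have X: "block W o\<^sub>L X o\<^sub>L block W = X" using assms by (simp add: matrices_def)
  have "block W o\<^sub>L block W = (block W :: ('a \<times> 'b) op)"
    by (rule blinfun_eqI) (simp add: block_block assms)
  then show "X o\<^sub>L block W = X" by (metis X blinfun_compose_assoc)
  show "entry X x y = 0" if "x \<notin> W \<or> y \<notin> W"
    using entry_block_block[OF assms(2), of X x y] that unfolding X by auto
qed

lemma matrix_map_block: "finite W \<Longrightarrow> matrix_map W q X o\<^sub>L block W = matrix_map W q X"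
  by (rule blinfun_eqI) (simp add: matrix_map_def blinfun.sum_left slice_block)

context star_subalgebra_hom begin

text \<open>Makes \<open>hom_norm_le\<close> available for matrices of every finite size, which
  amounts to complete contractivity of \<open>\<phi>\<close>.\<close>

lemma matrices_hom:
  assumes W: "finite W"
  shows "star_subalgebra_hom (matrices W A) (matrix_map W \<phi>)"
proof -
  let ?M = "matrices W A"
  have memI: "X \<in> ?M" if "\<And>x y. entry X x y \<in> A" "\<And>x y. x \<notin> W \<or> y \<notin> W \<Longrightarrow> entry X x y = 0" for X
  proof -
    have "block W o\<^sub>L X o\<^sub>L block W = X"
      by (rule entry_eqI) (use that in \<open>auto simp: entry_block_block W\<close>)
    with that show ?thesis by (simp add: matrices_def)
  qed
  have mem: "entry X x y \<in> A" if "X \<in> ?M" for X x y using that by (simp add: matrices_def)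
  have z: "entry X x y = 0" if "X \<in> ?M" "x \<notin> W \<or> y \<notin> W" for X x y
    using matrices_block(2)[OF that(1) W] that(2) .
  have comp: "entry (X o\<^sub>L Y) x y = (\<Sum>z\<in>W. entry X x z o\<^sub>L entry Y z y)" if "X \<in> ?M" for X Y x y
    by (rule entry_compose_block[OF matrices_block(1)[OF that W]])
  have mm: "entry (matrix_map W \<phi> X) x y = \<phi> (entry X x y)" if "X \<in> ?M" for X x y
    using z[OF that] by (auto simp: entry_matrix_map W hom_0)
  show ?thesis
  proof
    have "closed {X :: ('a \<times> 'c) op. entry X x y \<in> A}" for x y
      using continuous_closed_vimage[OF closed linear_continuous_at[OF bounded_linear_entry[of x y]]]
      by (simp add: vimage_def)
    moreover have "closed {X :: ('a \<times> 'c) op. block W o\<^sub>L X o\<^sub>L block W = X}"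
      by (intro closed_Collect_eq continuous_intros
          bounded_bilinear.continuous_on[OF bounded_bilinear_blinfun_compose])
    moreover have "?M = (\<Inter>x. \<Inter>y. {X. entry X x y \<in> A}) \<inter> {X. block W o\<^sub>L X o\<^sub>L block W = X}"
      by (auto simp: matrices_def)
    ultimately show "closed ?M" by (simp only:) (intro closed_Int closed_INT ballI; simp)
    show "subspace ?M"
      unfolding subspace_def
      by (auto intro!: memI simp: entry_0 entry_add entry_scaleR z mem subspace_0[OF subspace]
          subspace_add[OF subspace] subspace_scale[OF subspace])
    fix S T assume S: "S \<in> ?M" and T: "T \<in> ?M"
    show ST: "S o\<^sub>L T \<in> ?M"
      by (rule memI) (auto simp: comp[OF S] z[OF S] z[OF T] intro!: subspace_sum[OF subspace] compose mem S T)
    show "adj T \<in> ?M"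
      by (rule memI) (auto simp: entry_adj z[OF T] intro!: adj mem T)
    show "matrix_map W \<phi> (S o\<^sub>L T) = matrix_map W \<phi> S o\<^sub>L matrix_map W \<phi> T"
    proof (rule entry_eqI)
      fix x y
      have "entry (matrix_map W \<phi> (S o\<^sub>L T)) x y = (\<Sum>z\<in>W. \<phi> (entry S x z) o\<^sub>L \<phi> (entry T z y))"
        unfolding mm[OF ST] comp[OF S] by (subst hom_sum) (auto simp: hom_compose mem S T compose)
      then show "entry (matrix_map W \<phi> (S o\<^sub>L T)) x y = entry (matrix_map W \<phi> S o\<^sub>L matrix_map W \<phi> T) x y"
        by (simp add: entry_compose_block[OF matrix_map_block[OF W]] mm S T)
    qed
    have "S + T \<in> ?M" by (rule memI) (auto simp: entry_add z[OF S] z[OF T] intro!: subspace_add[OF subspace] mem S T)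
    then show "matrix_map W \<phi> (S + T) = matrix_map W \<phi> S + matrix_map W \<phi> T"
      by (intro entry_eqI) (simp add: mm S T entry_add hom_add mem)
    have "r *\<^sub>R T \<in> ?M" for r by (rule memI) (auto simp: entry_scaleR z[OF T] intro!: subspace_scale[OF subspace] mem T)
    then show "matrix_map W \<phi> (r *\<^sub>R T) = r *\<^sub>R matrix_map W \<phi> T" for r
      by (intro entry_eqI) (simp add: mm T entry_scaleR hom_scaleR mem)
    have "adj T \<in> ?M" by fact
    then show "matrix_map W \<phi> (adj T) = adj (matrix_map W \<phi> T)"
      by (intro entry_eqI) (simp add: mm T entry_adj hom_adj mem)
  qed
qed

text \<open>Compression to a finite block reduces the claim to finite matrices, and the bound
  obtained there does not depend on the block.\<close>

lemma entrywise_norm_le: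
  assumes "\<And>x y. entry X x y \<in> A" "\<And>x y. entry Y x y = \<phi> (entry X x y)"
  shows "norm Y \<le> norm X"
proof (rule norm_block_boundI)
  fix W :: "'c set" and F G assume W: "finite W"
  let ?P = "\<lambda>X. block W o\<^sub>L X o\<^sub>L block W"
  interpret M: star_subalgebra_hom "matrices W A" "matrix_map W \<phi>" by (rule matrices_hom[OF W])
  have ent: "entry (?P X) x y \<in> A" for x y
    by (auto simp: entry_block_block W assms subspace_0[OF subspace])
  have "?P (?P X) = ?P X"
    by (rule entry_eqI) (simp add: entry_block_block W)
  then have mem: "?P X \<in> matrices W A" using ent by (simp add: matrices_def)
  have "matrix_map W \<phi> (?P X) = ?P Y"
    by (rule entry_eqI) (auto simp: entry_matrix_map entry_block_block W assms)
  then have "norm (?P Y) \<le> norm (?P X)" using M.hom_norm_le[OF mem] by simp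
  also have "\<dots> \<le> norm (block W o\<^sub>L X) * norm (block W :: ('a \<times> 'c) op)" by (rule norm_blinfun_compose)
  also have "\<dots> \<le> (norm (block W :: ('a \<times> 'c) op) * norm X) * norm (block W :: ('a \<times> 'c) op)"
    by (intro mult_right_mono norm_blinfun_compose) auto
  also have "\<dots> \<le> (1 * norm X) * 1" by (intro mult_mono norm_block_le W) auto
  finally have *: "norm (?P Y) \<le> norm X" by simp
  have "inner (Y (block W F)) (block W G) = inner (?P Y F) G"
    by (simp add: adj_inner adj_block)
  also have "\<dots> \<le> norm (?P Y F) * norm G" by (rule norm_cauchy_schwarz)
  also have "\<dots> \<le> norm (?P Y) * norm F * norm G" by (intro mult_right_mono norm_blinfun) auto
  also have "\<dots> \<le> norm X * norm F * norm G" using * by (intro mult_right_mono) auto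
  finally show "inner (Y (block W F)) (block W G) \<le> norm X * norm F * norm G" .
qed simp

end

text \<open>This \<open>R\<close> is \<open>S \<otimes> 1\<close>. Square summability of its values
  is checked on finite rectangles of indices, where the bound for \<open>S\<close> applies fibre by
  fibre.\<close>

lemma amplification_ex:
  fixes S :: "'i op"
  shows "\<exists>R :: ('i \<times> 'j) op. (\<forall>y F. slice y (blinfun_apply R F) = S (slice y F)) \<and> norm R \<le> norm S"
proof -
  have "\<exists>G. (\<forall>y. slice y G = S (slice y F)) \<and> norm G \<le> norm S * norm F" for F :: "('i \<times> 'j) ell2"
  proof -
    define h where "h z = Rep_ell2 (S (slice (snd z) F)) (fst z)" for z :: "'i \<times> 'j"
    have "(\<Sum>z\<in>E. (cmod (h z))\<^sup>2) \<le> (norm S * norm F)\<^sup>2" if "finite E" for E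
    proof -
      have "(\<Sum>z\<in>E. (cmod (h z))\<^sup>2) \<le> (\<Sum>z\<in>fst ` E \<times> snd ` E. (cmod (h z))\<^sup>2)"
        using that by (intro sum_mono2) (auto simp: subset_fst_snd)
      also have "\<dots> = (\<Sum>y\<in>snd ` E. \<Sum>i\<in>fst ` E. (cmod (Rep_ell2 (S (slice y F)) i))\<^sup>2)"
        by (subst sum.swap) (simp add: sum.cartesian_product h_def case_prod_beta)
      also have "\<dots> \<le> (\<Sum>y\<in>snd ` E. (norm (S (slice y F)))\<^sup>2)"
        using that by (intro sum_mono sum_le_norm_ell2) auto
      also have "\<dots> \<le> (\<Sum>y\<in>snd ` E. (norm S * norm (slice y F))\<^sup>2)"
        by (intro sum_mono power_mono norm_blinfun) auto
      also have "\<dots> = (norm S)\<^sup>2 * (\<Sum>y\<in>snd ` E. (norm (slice y F))\<^sup>2)"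
        by (simp add: power_mult_distrib sum_distrib_left)
      also have "\<dots> \<le> (norm S)\<^sup>2 * (norm F)\<^sup>2"
        using that by (intro mult_left_mono sum_slice_le) auto
      finally show ?thesis by (simp add: power_mult_distrib)
    qed
    then obtain G where G: "Rep_ell2 G = h" "norm G \<le> norm S * norm F"
      by (rule ell2_bounded_ex) auto
    have "slice y G = S (slice y F)" for y by (rule ell2_eqI) (simp add: Rep_slice G h_def)
    with G show ?thesis by blast
  qed
  then obtain R :: "('i \<times> 'j) ell2 \<Rightarrow> ('i \<times> 'j) ell2"
    where R: "\<And>F y. slice y (R F) = S (slice y F)" "\<And>F. norm (R F) \<le> norm S * norm F"
    by metis
  have "bounded_linear R"
    by (rule bounded_linear_intro[where K = "norm S"])
       (auto intro!: slice_eqI simp: R(1) blinfun.add_right blinfun.scaleR_right mult.commute[of _ "norm S"] R(2))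
  then have "blinfun_apply (Blinfun R) = R" by (rule bounded_linear_Blinfun_apply)
  with R show ?thesis by (intro exI[of _ "Blinfun R"]) (auto intro!: norm_blinfun_bound)
qed

text \<open>Exchanging the factors turns the amplification of \<open>T\<close> into
  \<open>1 \<otimes> T\<close>.\<close>

lift_definition flip :: "('i \<times> 'j) ell2 \<Rightarrow> ('j \<times> 'i) ell2" is "\<lambda>F z. F (prod.swap z)"
proof -
  fix F :: "'i \<times> 'j \<Rightarrow> complex" assume "(\<lambda>z. (cmod (F z))\<^sup>2) summable_on UNIV"
  then have "(\<lambda>z. (cmod (F z))\<^sup>2) summable_on prod.swap ` UNIV" by simp
  then show "(\<lambda>z. (cmod (F (prod.swap z)))\<^sup>2) summable_on UNIV"
    by (subst (asm) summable_on_reindex) (simp_all add: o_def)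
qed

lemma norm_flip: "norm (flip F) = norm F"
proof -
  have "(norm (flip F))\<^sup>2 = (\<Sum>\<^sub>\<infinity>z\<in>prod.swap ` UNIV. (cmod (Rep_ell2 F z))\<^sup>2)"
    unfolding norm_ell2_square by (subst infsum_reindex) (simp_all add: o_def flip.rep_eq)
  then show ?thesis by (simp add: norm_ell2_square[symmetric])
qed

lemma flip_tensor: "flip (tensor_vec f g) = tensor_vec g f"
  by (rule ell2_eqI) (auto simp: flip.rep_eq tensor_vec.rep_eq)

lemma bounded_linear_flip: "bounded_linear flip"
  by (rule bounded_linear_intro[where K = 1])
     (auto intro!: ell2_eqI simp: flip.rep_eq plus_ell2.rep_eq scaleR_ell2.rep_eq norm_flip)

text \<open>Built as \<open>(S \<otimes> 1) (1 \<otimes> T)\<close>. Complex linearity enters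
  because slicing \<open>tensor_vec f g\<close> yields complex multiples of \<open>f\<close>, which
  the operator must respect.\<close>

lemma op_tensor_ex:
  fixes S :: "'i op" and T :: "'j op"
  assumes S: "op_clinear S" and T: "op_clinear T"
  shows "\<exists>R. (\<forall>f g. blinfun_apply R (tensor_vec f g) = tensor_vec (S f) (T g)) \<and> norm R \<le> norm S * norm T"
proof -
  obtain R1 :: "('i \<times> 'j) op" where R1: "\<And>y (F :: ('i \<times> 'j) ell2). slice y (R1 F) = S (slice y F)" "norm R1 \<le> norm S"
    using amplification_ex[where S = S and 'j = 'j] by blast
  obtain R2 :: "('j \<times> 'i) op" where R2: "\<And>y (F :: ('j \<times> 'i) ell2). slice y (R2 F) = T (slice y F)" "norm R2 \<le> norm T"
    using amplification_ex[where S = T and 'j = 'i] by blast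
  have 1: "R1 (tensor_vec f g) = tensor_vec (S f) g" for f g
    by (rule slice_eqI) (simp add: R1 slice_tensor op_clinearD[OF S])
  have 2: "R2 (tensor_vec g f) = tensor_vec (T g) f" for f g
    by (rule slice_eqI) (simp add: R2 slice_tensor op_clinearD[OF T])
  define V :: "('i \<times> 'j) ell2 \<Rightarrow>\<^sub>L ('j \<times> 'i) ell2" where "V = Blinfun flip"
  define V' :: "('j \<times> 'i) ell2 \<Rightarrow>\<^sub>L ('i \<times> 'j) ell2" where "V' = Blinfun flip"
  have V: "V F = flip F" "V' G = flip G" for F G
    by (simp_all add: V_def V'_def bounded_linear_Blinfun_apply bounded_linear_flip)
  define R where "R = R1 o\<^sub>L (V' o\<^sub>L (R2 o\<^sub>L V))"
  have "norm R \<le> norm S * norm T"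
  proof (rule norm_blinfun_bound)
    fix F
    have "norm (R F) \<le> norm R1 * norm (R2 (flip F))"
      using norm_blinfun[of R1 "flip (R2 (flip F))"] by (simp add: R_def V norm_flip)
    also have "\<dots> \<le> norm R1 * (norm R2 * norm F)"
      using norm_blinfun[of R2 "flip F"] by (intro mult_left_mono) (auto simp: norm_flip)
    also have "\<dots> \<le> norm S * (norm T * norm F)"
      using R1 R2 by (intro mult_mono) auto
    finally show "norm (R F) \<le> norm S * norm T * norm F" by (simp add: mult_ac)
  qed simp
  then show ?thesis
    by (intro exI[of _ R]) (simp add: R_def V flip_tensor 1 2)
qed

lemma tensor_op_unique:
  fixes R R' :: "('i \<times> 'j) op"
  assumes "\<And>f g. blinfun_apply R (tensor_vec f g) = blinfun_apply R' (tensor_vec f g)"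
  shows "R = R'"
proof (rule blinfun_eq_on_ket)
  show "R (ket z c) = R' (ket z c)" for z c
    unfolding ket_tensor[of z c] by (rule assms)
qed

lemma op_tensor_eqI:
  assumes "\<And>f g. blinfun_apply R (tensor_vec f g) = tensor_vec (blinfun_apply S f) (blinfun_apply T g)"
  shows "op_tensor S T = R"
  unfolding op_tensor_def
proof (rule the_equality)
  show "R' = R" if "\<forall>f g. blinfun_apply R' (tensor_vec f g) = tensor_vec (blinfun_apply S f) (blinfun_apply T g)" for R'
    by (rule tensor_op_unique) (use that assms in simp)
qed (use assms in simp)

lemma
  assumes "op_clinear S" "op_clinear T"
  shows op_tensor_apply: "blinfun_apply (op_tensor S T) (tensor_vec f g) = tensor_vec (blinfun_apply S f) (blinfun_apply T g)"
    and norm_op_tensor_le: "norm (op_tensor S T) \<le> norm S * norm T"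
proof -
  obtain R where R: "\<And>f g. blinfun_apply R (tensor_vec f g) = tensor_vec (S f) (T g)" "norm R \<le> norm S * norm T"
    using op_tensor_ex[OF assms] by blast
  have "op_tensor S T = R" by (rule op_tensor_eqI[OF R(1)])
  with R show "op_tensor S T (tensor_vec f g) = tensor_vec (S f) (T g)" "norm (op_tensor S T) \<le> norm S * norm T"
    by simp_all
qed

lemma op_tensor_clinear:
  assumes "op_clinear S" "op_clinear T"
  shows "op_clinear (op_tensor S T)"
  unfolding op_clinear_def
proof (intro allI)
  fix c F
  have "op_tensor S T o\<^sub>L scal c = scal c o\<^sub>L op_tensor S T"
  proof (rule tensor_op_unique)
    fix f g
    have "op_tensor S T (scaleC c (tensor_vec f g)) = scaleC c (op_tensor S T (tensor_vec f g))"
      unfolding tensor_vec_scaleC_left[symmetric] op_tensor_apply[OF assms] op_clinearD[OF assms(1)] ..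
    then show "(op_tensor S T o\<^sub>L scal c) (tensor_vec f g) = (scal c o\<^sub>L op_tensor S T) (tensor_vec f g)"
      by simp
  qed
  then show "op_tensor S T (scaleC c F) = scaleC c (op_tensor S T F)"
    by (metis blinfun_apply_blinfun_compose scal_apply)
qed

lemma op_tensor_compose:
  assumes "op_clinear S" "op_clinear T" "op_clinear S'" "op_clinear T'"
  shows "op_tensor S T o\<^sub>L op_tensor S' T' = op_tensor (S o\<^sub>L S') (T o\<^sub>L T')"
  by (rule op_tensor_eqI[symmetric]) (simp add: op_tensor_apply assms)

lemma op_tensor_add_left:
  assumes "op_clinear S" "op_clinear S'" "op_clinear T"
  shows "op_tensor (S + S') T = op_tensor S T + op_tensor S' T"
  by (rule op_tensor_eqI) (simp add: op_tensor_apply assms blinfun.add_left tensor_vec_add_left)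

lemma op_tensor_add_right:
  assumes "op_clinear S" "op_clinear T" "op_clinear T'"
  shows "op_tensor S (T + T') = op_tensor S T + op_tensor S T'"
  by (rule op_tensor_eqI) (simp add: op_tensor_apply assms blinfun.add_left tensor_vec_add_right)

lemma op_tensor_scaleC:
  assumes "op_clinear S" "op_clinear T"
  shows "op_tensor (op_scaleC c S) T = op_scaleC c (op_tensor S T)"
  by (rule op_tensor_eqI) (simp add: op_tensor_apply assms tensor_vec_scaleC_left)

lemma op_tensor_0 [simp]: "op_tensor 0 T = 0"
  by (rule op_tensor_eqI, rule ell2_eqI) (auto simp: tensor_vec.rep_eq zero_ell2.rep_eq)

definition mcoeff :: "'a op \<Rightarrow> 'a \<Rightarrow> 'a \<Rightarrow> complex" where
  "mcoeff T x y = Rep_ell2 (T (ket y 1)) x"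

lemma cmod_mcoeff_le: "cmod (mcoeff T x y) \<le> norm T"
  using cmod_le_norm_ell2[of "T (ket y 1)" x] norm_blinfun[of T "ket y 1"]
  by (simp add: mcoeff_def norm_ket)

lemma inner_mcoeff:
  assumes "op_clinear T"
  shows "inner (blinfun_apply T (ket y c)) (ket x d) = inner (mcoeff T x y * c) d"
proof -
  have "T (ket y c) = scaleC c (T (ket y 1))" using op_clinearD[OF assms, of c "ket y 1"] by (simp add: scaleC_ket)
  then show ?thesis by (simp add: inner_ket scaleC.rep_eq mcoeff_def mult.commute)
qed

lemma mcoeff_adj:
  assumes "op_clinear T"
  shows "mcoeff (adj T) x y = cnj (mcoeff T y x)"
proof -
  have "inner (mcoeff (adj T) x y) d = inner (cnj (mcoeff T y x)) d" for d
  proof -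
    have "inner (mcoeff (adj T) x y) d = inner (adj T (ket y 1)) (ket x d)"
      by (simp add: inner_mcoeff op_clinear_adj assms)
    also have "\<dots> = inner (T (ket x d)) (ket y 1)" by (metis adj_inner inner_commute)
    also have "\<dots> = inner (mcoeff T y x * d) 1" by (rule inner_mcoeff[OF assms])
    finally show ?thesis by (simp add: inner_complex_def)
  qed
  then show ?thesis by (metis vector_eq_rdot)
qed

text \<open>Links scalar and operator-valued matrices: the entries of an elementary tensor are
  multiples of one operator, with bounded coefficients, and they vanish where
  \<open>mcoeff T\<close> does. Compactness of the entries and finite propagation both rest on
  this.\<close>

lemma entry_op_tensor:
  assumes "op_clinear S" "op_clinear T"
  shows "entry (op_tensor S T) x y = op_scaleC (mcoeff T x y) S"
  by (rule blinfun_eqI) (simp add: entry_def emb_apply op_tensor_apply assms slice_tensor mcoeff_def)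

lemma adj_op_scaleC:
  assumes "op_clinear S"
  shows "adj (op_scaleC c S) = op_scaleC (cnj c) (adj S)"
  by (rule adj_eqI) (simp add: inner_scaleC adj_inner op_clinearD[OF op_clinear_adj[OF assms]])

lemma op_tensor_adj:
  assumes "op_clinear S" "op_clinear T"
  shows "adj (op_tensor S T) = op_tensor (adj S) (adj T)"
  by (rule entry_eqI)
     (simp add: entry_adj entry_op_tensor assms op_clinear_adj adj_op_scaleC mcoeff_adj)


section \<open>The induced homomorphism of minimal tensor products\<close>

lemma cstar_algebraD:
  assumes "cstar_algebra B"
  shows "T \<in> B \<Longrightarrow> op_clinear T" "T \<in> B \<Longrightarrow> op_scaleC c T \<in> B" "T \<in> B \<Longrightarrow> adj T \<in> B"
  using assms by (auto simp: cstar_algebra_def simp flip: op_adj_eq)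

lemma cstar_algebra_star_subalgebra:
  assumes "cstar_algebra B"
  shows "star_subalgebra B"
proof
  have "r *\<^sub>R T \<in> B" if "T \<in> B" for r T
    using cstar_algebraD(2)[OF assms that, of "complex_of_real r"] by (simp add: op_scaleC_of_real)
  then show "subspace B" using assms by (auto simp: subspace_def cstar_algebra_def)
qed (use assms cstar_algebraD[OF assms] in \<open>auto simp: cstar_algebra_def\<close>)

lemma star_hom_star_subalgebra_hom:
  assumes B: "cstar_algebra B" and C: "cstar_algebra C" and q: "star_hom B C q"
  shows "star_subalgebra_hom B q"
proof -
  interpret star_subalgebra B by (rule cstar_algebra_star_subalgebra[OF B])
  show ?thesis
  proof
    show "q (r *\<^sub>R T) = r *\<^sub>R q T" if "T \<in> B" for r T
      using q that unfolding star_hom_def op_scaleC_of_real[symmetric] by blast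
    show "q (adj T) = adj (q T)" if "T \<in> B" for T
    proof -
      have "q T \<in> C" using q that by (auto simp: star_hom_def)
      then have "op_clinear (q T)" "op_clinear T" using that B C by (auto simp: cstar_algebra_def)
      then show ?thesis using q that by (metis star_hom_def op_adj_eq)
    qed
  qed (use q in \<open>auto simp: star_hom_def\<close>)
qed

abbreviation elementary_tensors :: "'i op set \<Rightarrow> 'j op set \<Rightarrow> ('i \<times> 'j) op set" where
  "elementary_tensors B A \<equiv> {op_tensor S T | S T. S \<in> B \<and> T \<in> A}"

lemma subspace_min_tensor: "subspace (min_tensor B A)"
  unfolding min_tensor_def by (intro subspace_closure subspace_span)

lemma closed_min_tensor: "closed (min_tensor B A)"
  by (simp add: min_tensor_def)

lemma op_tensor_in_min_tensor: "S \<in> B \<Longrightarrow> T \<in> A \<Longrightarrow> op_tensor S T \<in> min_tensor B A"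
  unfolding min_tensor_def by (intro closure_subset[THEN subsetD] span_base) blast

lemma min_tensor_minimal:
  assumes "elementary_tensors B A \<subseteq> S" "subspace S" "closed S"
  shows "min_tensor B A \<subseteq> S"
  unfolding min_tensor_def by (intro closure_minimal span_minimal assms)

lemma cstar_algebra_min_tensor:
  assumes B: "cstar_algebra B" and A: "cstar_algebra A"
  shows "cstar_algebra (min_tensor B A)"
proof -
  have sub: "min_tensor B A \<subseteq> {X. op_clinear X}"
    by (rule min_tensor_minimal)
       (auto simp: subspace_def closed_op_clinear
         intro!: op_clinear_simps op_tensor_clinear cstar_algebraD(1)[OF A] cstar_algebraD(1)[OF B])
  have adj: "adj X \<in> min_tensor B A" if "X \<in> min_tensor B A" for X
    unfolding min_tensor_def
  proof (rule bounded_linear_closure_subset[OF bounded_linear_adj _ that[unfolded min_tensor_def]])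
    fix X assume "X \<in> elementary_tensors B A"
    then obtain S T where "X = op_tensor S T" "S \<in> B" "T \<in> A" by blast
    then show "adj X \<in> closure (span (elementary_tensors B A))"
      using op_tensor_in_min_tensor[of "adj S" B "adj T" A]
      by (simp add: op_tensor_adj cstar_algebraD[OF A] cstar_algebraD[OF B] min_tensor_def)
  qed
  have sc: "op_scaleC c X \<in> min_tensor B A" if "X \<in> min_tensor B A" for X c
    unfolding min_tensor_def
  proof (rule bounded_linear_closure_subset[OF bounded_linear_op_scaleC _ that[unfolded min_tensor_def]])
    fix X assume "X \<in> elementary_tensors B A"
    then obtain S T where "X = op_tensor S T" "S \<in> B" "T \<in> A" by blast
    then show "op_scaleC c X \<in> closure (span (elementary_tensors B A))"
      using op_tensor_in_min_tensor[of "op_scaleC c S" B T A]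
      by (simp add: op_tensor_scaleC cstar_algebraD[OF A] cstar_algebraD[OF B] min_tensor_def)
  qed
  have comp: "X o\<^sub>L Y \<in> min_tensor B A" if "X \<in> min_tensor B A" "Y \<in> min_tensor B A" for X Y
    unfolding min_tensor_def
  proof (rule bounded_bilinear_closure_subset[OF bounded_bilinear_blinfun_compose _ that[unfolded min_tensor_def]])
    fix X Y assume "X \<in> elementary_tensors B A" "Y \<in> elementary_tensors B A"
    then obtain S T S' T' where "X = op_tensor S T" "S \<in> B" "T \<in> A" "Y = op_tensor S' T'" "S' \<in> B" "T' \<in> A"
      by blast
    then show "X o\<^sub>L Y \<in> closure (span (elementary_tensors B A))"
      using op_tensor_in_min_tensor[of "S o\<^sub>L S'" B "T o\<^sub>L T'" A] A B
      by (simp add: op_tensor_compose cstar_algebraD[OF A] cstar_algebraD[OF B] min_tensor_def cstar_algebra_def)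
  qed
  show ?thesis
    unfolding cstar_algebra_def
    using sub adj sc comp subspace_0[OF subspace_min_tensor] subspace_add[OF subspace_min_tensor]
    by (auto simp: op_adj_eq subset_iff closed_min_tensor)
qed

text \<open>Lets the graph of the induced map be shown multiplicatively closed by checking
  generators only.\<close>

lemma bounded_bilinear_pair_compose:
  "bounded_bilinear (\<lambda>(a :: 'a op \<times> 'b op) (b :: 'a op \<times> 'b op). (fst a o\<^sub>L fst b, snd a o\<^sub>L snd b))"
proof (rule bounded_bilinear.intro)
  show "\<exists>K. \<forall>(a :: 'a op \<times> 'b op) (b :: 'a op \<times> 'b op). norm (fst a o\<^sub>L fst b, snd a o\<^sub>L snd b) \<le> norm a * norm b * K"
  proof (intro exI allI)
    fix a b :: "'a op \<times> 'b op"
    have "norm (fst a o\<^sub>L fst b, snd a o\<^sub>L snd b) \<le> norm (fst a o\<^sub>L fst b) + norm (snd a o\<^sub>L snd b)"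
      by (rule norm_Pair_le)
    also have "\<dots> \<le> norm (fst a) * norm (fst b) + norm (snd a) * norm (snd b)"
      by (intro add_mono norm_blinfun_compose)
    also have "\<dots> \<le> norm a * norm b + norm a * norm b"
      by (intro add_mono mult_mono) (use norm_fst_le[of "fst a" "snd a"] norm_fst_le[of "fst b" "snd b"]
          norm_snd_le[of "snd a" "fst a"] norm_snd_le[of "snd b" "fst b"] in auto)
    finally show "norm (fst a o\<^sub>L fst b, snd a o\<^sub>L snd b) \<le> norm a * norm b * 2" by (simp add: mult_ac)
  qed
qed (auto simp: bounded_bilinear.add_left[OF bounded_bilinear_blinfun_compose]
    bounded_bilinear.add_right[OF bounded_bilinear_blinfun_compose]
    bounded_bilinear.scaleR_left[OF bounded_bilinear_blinfun_compose]
    bounded_bilinear.scaleR_right[OF bounded_bilinear_blinfun_compose])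

locale tensor_extension =
  fixes B :: "'i op set" and C :: "'j op set" and q :: "'i op \<Rightarrow> 'j op" and A :: "'a op set"
  assumes B: "cstar_algebra B" and C: "cstar_algebra C" and A: "cstar_algebra A"
    and q: "star_hom B C q"
begin

sublocale q: star_subalgebra_hom B q
  by (rule star_hom_star_subalgebra_hom[OF B C q])

lemma qC: "S \<in> B \<Longrightarrow> q S \<in> C"
  and q_scaleC: "S \<in> B \<Longrightarrow> q (op_scaleC c S) = op_scaleC c (q S)"
  using q by (auto simp: star_hom_def)

lemmas clinear = cstar_algebraD(1)[OF B] cstar_algebraD(1)[OF C, OF qC] cstar_algebraD(1)[OF A]

definition pairs :: "(('i \<times> 'a) op \<times> ('j \<times> 'a) op) set" where
  "pairs = {(op_tensor S T, op_tensor (q S) T) | S T. S \<in> B \<and> T \<in> A}"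

text \<open>
  Closing the graph avoids showing that \<open>q \<otimes> id\<close> is well defined on sums of elementary tensors;
  single-valuedness follows from \<open>graph_norm_le\<close>.
\<close>

definition graph :: "(('i \<times> 'a) op \<times> ('j \<times> 'a) op) set" where
  "graph = closure (span pairs)"

lemma subspace_graph: "subspace graph"
  unfolding graph_def by (intro subspace_closure subspace_span)

lemma graph_base: "S \<in> B \<Longrightarrow> T \<in> A \<Longrightarrow> (op_tensor S T, op_tensor (q S) T) \<in> graph"
  unfolding graph_def pairs_def by (intro closure_subset[THEN subsetD] span_base) blast

text \<open>\<open>q\<close> acts entrywise on the generating pairs, and the relation passes to
  linear combinations and limits because \<open>q\<close> is linear and contractive on
  \<open>B\<close>.\<close>

lemma graph_entry:
  assumes "(X, Y) \<in> graph"
  shows "entry X x y \<in> B" "entry Y x y = q (entry X x y)"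
proof -
  define E where "E = {(X :: ('i \<times> 'a) op, Y :: ('j \<times> 'a) op). entry X x y \<in> B \<and> entry Y x y = q (entry X x y)}"
  have "closed E"
    unfolding closed_sequential_limits
  proof (intro allI impI)
    fix f l assume f: "(\<forall>n. f n \<in> E) \<and> f \<longlonglongrightarrow> l"
    note lim = bounded_linear.tendsto[OF bounded_linear_entry]
    have 1: "(\<lambda>n. entry (fst (f n)) x y) \<longlonglongrightarrow> entry (fst l) x y" using f by (intro lim tendsto_fst) auto
    have 2: "(\<lambda>n. entry (snd (f n)) x y) \<longlonglongrightarrow> entry (snd l) x y" using f by (intro lim tendsto_snd) auto
    have m: "entry (fst (f n)) x y \<in> B" "entry (snd (f n)) x y = q (entry (fst (f n)) x y)" for n
      using f by (auto simp: E_def case_prod_beta)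
    have "entry (fst l) x y \<in> B" by (rule closed_sequentially[OF q.closed m(1) 1])
    moreover have "entry (snd l) x y = q (entry (fst l) x y)"
      using q.hom_tendsto[OF 1 m(1)] 2 unfolding m(2) by (rule LIMSEQ_unique[rotated])
    ultimately show "l \<in> E" by (simp add: E_def case_prod_beta)
  qed
  moreover have "subspace E"
    unfolding subspace_def E_def
    by (auto simp: zero_prod_def entry_0 entry_add entry_scaleR q.hom_0 q.hom_add q.hom_scaleR subspace_0[OF q.subspace]
        subspace_add[OF q.subspace] subspace_scale[OF q.subspace])
  moreover have "pairs \<subseteq> E"
    by (auto simp: pairs_def E_def entry_op_tensor clinear q_scaleC cstar_algebraD(2)[OF B])
  ultimately have "graph \<subseteq> E" unfolding graph_def by (intro closure_minimal span_minimal)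
  with assms show "entry X x y \<in> B" "entry Y x y = q (entry X x y)" by (auto simp: E_def)
qed

lemma graph_norm_le: "(X, Y) \<in> graph \<Longrightarrow> norm Y \<le> norm X"
  by (rule q.entrywise_norm_le) (auto dest: graph_entry)

text \<open>On the algebraic tensor product a partner exists since the span of \<open>pairs\<close>
  projects onto it. For a convergent sequence there, \<open>graph_norm_le\<close> makes the partners
  Cauchy, so the limit has a partner too.\<close>

lemma graph_ex:
  assumes "X \<in> min_tensor B A"
  shows "\<exists>Y. (X, Y) \<in> graph"
proof -
  have "elementary_tensors B A = fst ` pairs" by (force simp: pairs_def)
  then have "span (elementary_tensors B A) = fst ` span pairs"
    by (simp add: linear_span_image bounded_linear.linear bounded_linear_fst)
  moreover obtain f where f: "\<And>n::nat. f n \<in> span (elementary_tensors B A)" "f \<longlonglongrightarrow> X"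
    using assms unfolding min_tensor_def closure_sequential by blast
  ultimately have "\<forall>n. \<exists>Y. (f n, Y) \<in> span pairs" by fastforce
  then obtain g where g: "\<And>n. (f n, g n) \<in> span pairs" by metis
  then have G: "(f n, g n) \<in> graph" for n unfolding graph_def using closure_subset by blast
  have "norm (g m - g n) \<le> norm (f m - f n)" for m n
    using subspace_diff[OF subspace_graph G G, of m n] by (intro graph_norm_le) simp
  moreover have "Cauchy f" using f(2) by (rule LIMSEQ_imp_Cauchy)
  ultimately have "Cauchy g" unfolding Cauchy_def dist_norm by (meson le_less_trans)
  then obtain Y where "g \<longlonglongrightarrow> Y" using Cauchy_convergent convergent_def by blast
  with f(2) have "(\<lambda>n. (f n, g n)) \<longlonglongrightarrow> (X, Y)" by (rule tendsto_Pair)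
  then have "(X, Y) \<in> closure (span pairs)"
    unfolding closure_sequential using g by (intro exI[of _ "\<lambda>n. (f n, g n)"]) auto
  then show ?thesis by (auto simp: graph_def)
qed

lemma graph_min_tensor:
  assumes "(X, Y) \<in> graph"
  shows "X \<in> min_tensor B A" "Y \<in> min_tensor C A"
proof -
  have "fst p \<in> min_tensor B A" "snd p \<in> min_tensor C A" if "p \<in> pairs" for p
    using that by (auto simp: pairs_def intro!: op_tensor_in_min_tensor qC)
  then show "X \<in> min_tensor B A" "Y \<in> min_tensor C A"
    using bounded_linear_closure_subset[OF bounded_linear_fst _ assms[unfolded graph_def], of "elementary_tensors B A"]
      bounded_linear_closure_subset[OF bounded_linear_snd _ assms[unfolded graph_def], of "elementary_tensors C A"]
    by (auto simp: min_tensor_def)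
qed

definition extension :: "('i \<times> 'a) op \<Rightarrow> ('j \<times> 'a) op" where
  "extension X = (SOME Y. (X, Y) \<in> graph)"

lemma extension_graph: "X \<in> min_tensor B A \<Longrightarrow> (X, extension X) \<in> graph"
  unfolding extension_def using graph_ex by (rule someI_ex)

lemma extension_eq:
  assumes "(X, Y) \<in> graph"
  shows "extension X = Y"
proof -
  have "(X, extension X) \<in> graph" using extension_graph graph_min_tensor(1)[OF assms] by blast
  from subspace_diff[OF subspace_graph this assms] have "norm (extension X - Y) \<le> 0"
    using graph_norm_le by fastforce
  then show ?thesis by simp
qed

lemma extension_op_tensor: "S \<in> B \<Longrightarrow> T \<in> A \<Longrightarrow> extension (op_tensor S T) = op_tensor (q S) T"
  by (intro extension_eq graph_base)

lemma graph_compose: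
  assumes "(X, Y) \<in> graph" "(X', Y') \<in> graph"
  shows "(X o\<^sub>L X', Y o\<^sub>L Y') \<in> graph"
proof -
  have "(fst a o\<^sub>L fst b, snd a o\<^sub>L snd b) \<in> closure (span pairs)" if "a \<in> pairs" "b \<in> pairs" for a b
  proof -
    from that obtain S T S' T' where "a = (op_tensor S T, op_tensor (q S) T)" "S \<in> B" "T \<in> A"
      "b = (op_tensor S' T', op_tensor (q S') T')" "S' \<in> B" "T' \<in> A" by (auto simp: pairs_def)
    then show ?thesis
      using graph_base[of "S o\<^sub>L S'" "T o\<^sub>L T'"] A
      by (simp add: op_tensor_compose clinear q.hom_compose q.compose graph_def cstar_algebra_def)
  qed
  from bounded_bilinear_closure_subset[OF bounded_bilinear_pair_compose this assms[unfolded graph_def]]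
  show ?thesis by (simp add: graph_def)
qed

lemma graph_adj:
  assumes "(X, Y) \<in> graph"
  shows "(adj X, adj Y) \<in> graph"
proof -
  have bl: "bounded_linear (\<lambda>p. (adj (fst p), adj (snd p)))"
    by (intro bounded_linear_Pair bounded_linear_compose[OF bounded_linear_adj] bounded_linear_fst bounded_linear_snd)
  have "(adj (fst a), adj (snd a)) \<in> closure (span pairs)" if "a \<in> pairs" for a
  proof -
    from that obtain S T where "a = (op_tensor S T, op_tensor (q S) T)" "S \<in> B" "T \<in> A"
      by (auto simp: pairs_def)
    then show ?thesis
      using graph_base[of "adj S" "adj T"]
      by (simp add: op_tensor_adj clinear q.hom_adj q.adj graph_def cstar_algebraD(3)[OF A])
  qed
  from bounded_linear_closure_subset[OF bl this assms[unfolded graph_def]]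
  show ?thesis by (simp add: graph_def)
qed

lemma graph_scaleC:
  assumes "(X, Y) \<in> graph"
  shows "(op_scaleC c X, op_scaleC c Y) \<in> graph"
proof -
  have bl: "bounded_linear (\<lambda>p. (op_scaleC c (fst p), op_scaleC c (snd p)))"
    by (intro bounded_linear_Pair bounded_linear_compose[OF bounded_linear_op_scaleC] bounded_linear_fst bounded_linear_snd)
  have "(op_scaleC c (fst a), op_scaleC c (snd a)) \<in> closure (span pairs)" if "a \<in> pairs" for a
  proof -
    from that obtain S T where "a = (op_tensor S T, op_tensor (q S) T)" "S \<in> B" "T \<in> A"
      by (auto simp: pairs_def)
    then show ?thesis
      using graph_base[of "op_scaleC c S" T]
      by (simp add: op_tensor_scaleC clinear q_scaleC cstar_algebraD(2)[OF B] graph_def)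
  qed
  from bounded_linear_closure_subset[OF bl this assms[unfolded graph_def]]
  show ?thesis by (simp add: graph_def)
qed

lemma star_hom_extension: "star_hom (min_tensor B A) (min_tensor C A) extension"
  unfolding star_hom_def
proof (intro conjI ballI allI)
  show "extension ` min_tensor B A \<subseteq> min_tensor C A"
    using extension_graph graph_min_tensor(2) by blast
  fix X assume X: "X \<in> min_tensor B A"
  note GX = extension_graph[OF X]
  show "extension (op_scaleC c X) = op_scaleC c (extension X)" for c
    by (rule extension_eq[OF graph_scaleC[OF GX]])
  have "op_clinear X" using X cstar_algebra_min_tensor[OF B A] by (simp add: cstar_algebraD)
  moreover have "op_clinear (extension X)"
    using graph_min_tensor(2)[OF GX] cstar_algebra_min_tensor[OF C A] by (simp add: cstar_algebraD)
  ultimately show "extension (op_adj X) = op_adj (extension X)"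
    using extension_eq[OF graph_adj[OF GX]] by (simp add: op_adj_eq)
  fix Y assume Y: "Y \<in> min_tensor B A"
  note GY = extension_graph[OF Y]
  show "extension (X + Y) = extension X + extension Y"
    using subspace_add[OF subspace_graph GX GY] by (intro extension_eq) simp
  show "extension (X o\<^sub>L Y) = extension X o\<^sub>L extension Y"
    by (rule extension_eq[OF graph_compose[OF GX GY]])
qed

sublocale ext: star_subalgebra_hom "min_tensor B A" extension
  by (rule star_hom_star_subalgebra_hom[OF cstar_algebra_min_tensor[OF B A] cstar_algebra_min_tensor[OF C A] star_hom_extension])

text \<open>The range is a closed subspace by \<open>range_closed\<close>, so it is enough that it
  contains the elementary tensors.\<close>

lemma extension_surj:
  assumes "q ` B = C"
  shows "extension ` min_tensor B A = min_tensor C A"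
proof
  show "extension ` min_tensor B A \<subseteq> min_tensor C A" using star_hom_extension by (simp add: star_hom_def)
  have "op_tensor S T \<in> extension ` min_tensor B A" if "S \<in> C" "T \<in> A" for S T
  proof -
    from that assms obtain S' where "S' \<in> B" "S = q S'" by blast
    then show ?thesis
      using extension_op_tensor[of S' T] op_tensor_in_min_tensor[of S' B T A] that by (metis image_eqI)
  qed
  then show "min_tensor C A \<subseteq> extension ` min_tensor B A"
    by (intro min_tensor_minimal[OF _ ext.range_subspace ext.range_closed]) blast
qed

lemma min_tensor_subset_kernel:
  assumes "J = {S \<in> B. q S = 0}"
  shows "min_tensor J A \<subseteq> {X \<in> min_tensor B A. extension X = 0}"
proof -
  interpret k: star_subalgebra "{X \<in> min_tensor B A. extension X = 0}" by (rule ext.kernel_star_subalgebra)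
  show ?thesis
    by (rule min_tensor_minimal[OF _ k.subspace k.closed])
       (auto simp: assms extension_op_tensor intro: op_tensor_in_min_tensor)
qed

end


section \<open>Property A and the Schur test\<close>

lemma graph_dist_le_iff: "graph_dist E x y \<le> enat n \<longleftrightarrow> (\<exists>m\<le>n. (x, y) \<in> E ^^ m)"
proof
  assume le: "graph_dist E x y \<le> enat n"
  show "\<exists>m\<le>n. (x, y) \<in> E ^^ m"
  proof (rule ccontr)
    assume "\<not> (\<exists>m\<le>n. (x, y) \<in> E ^^ m)"
    then have "enat (Suc n) \<le> graph_dist E x y"
      unfolding graph_dist_def by (intro INF_greatest) (auto simp: not_le Suc_le_eq)
    then have "enat (Suc n) \<le> enat n" using le by (rule order_trans)
    then show False by simp
  qed
next
  assume "\<exists>m\<le>n. (x, y) \<in> E ^^ m"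
  then obtain m where "m \<le> n" "(x, y) \<in> E ^^ m" by blast
  then have "graph_dist E x y \<le> enat m" unfolding graph_dist_def by (intro INF_lower) simp
  also have "\<dots> \<le> enat n" using \<open>m \<le> n\<close> by simp
  finally show "graph_dist E x y \<le> enat n" .
qed

lemma graph_ball_iff: "y \<in> graph_ball V E r x \<longleftrightarrow> y \<in> V \<and> (\<exists>m\<le>r. (x, y) \<in> E ^^ m)"
  by (simp add: graph_ball_def graph_dist_le_iff)

lemma graph_ball_mono: "y \<in> graph_ball V E r x \<Longrightarrow> r \<le> s \<Longrightarrow> y \<in> graph_ball V E s x"
  by (auto simp: graph_ball_iff intro: order_trans)

lemma graph_ball_trans:
  assumes "y \<in> graph_ball V E r x" "z \<in> graph_ball V E s y"
  shows "z \<in> graph_ball V E (r + s) x"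
proof -
  from assms obtain m k where "m \<le> r" "(x, y) \<in> E ^^ m" "k \<le> s" "(y, z) \<in> E ^^ k" "z \<in> V"
    by (auto simp: graph_ball_iff)
  then have "(x, z) \<in> E ^^ (m + k)" "m + k \<le> r + s" by (auto simp: relpow_add)
  then show ?thesis using \<open>z \<in> V\<close> by (auto simp: graph_ball_iff)
qed

lemma graph_ball_sym:
  assumes "sym E" "x \<in> V" "y \<in> graph_ball V E r x"
  shows "x \<in> graph_ball V E r y"
proof -
  have "(y, x) \<in> E ^^ m" if "(x, y) \<in> E ^^ m" for m
    using that
  proof (induction m arbitrary: y)
    case (Suc m)
    then obtain z where "(x, z) \<in> E ^^ m" "(z, y) \<in> E" by auto
    then have "(y, z) \<in> E" "(z, x) \<in> E ^^ m" using Suc.IH \<open>sym E\<close> by (auto dest: symD)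
    then show ?case by (rule relpow_Suc_I2)
  qed simp
  then show ?thesis using assms(2,3) by (auto simp: graph_ball_iff)
qed

section \<open>Bounded geometry and weights from Property A\<close>

definition bounded_geometry :: "'v set \<Rightarrow> ('v \<times> 'v) set \<Rightarrow> bool" where
  "bounded_geometry V E \<longleftrightarrow> sym E \<and>
     (\<forall>r. \<exists>N. \<forall>x\<in>V. finite (graph_ball V E r x) \<and> card (graph_ball V E r x) \<le> N)"

text \<open>Moduli of the Property A vectors keep norms and supports, and the reverse triangle
  inequality keeps them close. The Gram kernel becomes real and nonnegative, as needed for estimates
  with the real inner product. The bound \<open>(1/n)^2\<close> is relaxed to
  \<open>1/n\<close>.\<close>

lemma property_A_weights:
  assumes "property_A V E" "bounded_geometry V E" "n \<ge> 1"
  shows "\<exists>(a :: 'v \<Rightarrow> 'v \<Rightarrow> real) r. (\<forall>x z. 0 \<le> a x z) \<and>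
    (\<forall>x z. a x z \<noteq> 0 \<longrightarrow> x \<in> V \<and> z \<in> graph_ball V E r x) \<and>
    (\<forall>x U. x \<in> V \<longrightarrow> finite U \<longrightarrow> graph_ball V E r x \<subseteq> U \<longrightarrow> (\<Sum>z\<in>U. (a x z)\<^sup>2) = 1) \<and>
    (\<forall>x y U. x \<in> V \<longrightarrow> y \<in> V \<longrightarrow> graph_dist E x y \<le> enat n \<longrightarrow> finite U \<longrightarrow>
       (\<Sum>z\<in>U. (a x z - a y z)\<^sup>2) \<le> 1 / real n)"
proof -
  obtain s :: "'v \<Rightarrow> 'v ell2" and r where
    s: "\<And>x. x \<in> V \<Longrightarrow> norm (s x) = 1"
    "\<And>x y. x \<in> V \<Longrightarrow> y \<in> V \<Longrightarrow> graph_dist E x y \<le> enat n \<Longrightarrow> norm (s x - s y) \<le> 1 / real n"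
    "\<And>x. x \<in> V \<Longrightarrow> {y. Rep_ell2 (s x) y \<noteq> 0} \<subseteq> graph_ball V E r x"
  proof -
    obtain \<sigma> :: "nat \<Rightarrow> 'v \<Rightarrow> 'v ell2" where "\<forall>n\<ge>1.
        (\<forall>x\<in>V. norm (\<sigma> n x) = 1) \<and>
        (\<forall>x\<in>V. \<forall>y\<in>V. graph_dist E x y \<le> enat n \<longrightarrow> norm (\<sigma> n x - \<sigma> n y) \<le> 1 / real n) \<and>
        (\<exists>R>0. \<forall>x\<in>V. {y. Rep_ell2 (\<sigma> n x) y \<noteq> 0} \<subseteq> graph_ball V E R x)"
      using assms(1) unfolding property_A_def by (elim exE)
    then have \<sigma>: "\<forall>x\<in>V. norm (\<sigma> n x) = 1"
        "\<forall>x\<in>V. \<forall>y\<in>V. graph_dist E x y \<le> enat n \<longrightarrow> norm (\<sigma> n x - \<sigma> n y) \<le> 1 / real n"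
        "\<exists>R>0. \<forall>x\<in>V. {y. Rep_ell2 (\<sigma> n x) y \<noteq> 0} \<subseteq> graph_ball V E R x"
      using \<open>n \<ge> 1\<close> by simp_all
    from \<sigma>(3) obtain r where "\<forall>x\<in>V. {y. Rep_ell2 (\<sigma> n x) y \<noteq> 0} \<subseteq> graph_ball V E r x" by (elim exE conjE)
    with \<sigma>(1,2) show ?thesis by (intro that[of "\<sigma> n" r]) simp_all
  qed
  define a where "a x z = (if x \<in> V then cmod (Rep_ell2 (s x) z) else 0)" for x z
  show ?thesis
  proof (intro exI[of _ a] exI[of _ r] conjI allI impI)
    show "0 \<le> a x z" for x z by (simp add: a_def)
    show "x \<in> V" if "a x z \<noteq> 0" for x z
      using that by (auto simp: a_def split: if_splits)
    show "z \<in> graph_ball V E r x" if "a x z \<noteq> 0" for x z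
      using that s(3)[of x] by (auto simp: a_def split: if_splits)
    show "(\<Sum>z\<in>U. (a x z)\<^sup>2) = 1" if "x \<in> V" "finite U" "graph_ball V E r x \<subseteq> U" for x U
    proof -
      have "(norm (s x))\<^sup>2 = (\<Sum>\<^sub>\<infinity>z\<in>U. (cmod (Rep_ell2 (s x) z))\<^sup>2)"
        unfolding norm_ell2_square by (rule infsum_cong_neutral) (use that s(3) in auto)
      then show ?thesis using that s(1) by (simp add: a_def)
    qed
    show "(\<Sum>z\<in>U. (a x z - a y z)\<^sup>2) \<le> 1 / real n"
      if "x \<in> V" "y \<in> V" "graph_dist E x y \<le> enat n" "finite U" for x y U
    proof -
      have "(\<Sum>z\<in>U. (a x z - a y z)\<^sup>2) \<le> (\<Sum>z\<in>U. (cmod (Rep_ell2 (s x - s y) z))\<^sup>2)"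
        using that by (intro sum_mono) (auto simp: a_def minus_ell2.rep_eq abs_le_square_iff[symmetric] norm_triangle_ineq3)
      also have "\<dots> \<le> (norm (s x - s y))\<^sup>2" by (rule sum_le_norm_ell2[OF \<open>finite U\<close>])
      also have "\<dots> \<le> (1 / real n)\<^sup>2" using s(2) that by (intro power_mono) auto
      also have "\<dots> \<le> 1 / real n" using \<open>n \<ge> 1\<close> by (simp add: power2_eq_square field_simps)
      finally show ?thesis .
    qed
  qed
qed

text \<open>Cauchy-Schwarz over the pairs satisfying \<open>P\<close>, among which each index occurs
  at most \<open>N\<close> times in either position. Only upper bounds on \<open>m\<close> are asked
  for, matching the one-sided form of \<open>norm_block_boundI\<close>.\<close>

lemma schur_test:
  fixes m :: "'v \<Rightarrow> 'v \<Rightarrow> real" and u v :: "'v \<Rightarrow> real"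
  assumes W: "finite W" and m: "\<And>x y. x \<in> W \<Longrightarrow> y \<in> W \<Longrightarrow> m x y \<le> c * (u y * v x)"
    and m0: "\<And>x y. x \<in> W \<Longrightarrow> y \<in> W \<Longrightarrow> \<not> P x y \<Longrightarrow> m x y = 0"
    and rows: "\<And>x. x \<in> W \<Longrightarrow> card {y \<in> W. P x y} \<le> N"
    and cols: "\<And>y. y \<in> W \<Longrightarrow> card {x \<in> W. P x y} \<le> N"
    and c: "0 \<le> c" and f: "(\<Sum>y\<in>W. (u y)\<^sup>2) \<le> f\<^sup>2" "0 \<le> f" and g: "(\<Sum>x\<in>W. (v x)\<^sup>2) \<le> g\<^sup>2" "0 \<le> g"
  shows "(\<Sum>x\<in>W. \<Sum>y\<in>W. m x y) \<le> c * real N * f * g"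
proof -
  define Q where "Q = {(x, y). x \<in> W \<and> y \<in> W \<and> P x y}"
  have Q: "finite Q" unfolding Q_def by (rule finite_subset[of _ "W \<times> W"]) (use W in auto)
  have Qsum: "(\<Sum>p\<in>Q. h p) = (\<Sum>x\<in>W. \<Sum>y\<in>W. if P x y then h (x, y) else 0)" for h :: "'v \<times> 'v \<Rightarrow> real"
    unfolding sum.cartesian_product Q_def
    by (rule sum.mono_neutral_cong_left) (use W in \<open>auto split: if_splits\<close>)
  have count: "(\<Sum>y\<in>W. if R y then b else 0) = real (card {y \<in> W. R y}) * b" for R and b :: real
    using W by (simp add: sum.If_cases Int_def)
  have U: "(\<Sum>p\<in>Q. (u (snd p))\<^sup>2) \<le> real N * f\<^sup>2"
  proof -
    have "(\<Sum>p\<in>Q. (u (snd p))\<^sup>2) = (\<Sum>y\<in>W. real (card {x \<in> W. P x y}) * (u y)\<^sup>2)"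
      unfolding Qsum snd_conv by (subst sum.swap) (simp add: count)
    also have "\<dots> \<le> (\<Sum>y\<in>W. real N * (u y)\<^sup>2)" using cols by (intro sum_mono mult_right_mono) auto
    also have "\<dots> \<le> real N * f\<^sup>2" using f(1) by (simp add: mult_left_mono flip: sum_distrib_left)
    finally show ?thesis .
  qed
  have V: "(\<Sum>p\<in>Q. (v (fst p))\<^sup>2) \<le> real N * g\<^sup>2"
  proof -
    have "(\<Sum>p\<in>Q. (v (fst p))\<^sup>2) = (\<Sum>x\<in>W. real (card {y \<in> W. P x y}) * (v x)\<^sup>2)"
      unfolding Qsum fst_conv by (simp add: count)
    also have "\<dots> \<le> (\<Sum>x\<in>W. real N * (v x)\<^sup>2)" using rows by (intro sum_mono mult_right_mono) auto
    also have "\<dots> \<le> real N * g\<^sup>2" using g(1) by (simp add: mult_left_mono flip: sum_distrib_left)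
    finally show ?thesis .
  qed
  have "(\<Sum>p\<in>Q. u (snd p) * v (fst p))\<^sup>2 \<le> (\<Sum>p\<in>Q. (u (snd p))\<^sup>2) * (\<Sum>p\<in>Q. (v (fst p))\<^sup>2)"
    by (rule Cauchy_Schwarz_ineq_sum)
  also have "\<dots> \<le> (real N * f\<^sup>2) * (real N * g\<^sup>2)"
    by (intro mult_mono U V sum_nonneg) auto
  also have "\<dots> = (real N * f * g)\<^sup>2" by (simp add: power2_eq_square)
  finally have *: "(\<Sum>p\<in>Q. u (snd p) * v (fst p)) \<le> real N * f * g"
    by (rule power2_le_imp_le) (use f g in simp)
  have "(\<Sum>x\<in>W. \<Sum>y\<in>W. m x y) = (\<Sum>p\<in>Q. m (fst p) (snd p))"
    unfolding Qsum by (intro sum.cong refl) (use m0 in auto)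
  also have "\<dots> \<le> (\<Sum>p\<in>Q. c * (u (snd p) * v (fst p)))"
    by (intro sum_mono) (auto simp: Q_def intro!: m)
  also have "\<dots> \<le> c * (real N * f * g)" using * c by (simp add: mult_left_mono flip: sum_distrib_left)
  finally show ?thesis by (simp add: mult_ac)
qed

lemma inner_entry_le:
  "inner (blinfun_apply (entry Y x y) f) g \<le> norm (entry Y x y) * (norm f * norm g)"
proof -
  have "inner (entry Y x y f) g \<le> norm (entry Y x y f) * norm g" by (rule norm_cauchy_schwarz)
  also have "\<dots> \<le> (norm (entry Y x y) * norm f) * norm g" by (intro mult_right_mono norm_blinfun) auto
  finally show ?thesis by (simp add: mult_ac)
qed

text \<open>The multiplier is the Gram matrix of the vectors \<open>a x\<close>. The multiplied form
  is the sum over \<open>z\<close> of the form of \<open>Y\<close> at the vectors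
  \<open>D z F\<close> and \<open>D z G\<close>, with \<open>D z\<close> diagonal; since the
  \<open>(norm (D z H))^2\<close> add up to at most \<open>(norm H)^2\<close>, Cauchy-Schwarz in
  \<open>z\<close> finishes.\<close>

lemma gram_multiplier_bound:
  fixes Y :: "('i \<times> 'v) op" and F G :: "('i \<times> 'v) ell2" and a :: "'v \<Rightarrow> 'z \<Rightarrow> real"
  assumes W: "finite W" and U: "finite U" and a: "\<And>x. x \<in> W \<Longrightarrow> (\<Sum>z\<in>U. (a x z)\<^sup>2) \<le> 1"
  shows "(\<Sum>x\<in>W. \<Sum>y\<in>W. (\<Sum>z\<in>U. a x z * a y z) * inner (entry Y x y (slice y F)) (slice x G))
           \<le> norm Y * norm F * norm G"
proof -
  define D :: "'z \<Rightarrow> ('i \<times> 'v) op" where "D z = (\<Sum>y\<in>W. a y z *\<^sub>R (emb y o\<^sub>L slice y))" for z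
  have sD: "slice x (D z H) = (if x \<in> W then a x z *\<^sub>R slice x H else 0)" for x z H
  proof -
    have "slice x (D z H) = (\<Sum>y\<in>W. if x = y then a y z *\<^sub>R slice y H else 0)"
      unfolding D_def blinfun.sum_left blinfun.sum_right
      by (intro sum.cong refl) (simp add: blinfun.scaleR_left blinfun.scaleR_right slice_emb)
    then show ?thesis using W by simp
  qed
  have bD: "block W (D z H) = D z H" for z H
    by (rule slice_eqI) (simp add: slice_block W sD)
  have nD: "(\<Sum>z\<in>U. (norm (D z H))\<^sup>2) \<le> (norm H)\<^sup>2" for H
  proof -
    have "(norm (D z H))\<^sup>2 = (\<Sum>y\<in>W. (a y z)\<^sup>2 * (norm (slice y H))\<^sup>2)" for z
      using norm_block[OF W, of "D z H"] unfolding bD by (simp add: sD power_mult_distrib)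
    then have "(\<Sum>z\<in>U. (norm (D z H))\<^sup>2) = (\<Sum>y\<in>W. (\<Sum>z\<in>U. (a y z)\<^sup>2) * (norm (slice y H))\<^sup>2)"
      by (simp add: sum_distrib_right) (rule sum.swap)
    also have "\<dots> \<le> (\<Sum>y\<in>W. 1 * (norm (slice y H))\<^sup>2)" using a by (intro sum_mono mult_right_mono) auto
    also have "\<dots> \<le> (norm H)\<^sup>2" using sum_slice_le[OF W] by simp
    finally show ?thesis .
  qed
  have "(\<Sum>x\<in>W. \<Sum>y\<in>W. (\<Sum>z\<in>U. a x z * a y z) * inner (entry Y x y (slice y F)) (slice x G))
      = (\<Sum>x\<in>W. \<Sum>y\<in>W. \<Sum>z\<in>U. a x z * a y z * inner (entry Y x y (slice y F)) (slice x G))"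
    by (simp add: sum_distrib_right)
  also have "\<dots> = (\<Sum>x\<in>W. \<Sum>z\<in>U. \<Sum>y\<in>W. a x z * a y z * inner (entry Y x y (slice y F)) (slice x G))"
    by (intro sum.cong refl sum.swap)
  also have "\<dots> = (\<Sum>z\<in>U. \<Sum>x\<in>W. \<Sum>y\<in>W. a x z * a y z * inner (entry Y x y (slice y F)) (slice x G))"
    by (rule sum.swap)
  also have "\<dots> = (\<Sum>z\<in>U. inner (Y (block W (D z F))) (block W (D z G)))"
    unfolding inner_block_entry by (intro sum.cong refl) (simp add: sD blinfun.scaleR_right)
  also have "\<dots> \<le> (\<Sum>z\<in>U. norm Y * (norm (D z F) * norm (D z G)))"
  proof (rule sum_mono)
    fix z
    have "inner (Y (D z F)) (D z G) \<le> norm (Y (D z F)) * norm (D z G)" by (rule norm_cauchy_schwarz)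
    also have "\<dots> \<le> (norm Y * norm (D z F)) * norm (D z G)" by (intro mult_right_mono norm_blinfun) auto
    finally show "inner (Y (block W (D z F))) (block W (D z G)) \<le> norm Y * (norm (D z F) * norm (D z G))"
      by (simp add: bD mult_ac)
  qed
  also have "\<dots> = norm Y * (\<Sum>z\<in>U. norm (D z F) * norm (D z G))" by (simp add: sum_distrib_left)
  also have "\<dots> \<le> norm Y * (norm F * norm G)"
  proof (rule mult_left_mono)
    have "(\<Sum>z\<in>U. norm (D z F) * norm (D z G))\<^sup>2 \<le> (\<Sum>z\<in>U. (norm (D z F))\<^sup>2) * (\<Sum>z\<in>U. (norm (D z G))\<^sup>2)"
      by (rule Cauchy_Schwarz_ineq_sum)
    also have "\<dots> \<le> (norm F)\<^sup>2 * (norm G)\<^sup>2" by (intro mult_mono nD sum_nonneg) auto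
    finally show "(\<Sum>z\<in>U. norm (D z F) * norm (D z G)) \<le> norm F * norm G"
      unfolding power_mult_distrib[symmetric] by (rule power2_le_imp_le) simp
  qed simp
  finally show ?thesis by (simp add: mult_ac)
qed

text \<open>Values in any type with a zero, so that scalar coefficients \<open>mcoeff T\<close> and
  operator entries \<open>entry X\<close> are covered alike.\<close>

definition propagation :: "'v set \<Rightarrow> ('v \<times> 'v) set \<Rightarrow> nat \<Rightarrow> ('v \<Rightarrow> 'v \<Rightarrow> 'b::zero) \<Rightarrow> bool" where
  "propagation V E r K \<longleftrightarrow> (\<forall>x y. K x y \<noteq> 0 \<longrightarrow> x \<in> V \<and> y \<in> graph_ball V E r x)"

text \<open>
  An operator that is close to one of finite propagation is small once all its matrix entries are
  small: multiply it by the Gram matrix of the Property A vectors, which changes it little and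
  truncates it to a bounded neighbourhood of the diagonal, where the Schur test applies.
\<close>

lemma property_A_estimate:
  fixes V :: "'v set"
  assumes pA: "property_A V E" and bg: "bounded_geometry V E" and "0 < \<epsilon>" "0 \<le> \<delta>" "0 \<le> M"
  obtains \<eta> where "0 < \<eta>" "\<And>Z Z0 :: ('i \<times> 'v) op. propagation V E r (entry Z0) \<Longrightarrow> norm Z0 \<le> M \<Longrightarrow>
    norm (Z - Z0) \<le> \<delta> \<Longrightarrow> (\<And>x y. norm (entry Z x y) \<le> \<eta>) \<Longrightarrow> norm Z \<le> 2 * \<delta> + 2 * \<epsilon>"
proof -
  have sym: "sym E" using bg by (simp add: bounded_geometry_def)
  obtain N where N: "\<And>x. x \<in> V \<Longrightarrow> finite (graph_ball V E r x) \<and> card (graph_ball V E r x) \<le> N"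
    using bg unfolding bounded_geometry_def by meson
  \<comment> \<open>\<open>n \<ge> r\<close> makes the weights close on all pairs within the
    propagation of \<open>Z0\<close>; the third condition makes the Schur bound for
    \<open>(1 - k) Z0\<close>, namely \<open>M * N / n\<close>, at most
    \<open>\<epsilon>\<close>.\<close>
  obtain n :: nat where n: "n \<ge> 1" "n \<ge> r" "real n \<ge> M * N / \<epsilon>"
  proof
    let ?n = "max (max 1 r) (nat \<lceil>M * N / \<epsilon>\<rceil>)"
    show "?n \<ge> 1" "?n \<ge> r" by auto
    have "M * N / \<epsilon> \<le> real (nat \<lceil>M * N / \<epsilon>\<rceil>)" by (rule real_nat_ceiling_ge)
    also have "\<dots> \<le> real ?n" by simp
    finally show "real ?n \<ge> M * N / \<epsilon>" .
  qed
  have n': "1 / real n * M * real N \<le> \<epsilon>" using n \<open>0 < \<epsilon>\<close> by (simp add: field_simps)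
  have "\<exists>(a :: 'v \<Rightarrow> 'v \<Rightarrow> real) s. (\<forall>x z. 0 \<le> a x z) \<and>
    (\<forall>x z. a x z \<noteq> 0 \<longrightarrow> x \<in> V \<and> z \<in> graph_ball V E s x) \<and>
    (\<forall>x U. x \<in> V \<longrightarrow> finite U \<longrightarrow> graph_ball V E s x \<subseteq> U \<longrightarrow> (\<Sum>z\<in>U. (a x z)\<^sup>2) = 1) \<and>
    (\<forall>x y U. x \<in> V \<longrightarrow> y \<in> V \<longrightarrow> graph_dist E x y \<le> enat n \<longrightarrow> finite U \<longrightarrow>
       (\<Sum>z\<in>U. (a x z - a y z)\<^sup>2) \<le> 1 / real n)"
    by (rule property_A_weights[OF pA bg n(1)])
  then obtain a :: "'v \<Rightarrow> 'v \<Rightarrow> real" and s where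
    "\<forall>x z. 0 \<le> a x z" "\<forall>x z. a x z \<noteq> 0 \<longrightarrow> x \<in> V \<and> z \<in> graph_ball V E s x"
    "\<forall>x U. x \<in> V \<longrightarrow> finite U \<longrightarrow> graph_ball V E s x \<subseteq> U \<longrightarrow> (\<Sum>z\<in>U. (a x z)\<^sup>2) = 1"
    "\<forall>x y U. x \<in> V \<longrightarrow> y \<in> V \<longrightarrow> graph_dist E x y \<le> enat n \<longrightarrow> finite U \<longrightarrow>
       (\<Sum>z\<in>U. (a x z - a y z)\<^sup>2) \<le> 1 / real n"
    by (elim exE conjE)
  note a0 = this(1)[rule_format] and as = this(2)[rule_format]
    and a1 = this(3)[rule_format] and ad = this(4)[rule_format]
  obtain N' where N': "\<And>x. x \<in> V \<Longrightarrow> finite (graph_ball V E (s + s) x) \<and> card (graph_ball V E (s + s) x) \<le> N'"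
    using bg unfolding bounded_geometry_def by meson
  have fs: "finite (graph_ball V E s x)" if "x \<in> V" for x
    using bg that unfolding bounded_geometry_def by meson
  \<comment> \<open>\<open>N'\<close> bounds the balls of radius \<open>s + s\<close>, outside which
    the Gram kernel vanishes; adding 1 keeps the denominator positive.\<close>
  define \<eta> where "\<eta> = \<epsilon> / (real N' + 1)"
  have \<eta>: "0 < \<eta>" "\<eta> * real N' \<le> \<epsilon>" using \<open>0 < \<epsilon>\<close> by (auto simp: \<eta>_def field_simps)
  show ?thesis
  proof (rule that[OF \<eta>(1)])
    fix Z Z0 :: "('i \<times> 'v) op"
    assume pr: "propagation V E r (entry Z0)" and M: "norm Z0 \<le> M" and \<delta>: "norm (Z - Z0) \<le> \<delta>"
      and ent: "\<And>x y. norm (entry Z x y) \<le> \<eta>"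
    show "norm Z \<le> 2 * \<delta> + 2 * \<epsilon>"
    proof (rule norm_block_boundI)
      fix W :: "'v set" and F G :: "('i \<times> 'v) ell2"
      assume W: "finite W"
      \<comment> \<open>\<open>U\<close> contains the supports of the weights at all points of
        \<open>W \<inter> V\<close>, so sums over \<open>U\<close> lose nothing of their norms and
        inner products.\<close>
      define U where "U = (\<Union>x\<in>W \<inter> V. graph_ball V E s x)"
      have U: "finite U" unfolding U_def using W fs by auto
      have UI: "graph_ball V E s x \<subseteq> U" if "x \<in> W" "x \<in> V" for x
        using that by (auto simp: U_def)
      have aU: "(\<Sum>z\<in>U. (a x z)\<^sup>2) \<le> 1" if "x \<in> W" for x
      proof (cases "x \<in> V")
        case True
        then show ?thesis using a1[OF True U UI[OF that True]] by simp
      next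
        case False
        then have "a x z = 0" for z using as by blast
        then show ?thesis by simp
      qed
      define k where "k x y = (\<Sum>z\<in>U. a x z * a y z)" for x y
      have k0: "0 \<le> k x y" for x y unfolding k_def by (intro sum_nonneg mult_nonneg_nonneg a0)
      \<comment> \<open>Polarisation: closeness of the weight vectors becomes closeness of
        \<open>k\<close> to 1.\<close>
      have kd: "(\<Sum>z\<in>U. (a x z - a y z)\<^sup>2) = (\<Sum>z\<in>U. (a x z)\<^sup>2) + (\<Sum>z\<in>U. (a y z)\<^sup>2) - 2 * k x y" for x y
        by (simp add: k_def power2_diff sum.distrib sum_subtractf sum_distrib_left mult.assoc)
      have k1: "k x y \<le> 1" if "x \<in> W" "y \<in> W" for x y
      proof -
        have "0 \<le> (\<Sum>z\<in>U. (a x z - a y z)\<^sup>2)" by (intro sum_nonneg) auto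
        then show ?thesis using kd[of x y] aU[OF that(1)] aU[OF that(2)] by linarith
      qed
      have kn: "1 - k x y \<le> 1 / real n" if "x \<in> W" "y \<in> W" "x \<in> V" "y \<in> graph_ball V E r x" for x y
      proof -
        have y: "y \<in> V" "graph_dist E x y \<le> enat n"
          using that n(2) by (auto simp: graph_ball_def intro: order_trans)
        have "(\<Sum>z\<in>U. (a x z)\<^sup>2) = 1" "(\<Sum>z\<in>U. (a y z)\<^sup>2) = 1"
          by (intro a1 U UI that y)+
        then have "2 - 2 * k x y \<le> 1 / real n" using ad[OF \<open>x \<in> V\<close> y U] unfolding kd by simp
        moreover have "0 \<le> 1 / real n" by simp
        ultimately show ?thesis by linarith
      qed
      have ks: "x \<in> V \<and> y \<in> graph_ball V E (s + s) x" if "k x y \<noteq> 0" for x y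
      proof -
        obtain z where "a x z * a y z \<noteq> 0" using \<open>k x y \<noteq> 0\<close> unfolding k_def by (meson sum.neutral)
        then have z: "x \<in> V" "z \<in> graph_ball V E s x" "y \<in> V" "z \<in> graph_ball V E s y" using as by auto
        have "y \<in> graph_ball V E s z" by (rule graph_ball_sym[OF sym z(3,4)])
        with z show ?thesis using graph_ball_trans by metis
      qed
      define \<beta> where "\<beta> Y x y = inner (entry Y x y (slice y F)) (slice x G)" for Y :: "('i \<times> 'v) op" and x y
      have \<beta>_diff: "\<beta> (Y - Y') x y = \<beta> Y x y - \<beta> Y' x y" for Y Y' x y
        by (simp add: \<beta>_def entry_diff blinfun.diff_left inner_diff_left)
      have \<beta>0: "\<beta> Z0 x y = 0" if "\<not> (x \<in> V \<and> y \<in> graph_ball V E r x)" for x y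
      proof -
        have "entry Z0 x y = 0" using pr that unfolding propagation_def by blast
        then show ?thesis by (simp add: \<beta>_def)
      qed
      have \<beta>_le: "\<beta> Y x y \<le> norm (entry Y x y) * (norm (slice y F) * norm (slice x G))" for Y x y
        unfolding \<beta>_def by (rule inner_entry_le)
      have card_le: "card {y \<in> W. x \<in> V \<and> y \<in> graph_ball V E t x} \<le> K"
        "card {x \<in> W. x \<in> V \<and> y \<in> graph_ball V E t x} \<le> K"
        if K: "\<And>x. x \<in> V \<Longrightarrow> finite (graph_ball V E t x) \<and> card (graph_ball V E t x) \<le> K" for t K x y
      proof -
        show "card {y \<in> W. x \<in> V \<and> y \<in> graph_ball V E t x} \<le> K"
        proof (cases "x \<in> V")
          case True
          then have "card {y \<in> W. x \<in> V \<and> y \<in> graph_ball V E t x} \<le> card (graph_ball V E t x)"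
            using K by (intro card_mono) auto
          then show ?thesis using K[OF True] by simp
        qed simp
        show "card {x \<in> W. x \<in> V \<and> y \<in> graph_ball V E t x} \<le> K"
        proof (cases "y \<in> V")
          case True
          then have "card {x \<in> W. x \<in> V \<and> y \<in> graph_ball V E t x} \<le> card (graph_ball V E t y)"
            using K graph_ball_sym[OF sym] by (intro card_mono) auto
          then show ?thesis using K[OF True] by simp
        qed (simp add: graph_ball_def)
      qed
      have 1: "(\<Sum>x\<in>W. \<Sum>y\<in>W. \<beta> (Z - Z0) x y) \<le> \<delta> * norm F * norm G"
      proof -
        have b: "norm (block W H) \<le> norm H" for H :: "('i \<times> 'v) ell2"
          using sum_slice_le[OF W, of H] norm_block[OF W, of H] by (rule_tac power2_le_imp_le) auto
        have "(\<Sum>x\<in>W. \<Sum>y\<in>W. \<beta> (Z - Z0) x y) = inner ((Z - Z0) (block W F)) (block W G)"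
          unfolding \<beta>_def inner_block_entry ..
        also have "\<dots> \<le> norm ((Z - Z0) (block W F)) * norm (block W G)" by (rule norm_cauchy_schwarz)
        also have "\<dots> \<le> (norm (Z - Z0) * norm (block W F)) * norm (block W G)"
          by (intro mult_right_mono norm_blinfun) auto
        also have "\<dots> \<le> (\<delta> * norm F) * norm G"
          using \<open>0 \<le> \<delta>\<close> by (intro mult_mono b \<delta>) auto
        finally show ?thesis .
      qed
      have 2: "(\<Sum>x\<in>W. \<Sum>y\<in>W. (1 - k x y) * \<beta> Z0 x y) \<le> (1 / real n * M) * real N * norm F * norm G"
      proof (rule schur_test[where P = "\<lambda>x y. x \<in> V \<and> y \<in> graph_ball V E r x"
            and u = "\<lambda>y. norm (slice y F)" and v = "\<lambda>x. norm (slice x G)"])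
        fix x y assume xy: "x \<in> W" "y \<in> W"
        show "(1 - k x y) * \<beta> Z0 x y \<le> 1 / real n * M * (norm (slice y F) * norm (slice x G))"
        proof (cases "x \<in> V \<and> y \<in> graph_ball V E r x")
          case True
          have "(1 - k x y) * \<beta> Z0 x y \<le> (1 - k x y) * (norm (entry Z0 x y) * (norm (slice y F) * norm (slice x G)))"
            using k1[OF xy] by (intro mult_left_mono \<beta>_le) auto
          also have "\<dots> \<le> 1 / real n * (M * (norm (slice y F) * norm (slice x G)))"
            using True kn[OF xy] M norm_entry_le[of Z0 x y] \<open>0 \<le> M\<close> by (intro mult_mono) auto
          finally show ?thesis by (simp add: mult_ac)
        next
          case False
          then have "\<beta> Z0 x y = 0" by (rule \<beta>0)
          then show ?thesis using \<open>0 \<le> M\<close> by simp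
        qed
        show "(1 - k x y) * \<beta> Z0 x y = 0" if "\<not> (x \<in> V \<and> y \<in> graph_ball V E r x)"
          using \<beta>0[OF that] by simp
      qed (use W card_le[OF N] sum_slice_le[OF W] \<open>0 \<le> M\<close> in auto)
      have 3: "(\<Sum>x\<in>W. \<Sum>y\<in>W. k x y * \<beta> (Z0 - Z) x y) \<le> \<delta> * norm F * norm G"
      proof -
        have "(\<Sum>x\<in>W. \<Sum>y\<in>W. k x y * \<beta> (Z0 - Z) x y) \<le> norm (Z0 - Z) * norm F * norm G"
          unfolding k_def \<beta>_def by (rule gram_multiplier_bound[OF W U aU])
        also have "\<dots> \<le> \<delta> * norm F * norm G"
          using \<delta> by (intro mult_right_mono) (auto simp: norm_minus_commute)
        finally show ?thesis .
      qed
      have 4: "(\<Sum>x\<in>W. \<Sum>y\<in>W. k x y * \<beta> Z x y) \<le> \<eta> * real N' * norm F * norm G"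
      proof (rule schur_test[where P = "\<lambda>x y. x \<in> V \<and> y \<in> graph_ball V E (s + s) x"
            and u = "\<lambda>y. norm (slice y F)" and v = "\<lambda>x. norm (slice x G)"])
        fix x y assume xy: "x \<in> W" "y \<in> W"
        have "k x y * \<beta> Z x y \<le> k x y * (norm (entry Z x y) * (norm (slice y F) * norm (slice x G)))"
          by (intro mult_left_mono \<beta>_le k0)
        also have "\<dots> \<le> 1 * (\<eta> * (norm (slice y F) * norm (slice x G)))"
          using k1[OF xy] ent \<eta> by (intro mult_mono) auto
        finally show "k x y * \<beta> Z x y \<le> \<eta> * (norm (slice y F) * norm (slice x G))" by simp
        show "k x y * \<beta> Z x y = 0" if "\<not> (x \<in> V \<and> y \<in> graph_ball V E (s + s) x)"
          using ks that by auto
      qed (use W card_le[OF N'] sum_slice_le[OF W] \<eta> in auto)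
      have "inner (Z (block W F)) (block W G) = (\<Sum>x\<in>W. \<Sum>y\<in>W. \<beta> Z x y)"
        unfolding \<beta>_def inner_block_entry ..
      \<comment> \<open>Telescoping with \<open>Z0\<close>. In order, the four terms are bounded by
        the distance of \<open>Z\<close> from \<open>Z0\<close>, by the Schur test with
        \<open>1 - k\<close> small, by contractivity of the Gram multiplier, and by the Schur test
        with small entries.\<close>
      also have "\<dots> = (\<Sum>x\<in>W. \<Sum>y\<in>W. \<beta> (Z - Z0) x y + (1 - k x y) * \<beta> Z0 x y
          + k x y * \<beta> (Z0 - Z) x y + k x y * \<beta> Z x y)"
        by (intro sum.cong refl) (simp add: \<beta>_diff algebra_simps)
      also have "\<dots> = (\<Sum>x\<in>W. \<Sum>y\<in>W. \<beta> (Z - Z0) x y) + (\<Sum>x\<in>W. \<Sum>y\<in>W. (1 - k x y) * \<beta> Z0 x y)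
          + (\<Sum>x\<in>W. \<Sum>y\<in>W. k x y * \<beta> (Z0 - Z) x y) + (\<Sum>x\<in>W. \<Sum>y\<in>W. k x y * \<beta> Z x y)"
        by (simp add: sum.distrib)
      also have "\<dots> \<le> \<delta> * norm F * norm G + \<epsilon> * norm F * norm G + \<delta> * norm F * norm G + \<epsilon> * norm F * norm G"
      proof (intro add_mono)
        show "(\<Sum>x\<in>W. \<Sum>y\<in>W. (1 - k x y) * \<beta> Z0 x y) \<le> \<epsilon> * norm F * norm G"
          by (rule order_trans[OF 2]) (use n' in \<open>intro mult_right_mono; simp\<close>)
        show "(\<Sum>x\<in>W. \<Sum>y\<in>W. k x y * \<beta> Z x y) \<le> \<epsilon> * norm F * norm G"
          by (rule order_trans[OF 4]) (use \<eta> in \<open>intro mult_right_mono; simp\<close>)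
      qed (fact 1, fact 3)
      also have "\<dots> = (2 * \<delta> + 2 * \<epsilon>) * norm F * norm G" by (simp add: algebra_simps)
      finally show "inner (Z (block W F)) (block W G) \<le> (2 * \<delta> + 2 * \<epsilon>) * norm F * norm G" .
    qed (use \<open>0 < \<epsilon>\<close> \<open>0 \<le> \<delta>\<close> in simp)
  qed
qed


section \<open>Exactness from Property A\<close>

lemma op_scaleC_add_left: "op_scaleC (c + d) T = op_scaleC c T + op_scaleC d T"
  by (rule blinfun_eqI) (simp add: blinfun.add_left scaleC_add_left)

lemma op_scaleC_scaleR_left: "op_scaleC (r *\<^sub>R c) T = r *\<^sub>R op_scaleC c T"
  by (rule blinfun_eqI)
     (simp add: blinfun.scaleR_left scaleR_conv_of_real scaleC_scaleC[symmetric] scaleC_of_real)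

lemma bounded_linear_op_scaleC_left: "bounded_linear (\<lambda>c. op_scaleC c T)"
  by (rule bounded_linear_intro[where K = "norm T"])
     (auto simp: op_scaleC_add_left op_scaleC_scaleR_left norm_op_scaleC_le)

text \<open>For an elementary tensor the entries lie in a continuous image of a closed disc, and
  sums of compact sets are compact.\<close>

lemma entries_compact:
  fixes B :: "'i op set" and A :: "'j op set" and X :: "('i \<times> 'j) op"
  assumes lin: "\<And>S. S \<in> B \<Longrightarrow> op_clinear S" "\<And>T. T \<in> A \<Longrightarrow> op_clinear T"
    and X: "X \<in> span (elementary_tensors B A)"
  obtains K where "compact K" "\<And>x y. entry X x y \<in> K"
proof -
  let ?S = "{X :: ('i \<times> 'j) op. \<exists>K. compact K \<and> (\<forall>x y. entry X x y \<in> K)}"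
  have "X \<in> ?S"
  proof (rule subsetD[OF span_minimal X])
    show "elementary_tensors B A \<subseteq> ?S"
    proof safe
      fix S T assume ST: "S \<in> B" "T \<in> A"
      have "compact ((\<lambda>c. op_scaleC c S) ` cball 0 (norm T))"
        by (intro compact_continuous_image linear_continuous_on bounded_linear_op_scaleC_left compact_cball)
      moreover have "entry (op_tensor S T) x y \<in> (\<lambda>c. op_scaleC c S) ` cball 0 (norm T)" for x y
        using ST by (simp add: entry_op_tensor lin cmod_mcoeff_le)
      ultimately show "\<exists>K. compact K \<and> (\<forall>x y. entry (op_tensor S T) x y \<in> K)" by blast
    qed
    show "subspace ?S"
      unfolding subspace_def
    proof (intro conjI ballI allI)
      show "0 \<in> ?S"
        by (auto simp: entry_0 intro!: exI[of _ "{0}"])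
      fix X :: "('i \<times> 'j) op" assume "X \<in> ?S"
      then obtain K where K: "compact K" "\<And>x y. entry X x y \<in> K" by blast
      show "c *\<^sub>R X \<in> ?S" for c
        using compact_scaling[OF K(1), of c] K(2) by (auto simp: entry_scaleR)
      fix Y :: "('i \<times> 'j) op" assume "Y \<in> ?S"
      then obtain L where L: "compact L" "\<And>x y. entry Y x y \<in> L" by blast
      have "entry (X + Y) x y \<in> {k + l |k l. k \<in> K \<and> l \<in> L}" for x y
        using K(2)[of x y] L(2)[of x y] unfolding entry_add by blast
      with compact_sums[OF K(1) L(1)] show "X + Y \<in> ?S" by blast
    qed
  qed
  then show ?thesis using that by blast
qed

text \<open>The net consists of entries of \<open>X\<close> itself: in the application these lie in
  the ideal, whereas the entries of an approximant need not. Two errors of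
  \<open>\<epsilon> / 4\<close> place a centre within \<open>\<epsilon> / 2\<close> of each entry,
  and moving the centre onto an actual entry costs another \<open>\<epsilon> / 2\<close>.\<close>

lemma entries_totally_bounded:
  assumes lin: "\<And>S. S \<in> B \<Longrightarrow> op_clinear S" "\<And>T. T \<in> A \<Longrightarrow> op_clinear T"
    and X: "X \<in> min_tensor B A" and "0 < \<epsilon>"
  obtains K where "finite K" "K \<subseteq> range (\<lambda>(x, y). entry X x y)"
    "\<And>x y. \<exists>k\<in>K. norm (entry X x y - k) < \<epsilon>"
proof -
  have "0 < \<epsilon> / 4" using \<open>0 < \<epsilon>\<close> by simp
  with X obtain X0 where X0: "X0 \<in> span (elementary_tensors B A)" "dist X0 X < \<epsilon> / 4"
    unfolding min_tensor_def closure_approachable by blast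
  obtain C where C: "compact C" "\<And>x y. entry X0 x y \<in> C" using entries_compact[OF lin X0(1)] by blast
  obtain D where D: "finite D" "C \<subseteq> (\<Union>c\<in>D. ball c (\<epsilon> / 4))"
    using C(1) \<open>0 < \<epsilon> / 4\<close> unfolding compact_eq_totally_bounded by meson
  have near: "\<exists>c\<in>D. dist c (entry X x y) < \<epsilon> / 2" for x y
  proof -
    have "entry X0 x y \<in> (\<Union>c\<in>D. ball c (\<epsilon> / 4))" using C(2) D(2) by blast
    then obtain c where c: "c \<in> D" "dist c (entry X0 x y) < \<epsilon> / 4" by auto
    have "dist (entry X0 x y) (entry X x y) < \<epsilon> / 4"
      using norm_entry_le[of "X0 - X" x y] X0(2) by (simp add: dist_norm entry_diff)
    then have "dist c (entry X x y) < \<epsilon> / 2"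
      using dist_triangle[of c "entry X x y" "entry X0 x y"] c(2) by linarith
    with c(1) show ?thesis by blast
  qed
  define R where "R = range (\<lambda>(x, y). entry X x y)"
  define D' where "D' = {c \<in> D. \<exists>r\<in>R. dist c r < \<epsilon> / 2}"
  define p where "p c = (SOME r. r \<in> R \<and> dist c r < \<epsilon> / 2)" for c
  have p: "p c \<in> R \<and> dist c (p c) < \<epsilon> / 2" if "c \<in> D'" for c
    unfolding p_def by (rule someI_ex) (use that in \<open>auto simp: D'_def\<close>)
  show ?thesis
  proof (rule that[of "p ` D'"])
    show "finite (p ` D')" using D(1) by (simp add: D'_def)
    show "p ` D' \<subseteq> range (\<lambda>(x, y). entry X x y)" using p unfolding R_def by blast
    fix x y
    obtain c where c: "c \<in> D" "dist c (entry X x y) < \<epsilon> / 2" using near by blast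
    have "entry X x y \<in> R" unfolding R_def by (rule range_eqI[of _ _ "(x, y)"]) simp
    with c have "c \<in> D'" by (auto simp: D'_def)
    moreover have "dist (entry X x y) (p c) < \<epsilon>"
      using dist_triangle[of "entry X x y" "p c" c] p[OF \<open>c \<in> D'\<close>] c(2) by (simp add: dist_commute)
    ultimately show "\<exists>k\<in>p ` D'. norm (entry X x y - k) < \<epsilon>" by (auto simp: dist_norm)
  qed
qed

section \<open>Multipliers in the first factor and dense generators in the second\<close>

lemma op_tensor_id: "op_tensor id_blinfun id_blinfun = id_blinfun"
  by (rule op_tensor_eqI) simp

lemma slice_op_tensor_id:
  fixes S :: "'i op" and F :: "('i \<times> 'v) ell2"
  assumes "op_clinear S"
  shows "blinfun_apply (slice x) (blinfun_apply (op_tensor S id_blinfun) F) = S (slice x F)"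
proof -
  have "slice x o\<^sub>L op_tensor S id_blinfun = S o\<^sub>L slice x"
  proof (rule blinfun_eq_on_ket)
    fix z :: "'i \<times> 'v" and c
    show "(slice x o\<^sub>L op_tensor S id_blinfun) (ket z c) = (S o\<^sub>L slice x) (ket z c)"
      unfolding ket_tensor[of z c]
      by (simp add: op_tensor_apply assms op_clinear_simps slice_tensor op_clinearD[OF assms])
  qed
  then show ?thesis by (metis blinfun_apply_blinfun_compose)
qed

lemma entry_op_tensor_id_compose:
  assumes "op_clinear S"
  shows "entry (op_tensor S id_blinfun o\<^sub>L X) x y = S o\<^sub>L entry X x y"
  by (rule blinfun_eqI) (simp add: entry_def slice_op_tensor_id assms)

text \<open>\<open>op_tensor S\<close> is continuous in its second argument by
  \<open>norm_op_tensor_le\<close>, so approximants from \<open>A0\<close> suffice there.\<close>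

lemma min_tensor_dense:
  assumes lin: "\<And>S. S \<in> B \<Longrightarrow> op_clinear S" "\<And>T. T \<in> A \<Longrightarrow> op_clinear T"
    and dense: "A \<subseteq> closure A0" "A0 \<subseteq> A"
  shows "min_tensor B A \<subseteq> closure (span (elementary_tensors B A0))"
proof (rule min_tensor_minimal)
  show "elementary_tensors B A \<subseteq> closure (span (elementary_tensors B A0))"
  proof safe
    fix S T assume ST: "S \<in> B" "T \<in> A"
    then obtain f where f: "\<And>n::nat. f n \<in> A0" "f \<longlonglongrightarrow> T" using dense(1) closure_sequential by blast
    have f0: "(\<lambda>n. norm (f n - T)) \<longlonglongrightarrow> 0" using f(2) by (simp add: LIM_zero tendsto_norm_zero)
    have "(\<lambda>n. op_tensor S (f n) - op_tensor S T) \<longlonglongrightarrow> 0"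
    proof (rule Lim_null_comparison)
      show "\<forall>\<^sub>F n in sequentially. norm (op_tensor S (f n) - op_tensor S T) \<le> norm S * norm (f n - T)"
      proof (intro always_eventually allI)
        fix n
        have l: "op_clinear (f n)" using f(1)[of n] dense(2) lin(2) by blast
        then have l': "op_clinear (f n - T)"
          using op_clinear_simps(3)[OF l op_clinear_simps(6)[OF lin(2)[OF ST(2)], of "-1"]] by simp
        have "op_tensor S (f n) = op_tensor S (f n - T) + op_tensor S T"
          using op_tensor_add_right[OF lin(1)[OF ST(1)] l' lin(2)[OF ST(2)]] by simp
        then show "norm (op_tensor S (f n) - op_tensor S T) \<le> norm S * norm (f n - T)"
          using norm_op_tensor_le[OF lin(1)[OF ST(1)] l'] by simp
      qed
      show "(\<lambda>n. norm S * norm (f n - T)) \<longlonglongrightarrow> 0" using tendsto_mult_right_zero[OF f0] .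
    qed
    then have "(\<lambda>n. op_tensor S (f n)) \<longlonglongrightarrow> op_tensor S T" by (simp add: LIM_zero_iff)
    moreover have "op_tensor S (f n) \<in> span (elementary_tensors B A0)" for n
      using ST(1) f(1) by (intro span_base) blast
    ultimately show "op_tensor S T \<in> closure (span (elementary_tensors B A0))"
      unfolding closure_sequential by (intro exI[of _ "\<lambda>n. op_tensor S (f n)"]) simp
  qed
qed (intro subspace_closure subspace_span closed_closure)+

text \<open>An elementary tensor inherits its zero entries from the second factor, and a finite sum
  takes the largest radius. This is why the algebraic span appears: a limit may lose finite
  propagation.\<close>

lemma propagation_span:
  fixes B :: "'i op set" and A0 :: "'j op set" and X :: "('i \<times> 'j) op"
  assumes lin: "\<And>S. S \<in> B \<Longrightarrow> op_clinear S" "\<And>T. T \<in> A0 \<Longrightarrow> op_clinear T"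
    and pr: "\<And>T. T \<in> A0 \<Longrightarrow> \<exists>r. propagation V E r (mcoeff T)"
    and X: "X \<in> span (elementary_tensors B A0)"
  shows "\<exists>r. propagation V E r (entry X)"
proof -
  let ?P = "{X :: ('i \<times> 'j) op. \<exists>r. propagation V E r (entry X)}"
  have "X \<in> ?P"
  proof (rule subsetD[OF span_minimal X])
    show "elementary_tensors B A0 \<subseteq> ?P"
    proof safe
      fix S T assume ST: "S \<in> B" "T \<in> A0"
      have "op_scaleC 0 S = 0" using op_scaleC_of_real[of 0 S] by simp
      moreover obtain r where "propagation V E r (mcoeff T)" using pr ST by blast
      ultimately have "propagation V E r (entry (op_tensor S T))"
        unfolding propagation_def using ST lin by (metis entry_op_tensor)
      then show "\<exists>r. propagation V E r (entry (op_tensor S T))" by blast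
    qed
    show "subspace ?P"
      unfolding subspace_def
    proof (intro conjI ballI allI)
      show "0 \<in> ?P"
        by (auto simp: propagation_def entry_0)
      fix X :: "('i \<times> 'j) op" assume "X \<in> ?P"
      then obtain r where r: "propagation V E r (entry X)" by blast
      have "propagation V E r (entry (c *\<^sub>R X))" for c
        unfolding propagation_def
      proof (intro allI impI)
        fix x y assume "entry (c *\<^sub>R X) x y \<noteq> 0"
        then have "entry X x y \<noteq> 0" by (auto simp: entry_scaleR)
        then show "x \<in> V \<and> y \<in> graph_ball V E r x" using r by (simp add: propagation_def)
      qed
      then show "c *\<^sub>R X \<in> ?P" for c by blast
      fix Y :: "('i \<times> 'j) op" assume "Y \<in> ?P"
      then obtain s where s: "propagation V E s (entry Y)" by blast
      have "propagation V E (max r s) (entry (X + Y))"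
        unfolding propagation_def
      proof (intro allI impI)
        fix x y assume "entry (X + Y) x y \<noteq> 0"
        then have "entry X x y \<noteq> 0 \<or> entry Y x y \<noteq> 0" by (auto simp: entry_add)
        then have "x \<in> V \<and> (y \<in> graph_ball V E r x \<or> y \<in> graph_ball V E s x)"
          using r s unfolding propagation_def by blast
        then show "x \<in> V \<and> y \<in> graph_ball V E (max r s) x"
          using graph_ball_mono[of y V E r x "max r s"] graph_ball_mono[of y V E s x "max r s"] by auto
      qed
      then show "X + Y \<in> ?P" by blast
    qed
  qed
  then show ?thesis by simp
qed

section \<open>The kernel of the induced homomorphism\<close>

context tensor_extension begin

lemma kernel_subset_min_tensor:
  fixes V :: "'a set"
  assumes J: "J = {S \<in> B. q S = 0}"
    and pA: "property_A V E" and bg: "bounded_geometry V E"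
    and dense: "A \<subseteq> closure A0" "A0 \<subseteq> A"
    and pr: "\<And>T. T \<in> A0 \<Longrightarrow> \<exists>r. propagation V E r (mcoeff T)"
  shows "{X \<in> min_tensor B A. extension X = 0} \<subseteq> min_tensor J A"
proof
  fix X assume "X \<in> {X \<in> min_tensor B A. extension X = 0}"
  then have X: "X \<in> min_tensor B A" and gX: "(X, 0) \<in> graph" using extension_graph by force+
  interpret J: star_subalgebra J unfolding J by (rule q.kernel_star_subalgebra)
  have entJ: "entry X x y \<in> J" for x y
    using graph_entry[OF gX, of x y] by (simp add: J entry_0)
  have "\<exists>Y\<in>min_tensor J A. dist Y X < e" if "0 < e" for e
  proof -
    \<comment> \<open>The estimate for \<open>Q o\<^sub>L X\<close> ends with
      \<open>4 * \<epsilon>\<close>, so a fifth of \<open>e\<close> keeps the final inequality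
      strict.\<close>
    define \<epsilon> where "\<epsilon> = e / 5"
    have \<epsilon>: "0 < \<epsilon>" using that by (simp add: \<epsilon>_def)
    have "X \<in> closure (span (elementary_tensors B A0))"
      using min_tensor_dense[OF clinear(1,3) dense] X by blast
    then obtain X0 where X0: "X0 \<in> span (elementary_tensors B A0)" "norm (X - X0) < \<epsilon>"
      using \<epsilon> unfolding closure_approachable dist_norm norm_minus_commute[of _ X] by blast
    obtain r where r: "propagation V E r (entry X0)"
      using propagation_span[OF clinear(1) _ pr X0(1)] clinear(3) dense(2) by blast
    \<comment> \<open>Only \<open>r\<close> and \<open>norm X0\<close> constrain the approximant
      here, and \<open>Q o\<^sub>L X0\<close> will meet the same constraints for whichever
      \<open>u\<close> is chosen later.\<close>
    obtain \<eta> where \<eta>: "0 < \<eta>" "\<And>Z Z0 :: ('i \<times> 'a) op. propagation V E r (entry Z0) \<Longrightarrow> norm Z0 \<le> norm X0 \<Longrightarrow>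
        norm (Z - Z0) \<le> \<epsilon> \<Longrightarrow> (\<And>x y. norm (entry Z x y) \<le> \<eta>) \<Longrightarrow> norm Z \<le> 2 * \<epsilon> + 2 * \<epsilon>"
      using property_A_estimate[OF pA bg \<epsilon> less_imp_le[OF \<epsilon>] norm_ge_zero[of X0], of r] by blast
    obtain K where K: "finite K" "K \<subseteq> range (\<lambda>(x, y). entry X x y)"
      "\<And>x y. \<exists>k\<in>K. norm (entry X x y - k) < \<eta> / 2"
      using entries_totally_bounded[OF clinear(1,3) X, of "\<eta> / 2"] \<eta>(1) by (metis half_gt_zero)
    \<comment> \<open>The net consists of entries of \<open>X\<close>, and these are killed by
      \<open>q\<close> because \<open>X\<close> is paired with 0 in the graph.\<close>
    have "K \<subseteq> J" using K(2) entJ by auto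
    then obtain u where u: "u \<in> J" "norm (id_blinfun - u) \<le> 1" "\<And>j. j \<in> K \<Longrightarrow> norm (j - (u o\<^sub>L j)) \<le> \<eta> / 2"
      using J.approximate_unit[OF K(1) _ half_gt_zero[OF \<eta>(1)]] by blast
    define v where "v = id_blinfun - u"
    have lu: "op_clinear u" using u(1) clinear(1) by (simp add: J)
    have lv: "op_clinear v"
      using op_clinear_simps(3)[OF op_clinear_simps(2) op_clinear_simps(6)[OF lu, of "-1"]] by (simp add: v_def)
    have lid: "op_clinear (id_blinfun :: 'a op)" by (rule op_clinear_simps)
    define Q where "Q = (op_tensor v id_blinfun :: ('i \<times> 'a) op)"
    have "op_tensor u id_blinfun + Q = (id_blinfun :: ('i \<times> 'a) op)"
      using op_tensor_add_left[OF lu lv lid]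
      by (simp add: Q_def v_def op_tensor_id)
    then have Q: "op_tensor u id_blinfun = id_blinfun - Q" by (simp add: algebra_simps)
    have nQ: "norm Q \<le> 1"
    proof -
      have "norm Q \<le> norm v * norm (id_blinfun :: 'a op)"
        unfolding Q_def by (intro norm_op_tensor_le lv op_clinear_simps)
      also have "\<dots> \<le> 1 * 1" using u(2) by (intro mult_mono norm_blinfun_id_le) (auto simp: v_def)
      finally show ?thesis by simp
    qed
    have nQY: "norm (Q o\<^sub>L Y) \<le> norm Y" for Y :: "('i \<times> 'a) op"
    proof -
      have "norm (Q o\<^sub>L Y) \<le> norm Q * norm Y" by (rule norm_blinfun_compose)
      also have "\<dots> \<le> 1 * norm Y" by (intro mult_right_mono nQ) simp
      finally show ?thesis by simp
    qed
    have eQ: "entry (Q o\<^sub>L Y) x y = v o\<^sub>L entry Y x y" for Y :: "('i \<times> 'a) op" and x y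
      unfolding Q_def by (rule entry_op_tensor_id_compose[OF lv])
    have "norm (Q o\<^sub>L X) \<le> 2 * \<epsilon> + 2 * \<epsilon>"
    proof (rule \<eta>(2)[of "Q o\<^sub>L X0"])
      show "propagation V E r (entry (Q o\<^sub>L X0))"
        unfolding propagation_def
      proof (intro allI impI)
        fix x y assume "entry (Q o\<^sub>L X0) x y \<noteq> 0"
        then have "entry X0 x y \<noteq> 0" by (auto simp: eQ)
        then show "x \<in> V \<and> y \<in> graph_ball V E r x" using r by (simp add: propagation_def)
      qed
      show "norm (Q o\<^sub>L X0) \<le> norm X0" by (rule nQY)
      have "(Q o\<^sub>L X) - (Q o\<^sub>L X0) = Q o\<^sub>L (X - X0)"
        by (simp add: bounded_bilinear.diff_right[OF bounded_bilinear_blinfun_compose])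
      then show "norm ((Q o\<^sub>L X) - (Q o\<^sub>L X0)) \<le> \<epsilon>" using nQY[of "X - X0"] X0(2) by simp
      fix x y
      obtain k where k: "k \<in> K" "norm (entry X x y - k) < \<eta> / 2" using K(3) by blast
      \<comment> \<open>\<open>v\<close> is a contraction on the deviation from the net point
        \<open>k\<close>, and \<open>v o\<^sub>L k = k - (u o\<^sub>L k)\<close> is small by the
        choice of \<open>u\<close>: half of \<open>\<eta>\<close> for each.\<close>
      have "v o\<^sub>L entry X x y = (v o\<^sub>L (entry X x y - k)) + (k - (u o\<^sub>L k))"
        by (rule blinfun_eqI) (simp add: v_def blinfun.diff_left blinfun.diff_right blinfun.add_left)
      also have "norm \<dots> \<le> norm (v o\<^sub>L (entry X x y - k)) + norm (k - (u o\<^sub>L k))" by (rule norm_triangle_ineq)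
      also have "\<dots> \<le> norm v * norm (entry X x y - k) + \<eta> / 2"
        by (intro add_mono norm_blinfun_compose u(3) k)
      also have "\<dots> \<le> 1 * (\<eta> / 2) + \<eta> / 2"
        using u(2) k(2) by (intro add_mono mult_mono) (auto simp: v_def)
      finally show "norm (entry (Q o\<^sub>L X) x y) \<le> \<eta>" by (simp add: eQ)
    qed
    moreover have "X - (op_tensor u id_blinfun o\<^sub>L X) = Q o\<^sub>L X"
      unfolding Q by (rule blinfun_eqI) (simp add: blinfun.diff_left)
    ultimately have "dist (op_tensor u id_blinfun o\<^sub>L X) X < e"
      using \<epsilon> by (simp add: dist_norm norm_minus_commute \<epsilon>_def)
    \<comment> \<open>Left multiplication by \<open>u \<otimes> 1\<close> sends
      \<open>S \<otimes> T\<close> to \<open>(u S) \<otimes> T\<close>, and \<open>u S\<close> lies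
      in the ideal; boundedness carries this from generators to \<open>X\<close>.\<close>
    moreover have "op_tensor u id_blinfun o\<^sub>L X \<in> min_tensor J A"
      unfolding min_tensor_def
    proof (rule bounded_linear_closure_subset[OF _ _ X[unfolded min_tensor_def]])
      show "bounded_linear ((o\<^sub>L) (op_tensor u id_blinfun :: ('i \<times> 'a) op))"
        by (rule bounded_bilinear.bounded_linear_right[OF bounded_bilinear_blinfun_compose])
      fix Y assume "Y \<in> elementary_tensors B A"
      then obtain S T where Y: "Y = op_tensor S T" "S \<in> B" "T \<in> A" by blast
      have "op_tensor u id_blinfun o\<^sub>L Y = op_tensor (u o\<^sub>L S) T"
      proof -
        have "id_blinfun o\<^sub>L T = T" by (rule blinfun_eqI) simp
        then show ?thesis
          using Y(1) op_tensor_compose[OF lu lid clinear(1)[OF Y(2)] clinear(3)[OF Y(3)]] by simp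
      qed
      moreover have "u o\<^sub>L S \<in> J" using u(1) Y(2) by (simp add: J q.hom_compose q.compose)
      ultimately show "op_tensor u id_blinfun o\<^sub>L Y \<in> closure (span (elementary_tensors J A))"
        using op_tensor_in_min_tensor[of "u o\<^sub>L S" J T A] Y(3) by (simp add: min_tensor_def)
    qed
    ultimately show ?thesis by blast
  qed
  then have "X \<in> closure (min_tensor J A)" by (simp add: closure_approachable)
  then show "X \<in> min_tensor J A" by (simp add: min_tensor_def)
qed

end

theorem property_A_exact:
  fixes V :: "'a set"
  assumes A: "cstar_algebra A" and pA: "property_A V E" and bg: "bounded_geometry V E"
    and dense: "A \<subseteq> closure A0" "A0 \<subseteq> A"
    and pr: "\<And>T. T \<in> A0 \<Longrightarrow> \<exists>r. propagation V E r (mcoeff T)"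
  shows "exact_cstar_algebra TYPE('i) TYPE('j) A"
  unfolding exact_cstar_algebra_def
proof (intro conjI allI impI A)
  fix B J :: "'i op set" and C :: "'j op set" and q
  assume B: "cstar_algebra B" and C: "cstar_algebra C" and q: "star_hom B C q" and surj: "q ` B = C"
    and J: "{S \<in> B. q S = 0} = J"
  interpret tensor_extension B C q A using B C A q by unfold_locales
  have "{X \<in> min_tensor B A. extension X = 0} = min_tensor J A"
    using kernel_subset_min_tensor[OF J[symmetric] pA bg dense pr] min_tensor_subset_kernel[OF J[symmetric]] by blast
  then show "\<exists>F. star_hom (min_tensor B A) (min_tensor C A) F \<and>
      (\<forall>S\<in>B. \<forall>T\<in>A. F (op_tensor S T) = op_tensor (q S) T) \<and>
      F ` min_tensor B A = min_tensor C A \<and> {T \<in> min_tensor B A. F T = 0} = min_tensor J A"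
    using star_hom_extension extension_op_tensor extension_surj[OF surj] by (intro exI[of _ extension]) simp
qed


section \<open>Local operators on a Schreier graph\<close>

lemma kernel_op_clinear_mcoeff:
  assumes "kernel_op V K T"
  shows "op_clinear T" "mcoeff T x y = (if x \<in> V \<and> y \<in> V then K x y else 0)"
proof -
  have T: "Rep_ell2 (T f) x = (if x \<in> V then \<Sum>\<^sub>\<infinity>y\<in>V. K x y * Rep_ell2 f y else 0)" for f x
    using assms by (simp add: kernel_op_def)
  have "T (scaleC c f) = scaleC c (T f)" for c f
  proof (rule ell2_eqI)
    fix x
    have "(\<Sum>\<^sub>\<infinity>y\<in>V. K x y * (c * Rep_ell2 f y)) = c * (\<Sum>\<^sub>\<infinity>y\<in>V. K x y * Rep_ell2 f y)"
      by (simp add: infsum_cmult_right'[symmetric] mult.left_commute)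
    then show "Rep_ell2 (T (scaleC c f)) x = Rep_ell2 (scaleC c (T f)) x"
      by (simp add: T scaleC.rep_eq)
  qed
  then show "op_clinear T" by (simp add: op_clinear_def)
  have "(\<Sum>\<^sub>\<infinity>w\<in>V. K x w * Rep_ell2 (ket y 1) w) = (\<Sum>\<^sub>\<infinity>w\<in>V \<inter> {y}. K x w)"
    by (rule infsum_cong_neutral) (auto simp: ket.rep_eq)
  also have "\<dots> = (if y \<in> V then K x y else 0)" by auto
  finally show "mcoeff T x y = (if x \<in> V \<and> y \<in> V then K x y else 0)" by (simp add: mcoeff_def T)
qed

lemma mcoeff_apply:
  assumes "op_clinear T"
  shows "Rep_ell2 (blinfun_apply T f) x = (\<Sum>\<^sub>\<infinity>y. mcoeff T x y * Rep_ell2 f y)"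
  using op_apply_has_sum[OF assms] unfolding mcoeff_def by (rule infsumI[symmetric])

lemma kernel_op_mcoeff:
  assumes T: "op_clinear T" and V: "\<And>x y. mcoeff T x y \<noteq> 0 \<Longrightarrow> x \<in> V \<and> y \<in> V"
  shows "kernel_op V (mcoeff T) T"
  unfolding kernel_op_def
proof (intro allI)
  fix f x
  have "(\<Sum>\<^sub>\<infinity>y. mcoeff T x y * Rep_ell2 f y) = (\<Sum>\<^sub>\<infinity>y\<in>V. mcoeff T x y * Rep_ell2 f y)"
    by (rule infsum_cong_neutral) (use V in auto)
  moreover have "(\<Sum>\<^sub>\<infinity>y. mcoeff T x y * Rep_ell2 f y) = 0" if "x \<notin> V"
  proof -
    have "mcoeff T x y = 0" for y using V that by blast
    then show ?thesis by simp
  qed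
  ultimately show "Rep_ell2 (T f) x = (if x \<in> V then \<Sum>\<^sub>\<infinity>y\<in>V. mcoeff T x y * Rep_ell2 f y else 0)"
    using mcoeff_apply[OF T, of f x] by simp
qed

lemma mcoeff_add: "mcoeff (S + T) x y = mcoeff S x y + mcoeff T x y"
  by (simp add: mcoeff_def blinfun.add_left plus_ell2.rep_eq)

lemma mcoeff_scaleC: "mcoeff (op_scaleC c T) x y = c * mcoeff T x y"
  by (simp add: mcoeff_def scaleC.rep_eq)

lemma mcoeff_0: "mcoeff 0 x y = 0"
  by (simp add: mcoeff_def zero_ell2.rep_eq)

text \<open>A row of finite support turns the product series into a finite sum; local operators have
  such rows by bounded geometry.\<close>

lemma mcoeff_compose:
  assumes "op_clinear S" "finite F" "\<And>u. mcoeff S x u \<noteq> 0 \<Longrightarrow> u \<in> F"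
  shows "mcoeff (S o\<^sub>L T) x y = (\<Sum>u\<in>F. mcoeff S x u * mcoeff T u y)"
proof -
  have "mcoeff (S o\<^sub>L T) x y = (\<Sum>\<^sub>\<infinity>u. mcoeff S x u * mcoeff T u y)"
    using mcoeff_apply[OF assms(1), of "T (ket y 1)" x] by (simp add: mcoeff_def)
  also have "\<dots> = (\<Sum>\<^sub>\<infinity>u\<in>F. mcoeff S x u * mcoeff T u y)"
    by (rule infsum_cong_neutral) (use assms(3) in auto)
  finally show ?thesis using assms(2) by simp
qed

section \<open>Schreier graphs as graphs of bounded degree\<close>

locale schreier_graph = group G for G :: "('g, 'm) monoid_scheme" (structure) +
  fixes Q H :: "'g set"
  assumes finite_Q: "finite Q" and Q_carrier: "Q \<subseteq> carrier G" and H_carrier: "H \<subseteq> carrier G"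
begin

abbreviation "V \<equiv> lcosets H"
abbreviation "E \<equiv> schreier_adj G Q H"
abbreviation "nball \<equiv> schreier_ball G Q H"

lemma V_carrier: "x \<in> V \<Longrightarrow> x \<subseteq> carrier G"
  using H_carrier by (auto simp: LCOSETS_def l_coset_def)

lemma sym_E: "sym E"
  by (rule symI) (auto simp: schreier_adj_def)

lemma E_vertices: "(x, y) \<in> E \<Longrightarrow> x \<in> V \<and> y \<in> V"
  by (auto simp: schreier_adj_def schreier_edge_def)

text \<open>Translation by a generator is undone by its inverse, so a vertex has at most two
  neighbours per generator, a bound that does not depend on the vertex.\<close>

lemma E_neighbours: "E `` {x} \<subseteq> (\<lambda>\<gamma>. \<gamma> <# x) ` Q \<union> (\<lambda>\<gamma>. inv \<gamma> <# x) ` Q"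
proof
  fix y assume "y \<in> E `` {x}"
  then obtain \<gamma> where \<gamma>: "\<gamma> \<in> Q" "\<gamma> <# x = y \<or> \<gamma> <# y = x" and y: "y \<in> V"
    by (auto simp: schreier_adj_def schreier_edge_def)
  have "inv \<gamma> <# (\<gamma> <# y) = y"
    using \<gamma>(1) Q_carrier V_carrier[OF y] by (simp add: subset_iff lcos_m_assoc lcos_mult_one)
  with \<gamma> show "y \<in> (\<lambda>\<gamma>. \<gamma> <# x) ` Q \<union> (\<lambda>\<gamma>. inv \<gamma> <# x) ` Q" by force
qed

lemma relpow_neighbours:
  "finite {y. (x, y) \<in> E ^^ m} \<and> card {y. (x, y) \<in> E ^^ m} \<le> (2 * card Q) ^ m"
proof (induction m)
  case (Suc m)
  let ?S = "{y. (x, y) \<in> E ^^ m}"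
  have eq: "{y. (x, y) \<in> E ^^ Suc m} = (\<Union>z\<in>?S. E `` {z})" by auto
  have fin: "finite (E `` {z})" for z
    by (rule finite_subset[OF E_neighbours]) (simp add: finite_Q)
  have "card (E `` {z}) \<le> 2 * card Q" for z
  proof -
    have "card (E `` {z}) \<le> card ((\<lambda>\<gamma>. \<gamma> <# z) ` Q \<union> (\<lambda>\<gamma>. inv \<gamma> <# z) ` Q)"
      by (rule card_mono[OF _ E_neighbours]) (simp add: finite_Q)
    also have "\<dots> \<le> card ((\<lambda>\<gamma>. \<gamma> <# z) ` Q) + card ((\<lambda>\<gamma>. inv \<gamma> <# z) ` Q)" by (rule card_Un_le)
    also have "\<dots> \<le> card Q + card Q" by (intro add_mono card_image_le finite_Q)
    finally show ?thesis by simp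
  qed
  then have "(\<Sum>z\<in>?S. card (E `` {z})) \<le> (\<Sum>z\<in>?S. 2 * card Q)" by (intro sum_mono)
  then have "card (\<Union>z\<in>?S. E `` {z}) \<le> card ?S * (2 * card Q)"
    using card_UN_le[of ?S "\<lambda>z. E `` {z}"] Suc by simp
  also have "\<dots> \<le> (2 * card Q) ^ m * (2 * card Q)" using Suc by (intro mult_right_mono) auto
  finally show ?case using Suc fin unfolding eq by (auto simp: mult.commute)
qed simp

lemma bounded_geometry: "bounded_geometry V E"
  unfolding bounded_geometry_def
proof (intro conjI allI sym_E)
  fix r
  have "finite (nball r x) \<and> card (nball r x) \<le> (\<Sum>m\<le>r. (2 * card Q) ^ m)" for x
  proof -
    have sub: "nball r x \<subseteq> (\<Union>m\<le>r. {y. (x, y) \<in> E ^^ m})" by (auto simp: graph_ball_iff)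
    have fin: "finite (\<Union>m\<le>r. {y. (x, y) \<in> E ^^ m})" using relpow_neighbours by auto
    have "card (nball r x) \<le> card (\<Union>m\<le>r. {y. (x, y) \<in> E ^^ m})" by (rule card_mono[OF fin sub])
    also have "\<dots> \<le> (\<Sum>m\<le>r. card {y. (x, y) \<in> E ^^ m})" by (rule card_UN_le) simp
    also have "\<dots> \<le> (\<Sum>m\<le>r. (2 * card Q) ^ m)" using relpow_neighbours by (intro sum_mono) auto
    finally show ?thesis using finite_subset[OF sub fin] by blast
  qed
  then show "\<exists>N. \<forall>x\<in>V. finite (nball r x) \<and> card (nball r x) \<le> N" by blast
qed

lemma finite_ball: "x \<in> V \<Longrightarrow> finite (nball r x)"
  using bounded_geometry unfolding bounded_geometry_def by meson

lemma ball_subset: "nball r x \<subseteq> V"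
  by (auto simp: graph_ball_def)

lemma ball_self: "x \<in> V \<Longrightarrow> x \<in> nball r x"
  by (auto simp: graph_ball_iff intro: exI[of _ 0])

lemma nball_subset_nball:
  assumes "u \<in> nball i y" "i + k \<le> R"
  shows "nball k u \<subseteq> nball R y"
proof
  fix v assume "v \<in> nball k u"
  then have "v \<in> nball (i + k) y" by (rule graph_ball_trans[OF assms(1)])
  then show "v \<in> nball R y" by (rule graph_ball_mono[OF _ assms(2)])
qed

section \<open>Rooted isomorphisms of balls\<close>

abbreviation "biso \<equiv> ball_iso G Q H"

text \<open>\<open>\<theta>\<close> respects edges only inside \<open>nball R y\<close>, while
  distances are measured in the whole graph. A walk of length at most \<open>k\<close> starting
  within \<open>i\<close> of \<open>y\<close> stays within \<open>i + k \<le> R\<close>, so its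
  image is again a walk.\<close>

lemma iso_in_ball:
  assumes \<theta>: "biso R y z \<theta>" and u: "u \<in> nball i y" and v: "v \<in> nball k u" and le: "i + k \<le> R"
  shows "\<theta> v \<in> nball k (\<theta> u)"
proof -
  have path: "v \<in> nball (i + k) y \<and> (\<theta> u, \<theta> v) \<in> E ^^ k" if "(u, v) \<in> E ^^ k" "i + k \<le> R" for k v
    using that
  proof (induction k arbitrary: v)
    case 0
    then show ?case using u by simp
  next
    case (Suc k)
    then obtain w where w: "(u, w) \<in> E ^^ k" "(w, v) \<in> E" by auto
    with Suc have IH: "w \<in> nball (i + k) y" "(\<theta> u, \<theta> w) \<in> E ^^ k" by auto
    have "v \<in> nball 1 w" using w(2) E_vertices by (auto simp: graph_ball_iff intro!: exI[of _ 1])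
    then have v: "v \<in> nball (i + Suc k) y" using graph_ball_trans[OF IH(1), of v 1] by simp
    have "w \<in> nball R y" "v \<in> nball R y"
      using graph_ball_mono[OF IH(1)] graph_ball_mono[OF v] Suc.prems(2) by auto
    then have "schreier_edge G Q H s (\<theta> w) (\<theta> v) = schreier_edge G Q H s w v"
      "schreier_edge G Q H s (\<theta> v) (\<theta> w) = schreier_edge G Q H s v w" for s
      using \<theta> by (simp_all add: ball_iso_def)
    with w(2) have "(\<theta> w, \<theta> v) \<in> E" by (simp add: schreier_adj_def)
    with IH(2) v show ?case by auto
  qed
  obtain m where m: "m \<le> k" "(u, v) \<in> E ^^ m" using v by (auto simp: graph_ball_iff)
  have "i + m \<le> R" using m le by simp
  from path[OF m(2) this] have p: "v \<in> nball (i + m) y" "(\<theta> u, \<theta> v) \<in> E ^^ m" by auto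
  have "v \<in> nball R y" by (rule graph_ball_mono[OF p(1) \<open>i + m \<le> R\<close>])
  then have "\<theta> v \<in> nball R z" using \<theta> unfolding ball_iso_def bij_betw_def by blast
  then show ?thesis using p(2) m(1) by (auto simp: graph_ball_iff)
qed

lemma iso_inverse:
  assumes \<theta>: "biso R y z \<theta>" and y: "y \<in> V"
  shows "biso R z y (inv_into (nball R y) \<theta>)"
proof -
  let ?\<eta> = "inv_into (nball R y) \<theta>"
  have b: "bij_betw \<theta> (nball R y) (nball R z)" "\<theta> y = z" using \<theta> by (auto simp: ball_iso_def)
  have inv: "?\<eta> u \<in> nball R y" "\<theta> (?\<eta> u) = u" if "u \<in> nball R z" for u
    using that b(1) by (auto simp: bij_betw_def intro!: inv_into_into f_inv_into_f)
  have "?\<eta> z = y" using b ball_self[OF y] by (metis bij_betw_inv_into_left)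
  moreover have "schreier_edge G Q H s u v \<longleftrightarrow> schreier_edge G Q H s (?\<eta> u) (?\<eta> v)"
    if "u \<in> nball R z" "v \<in> nball R z" for s u v
    using \<theta> inv[OF that(1)] inv[OF that(2)] unfolding ball_iso_def by metis
  ultimately show ?thesis
    unfolding ball_iso_def using bij_betw_inv_into[OF b(1)] by blast
qed

text \<open>The direction from images back to preimages is \<open>iso_in_ball\<close> for the
  inverse isomorphism.\<close>

lemma iso_ball_iff:
  assumes \<theta>: "biso R y z \<theta>" and y: "y \<in> V" and u: "u \<in> nball i y" and le: "i + k \<le> R" and v: "v \<in> nball R y"
  shows "\<theta> v \<in> nball k (\<theta> u) \<longleftrightarrow> v \<in> nball k u"
proof
  show "\<theta> v \<in> nball k (\<theta> u)" if "v \<in> nball k u" using iso_in_ball[OF \<theta> u that le] .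
  let ?\<eta> = "inv_into (nball R y) \<theta>"
  have b: "inj_on \<theta> (nball R y)" "\<theta> y = z" using \<theta> by (auto simp: ball_iso_def bij_betw_def)
  have "\<theta> u \<in> nball i z" using iso_in_ball[OF \<theta> ball_self[OF y, of 0] u] le b(2) by simp
  moreover have "u \<in> nball R y" by (rule graph_ball_mono[OF u]) (use le in simp)
  moreover assume "\<theta> v \<in> nball k (\<theta> u)"
  ultimately show "v \<in> nball k u"
    using iso_in_ball[OF iso_inverse[OF \<theta> y] _ _ le, of "\<theta> u" "\<theta> v"] b(1) v by simp
qed

lemma iso_image_ball:
  assumes \<theta>: "biso R y z \<theta>" and y: "y \<in> V" and u: "u \<in> nball i y" and le: "i + k \<le> R"
  shows "bij_betw \<theta> (nball k u) (nball k (\<theta> u))"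
proof -
  have b: "bij_betw \<theta> (nball R y) (nball R z)" "\<theta> y = z" using \<theta> by (auto simp: ball_iso_def)
  have sub: "nball k u \<subseteq> nball R y" by (rule nball_subset_nball[OF u le])
  have \<theta>u: "\<theta> u \<in> nball i z" using iso_in_ball[OF \<theta> ball_self[OF y, of 0] u] le b(2) by simp
  have sub': "nball k (\<theta> u) \<subseteq> nball R z" by (rule nball_subset_nball[OF \<theta>u le])
  have "\<theta> ` nball k u = nball k (\<theta> u)"
  proof
    show "\<theta> ` nball k u \<subseteq> nball k (\<theta> u)" using iso_in_ball[OF \<theta> u _ le] by blast
    show "nball k (\<theta> u) \<subseteq> \<theta> ` nball k u"
    proof
      fix w assume w: "w \<in> nball k (\<theta> u)"
      then have "w \<in> \<theta> ` nball R y" using sub' b(1) by (auto simp: bij_betw_def)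
      then obtain v where v: "v \<in> nball R y" "w = \<theta> v" by blast
      with w have "v \<in> nball k u" using iso_ball_iff[OF \<theta> y u le v(1)] by simp
      with v show "w \<in> \<theta> ` nball k u" by blast
    qed
  qed
  moreover have "inj_on \<theta> (nball k u)" using b(1) sub by (auto simp: bij_betw_def intro: inj_on_subset)
  ultimately show ?thesis by (simp add: bij_betw_def)
qed

text \<open>Moves the root: locality at radius \<open>k\<close> can be applied at a vertex
  \<open>u\<close> near \<open>y\<close> as long as the ball around \<open>u\<close> stays in the
  domain of \<open>\<theta>\<close>.\<close>

lemma iso_restrict:
  assumes \<theta>: "biso R y z \<theta>" and y: "y \<in> V" and u: "u \<in> nball i y" and le: "i + k \<le> R"
  shows "biso k u (\<theta> u) \<theta>"
proof -
  have "nball k u \<subseteq> nball R y" by (rule nball_subset_nball[OF u le])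
  then show ?thesis
    using \<theta> iso_image_ball[OF \<theta> y u le] by (simp add: ball_iso_def subset_iff)
qed

definition local_radius :: "nat \<Rightarrow> ('g set \<Rightarrow> 'g set \<Rightarrow> complex) \<Rightarrow> bool" where
  "local_radius R K \<longleftrightarrow>
     (\<forall>x y. K x y \<noteq> 0 \<longrightarrow> x \<in> V \<and> y \<in> nball R x) \<and>
     (\<forall>y\<in>V. \<forall>z\<in>V. \<forall>\<theta>. biso R y z \<theta> \<longrightarrow> (\<forall>w\<in>nball R y. K y w = K z (\<theta> w)))"

lemma local_radiusD: "local_radius R K \<Longrightarrow> K x y \<noteq> 0 \<Longrightarrow> x \<in> V \<and> y \<in> nball R x"
  by (simp add: local_radius_def)

lemma local_radius_eq:
  assumes "local_radius R K" "y \<in> V" "z \<in> V" "biso R y z \<theta>" "w \<in> nball R y"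
  shows "K y w = K z (\<theta> w)"
  using assms unfolding local_radius_def by blast

text \<open>Invariance away from the root. If \<open>w\<close> is within \<open>R\<close> of
  \<open>u\<close>, restrict \<open>\<theta>\<close> to the ball around \<open>u\<close>; otherwise
  \<open>\<theta> w\<close> is not within \<open>R\<close> of \<open>\<theta> u\<close> either, and
  both values are 0.\<close>

lemma local_radius_iso:
  assumes K: "local_radius R K" and \<theta>: "biso R' y z \<theta>" and y: "y \<in> V" and u: "u \<in> nball i y"
    and le: "i + R \<le> R'" and w: "w \<in> nball R' y"
  shows "K (\<theta> u) (\<theta> w) = K u w"
proof (cases "w \<in> nball R u")
  case True
  have "\<theta> u \<in> V" using iso_in_ball[OF \<theta> u, of u 0] ball_self[of u 0] u ball_subset le by fastforce
  then show ?thesis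
    using K iso_restrict[OF \<theta> y u le] True u ball_subset unfolding local_radius_def by (metis subsetD)
next
  case False
  then have "\<theta> w \<notin> nball R (\<theta> u)" using iso_ball_iff[OF \<theta> y u le w] by simp
  with False show ?thesis using local_radiusD[OF K] by metis
qed

lemma local_radius_mono:
  assumes K: "local_radius R K" and "R \<le> R'"
  shows "local_radius R' K"
  unfolding local_radius_def
proof (intro conjI allI impI ballI)
  show "x \<in> V" "y \<in> nball R' x" if "K x y \<noteq> 0" for x y
    using local_radiusD[OF K that] graph_ball_mono[of y V E R x R'] \<open>R \<le> R'\<close> by auto
  fix y z \<theta> w assume y: "y \<in> V" and \<theta>: "biso R' y z \<theta>" and w: "w \<in> nball R' y"
  have "\<theta> y = z" using \<theta> by (simp add: ball_iso_def)
  then show "K y w = K z (\<theta> w)"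
    using local_radius_iso[OF K \<theta> y ball_self[OF y, of 0] _ w] \<open>R \<le> R'\<close> by simp
qed

section \<open>The algebra of local operators\<close>

definition local_op :: "'g set op \<Rightarrow> bool" where
  "local_op T \<longleftrightarrow> op_clinear T \<and> (\<exists>R. local_radius R (mcoeff T))"

text \<open>On \<open>V\<close> the kernel coincides with the coefficient matrix of the operator, so
  locality becomes a property of the operator itself.\<close>

lemma local_op_iff: "local_op T \<longleftrightarrow> (\<exists>K. local_kernel G Q H K \<and> kernel_op V K T)"
proof
  assume "local_op T"
  then obtain R where T: "op_clinear T" and R: "local_radius R (mcoeff T)" by (auto simp: local_op_def)
  \<comment> \<open>\<open>local_kernel\<close> demands a positive radius, and \<open>R\<close> may
    be 0.\<close>
  have R': "local_radius (Suc R) (mcoeff T)" by (rule local_radius_mono[OF R]) simp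
  have "mcoeff T x y = 0" if "y \<in> V" "graph_dist E x y > enat (Suc R)" for x y
  proof (rule ccontr)
    assume "mcoeff T x y \<noteq> 0"
    then have "y \<in> nball (Suc R) x" using local_radiusD[OF R'] by blast
    then have "graph_dist E x y \<le> enat (Suc R)" by (simp add: graph_ball_def)
    with that(2) show False by (meson leD)
  qed
  then have "local_kernel G Q H (mcoeff T)"
    unfolding local_kernel_def
    by (intro exI[of _ "Suc R"] conjI ballI allI impI) (auto intro: local_radius_eq[OF R'])
  moreover have "kernel_op V (mcoeff T) T"
    by (rule kernel_op_mcoeff[OF T]) (use local_radiusD[OF R] ball_subset[of R] in fast)
  ultimately show "\<exists>K. local_kernel G Q H K \<and> kernel_op V K T" by blast
next
  assume "\<exists>K. local_kernel G Q H K \<and> kernel_op V K T"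
  then obtain K where T: "kernel_op V K T" and K: "local_kernel G Q H K" by blast
  obtain R where "\<forall>x\<in>V. \<forall>y\<in>V. graph_dist E x y > enat R \<longrightarrow> K x y = 0"
    "\<forall>y\<in>V. \<forall>z\<in>V. \<forall>\<theta>. biso R y z \<theta> \<longrightarrow> (\<forall>w\<in>nball R y. K y w = K z (\<theta> w))"
    using K unfolding local_kernel_def by (elim exE conjE)
  note K1 = this(1)[rule_format] and K2 = this(2)[rule_format]
  note m = kernel_op_clinear_mcoeff[OF T]
  have "local_radius R (mcoeff T)"
    unfolding local_radius_def
  proof (intro conjI allI impI ballI)
    show "x \<in> V" if "mcoeff T x y \<noteq> 0" for x y using that by (auto simp: m(2) split: if_splits)
    show "y \<in> nball R x" if "mcoeff T x y \<noteq> 0" for x y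
      using that K1[of x y] by (auto simp: m(2) graph_ball_def not_less[symmetric] split: if_splits)
    fix y z \<theta> w assume y: "y \<in> V" "z \<in> V" "biso R y z \<theta>" "w \<in> nball R y"
    then have "\<theta> w \<in> nball R z" by (auto simp: ball_iso_def bij_betw_def)
    then show "mcoeff T y w = mcoeff T z (\<theta> w)"
      using K2[OF y] y(1,2) y(4) ball_subset[of R y] ball_subset[of R z] by (simp add: m(2) subset_iff)
  qed
  with m(1) show "local_op T" by (auto simp: local_op_def)
qed

lemma local_op_0: "local_op 0"
  by (auto simp: local_op_def op_clinear_simps local_radius_def mcoeff_0)

lemma local_op_add:
  assumes "local_op S" "local_op T"
  shows "local_op (S + T)"
proof -
  from assms obtain R R' where "op_clinear S" "op_clinear T" and
    R: "local_radius R (mcoeff S)" "local_radius R' (mcoeff T)" by (auto simp: local_op_def)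
  note M = local_radius_mono[OF R(1) max.cobounded1[of R R']] local_radius_mono[OF R(2) max.cobounded2[of R' R]]
  have "local_radius (max R R') (mcoeff (S + T))"
    unfolding local_radius_def mcoeff_add
  proof (intro conjI allI impI ballI)
    fix x y assume "mcoeff S x y + mcoeff T x y \<noteq> 0"
    then have "mcoeff S x y \<noteq> 0 \<or> mcoeff T x y \<noteq> 0" by auto
    then show "x \<in> V" "y \<in> nball (max R R') x" using M[THEN local_radiusD] by blast+
  next
    fix y z \<theta> w assume *: "y \<in> V" "z \<in> V" "biso (max R R') y z \<theta>" "w \<in> nball (max R R') y"
    show "mcoeff S y w + mcoeff T y w = mcoeff S z (\<theta> w) + mcoeff T z (\<theta> w)"
      using local_radius_eq[OF M(1) *] local_radius_eq[OF M(2) *] by (rule arg_cong2)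
  qed
  then show ?thesis
    using \<open>op_clinear S\<close> \<open>op_clinear T\<close> unfolding local_op_def by (blast intro: op_clinear_simps)
qed

lemma local_op_scaleC:
  assumes "local_op T"
  shows "local_op (op_scaleC c T)"
proof -
  from assms obtain R where "op_clinear T" "local_radius R (mcoeff T)" by (auto simp: local_op_def)
  note T = this
  have "local_radius R (mcoeff (op_scaleC c T))"
    unfolding local_radius_def mcoeff_scaleC
  proof (intro conjI allI impI ballI)
    fix x y assume "c * mcoeff T x y \<noteq> 0"
    then show "x \<in> V" "y \<in> nball R x" using local_radiusD[OF T(2), of x y] by auto
  next
    fix y z \<theta> w assume *: "y \<in> V" "z \<in> V" "biso R y z \<theta>" "w \<in> nball R y"
    show "c * mcoeff T y w = c * mcoeff T z (\<theta> w)" by (rule arg_cong[OF local_radius_eq[OF T(2) *]])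
  qed
  with T(1) show ?thesis unfolding local_op_def by (blast intro: op_clinear_simps)
qed

text \<open>The adjoint's coefficient with root \<open>y\<close> is a coefficient of
  \<open>T\<close> with root \<open>w\<close>. Doubling the radius keeps the \<open>R\<close>-ball
  around \<open>w\<close> in the domain of \<open>\<theta>\<close> whenever that coefficient can be
  nonzero.\<close>

lemma local_op_adj:
  assumes "local_op T"
  shows "local_op (adj T)"
proof -
  from assms obtain R where T: "op_clinear T" and R: "local_radius R (mcoeff T)" by (auto simp: local_op_def)
  have near: "x \<in> V \<and> x \<in> nball R y \<and> y \<in> nball R x" if "mcoeff T y x \<noteq> 0" for x y
    using local_radiusD[OF R that] graph_ball_sym[OF sym_E] ball_subset by blast
  have "local_radius (R + R) (\<lambda>x y. cnj (mcoeff T y x))"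
    unfolding local_radius_def
  proof (intro conjI allI impI ballI)
    fix x y assume "cnj (mcoeff T y x) \<noteq> 0"
    then show "x \<in> V" "y \<in> nball (R + R) x" using near[of y x] graph_ball_mono[of y V E R x "R + R"] by auto
  next
    fix y z \<theta> w assume y: "y \<in> V" and z: "z \<in> V" and \<theta>: "biso (R + R) y z \<theta>" and w: "w \<in> nball (R + R) y"
    have \<theta>y: "\<theta> y = z" using \<theta> by (simp add: ball_iso_def)
    show "cnj (mcoeff T w y) = cnj (mcoeff T (\<theta> w) z)"
    proof (cases "w \<in> nball R y")
      case True
      then show ?thesis using local_radius_iso[OF R \<theta> y True _ ball_self[OF y]] \<theta>y by simp
    next
      case False
      then have "\<theta> w \<notin> nball R z"
        using iso_ball_iff[OF \<theta> y ball_self[OF y, of 0] _ w, of R] \<theta>y by simp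
      with False have "mcoeff T w y = 0" "mcoeff T (\<theta> w) z = 0" using near by blast+
      then show ?thesis by simp
    qed
  qed
  then have "local_radius (R + R) (mcoeff (adj T))" by (simp add: mcoeff_adj[OF T, abs_def])
  with op_clinear_adj[OF T] show ?thesis by (auto simp: local_op_def)
qed

text \<open>In the sum over \<open>u\<close> the factor from \<open>T\<close> is rooted at
  \<open>u\<close>, up to \<open>R\<close> away from \<open>y\<close>, so the radius doubles.
  \<open>\<theta>\<close> maps the range of summation around \<open>y\<close> bijectively onto the
  one around \<open>z\<close>.\<close>

lemma local_op_compose:
  assumes "local_op S" "local_op T"
  shows "local_op (S o\<^sub>L T)"
proof -
  from assms obtain R1 R2 where S: "op_clinear S" and T: "op_clinear T" and
    R: "local_radius R1 (mcoeff S)" "local_radius R2 (mcoeff T)" by (auto simp: local_op_def)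
  define R where "R = max R1 R2"
  have RS: "local_radius R (mcoeff S)" and RT: "local_radius R (mcoeff T)"
    using R local_radius_mono by (auto simp: R_def)
  have ST: "mcoeff (S o\<^sub>L T) x y = (\<Sum>u\<in>nball R x. mcoeff S x u * mcoeff T u y)" if "x \<in> V" for x y
    by (rule mcoeff_compose[OF S finite_ball[OF that]]) (use local_radiusD[OF RS] in blast)
  have "local_radius (R + R) (mcoeff (S o\<^sub>L T))"
    unfolding local_radius_def
  proof (intro conjI allI impI ballI)
    fix x y assume nz: "mcoeff (S o\<^sub>L T) x y \<noteq> 0"
    show x: "x \<in> V"
    proof (rule ccontr)
      assume "x \<notin> V"
      then have "mcoeff S x u = 0" for u using local_radiusD[OF RS] by blast
      \<comment> \<open>Row \<open>x\<close> of \<open>S\<close> vanishes, so the product formula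
        holds with an empty range of summation.\<close>
      then show False using mcoeff_compose[OF S finite.emptyI, of x T y] nz by simp
    qed
    obtain u where "mcoeff S x u * mcoeff T u y \<noteq> 0"
      using nz unfolding ST[OF x] by (meson sum.neutral)
    then have "u \<in> nball R x" "y \<in> nball R u" using local_radiusD[OF RS] local_radiusD[OF RT] by auto
    then show "y \<in> nball (R + R) x" by (rule graph_ball_trans)
  next
    fix y z \<theta> w assume y: "y \<in> V" and z: "z \<in> V" and \<theta>: "biso (R + R) y z \<theta>" and w: "w \<in> nball (R + R) y"
    have \<theta>y: "\<theta> y = z" using \<theta> by (simp add: ball_iso_def)
    have "(\<Sum>u\<in>nball R y. mcoeff S y u * mcoeff T u w)
        = (\<Sum>u\<in>nball R y. mcoeff S z (\<theta> u) * mcoeff T (\<theta> u) (\<theta> w))"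
    proof (rule sum.cong[OF refl])
      fix u assume u: "u \<in> nball R y"
      have u': "u \<in> nball (R + R) y" by (rule graph_ball_mono[OF u]) simp
      have "mcoeff S z (\<theta> u) = mcoeff S y u"
        using local_radius_iso[OF RS \<theta> y ball_self[OF y, of 0] _ u'] \<theta>y by simp
      moreover have "mcoeff T (\<theta> u) (\<theta> w) = mcoeff T u w"
        by (rule local_radius_iso[OF RT \<theta> y u _ w]) simp
      ultimately show "mcoeff S y u * mcoeff T u w = mcoeff S z (\<theta> u) * mcoeff T (\<theta> u) (\<theta> w)" by simp
    qed
    also have "\<dots> = (\<Sum>u\<in>nball R z. mcoeff S z u * mcoeff T u (\<theta> w))"
      using iso_image_ball[OF \<theta> y ball_self[OF y, of 0], of R] \<theta>y
      by (intro sum.reindex_bij_betw) simp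
    finally show "mcoeff (S o\<^sub>L T) y w = mcoeff (S o\<^sub>L T) z (\<theta> w)"
      by (simp add: ST y z)
  qed
  then show ?thesis using S T by (auto simp: local_op_def op_clinear_simps)
qed

lemma cstar_r_eq: "cstar_r G Q H = closure {T. local_op T}"
  by (simp add: cstar_r_def local_op_iff)

lemma span_local_op: "span {T. local_op T} = {T. local_op T}"
proof -
  have "local_op (r *\<^sub>R T)" if "local_op T" for r T
    using local_op_scaleC[OF that, of "complex_of_real r"] by (simp add: op_scaleC_of_real)
  then show ?thesis by (auto simp: span_eq_iff subspace_def local_op_0 local_op_add)
qed

lemma cstar_algebra_cstar_r: "cstar_algebra (cstar_r G Q H)"
proof -
  let ?L = "{T. local_op T}"
  have A: "cstar_r G Q H = closure (span ?L)" by (simp add: span_local_op cstar_r_eq)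
  have sub: "subspace (cstar_r G Q H)" unfolding A by (intro subspace_closure subspace_span)
  have lin: "op_clinear T" if "T \<in> cstar_r G Q H" for T
  proof -
    have "?L \<subseteq> {T. op_clinear T}" by (auto simp: local_op_def)
    then have "closure ?L \<subseteq> {T. op_clinear T}" using closed_op_clinear by (rule closure_minimal)
    with that show ?thesis unfolding cstar_r_eq by blast
  qed
  have L: "T \<in> closure (span ?L)" if "local_op T" for T
    using that closure_subset unfolding span_local_op by blast
  have adj: "adj T \<in> cstar_r G Q H" if "T \<in> cstar_r G Q H" for T
    unfolding A
    by (rule bounded_linear_closure_subset[OF bounded_linear_adj _ that[unfolded A]]) (simp add: L local_op_adj)
  have sc: "op_scaleC c T \<in> cstar_r G Q H" if "T \<in> cstar_r G Q H" for c T
    unfolding A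
    by (rule bounded_linear_closure_subset[OF bounded_linear_op_scaleC _ that[unfolded A]]) (simp add: L local_op_scaleC)
  have comp: "S o\<^sub>L T \<in> cstar_r G Q H" if "S \<in> cstar_r G Q H" "T \<in> cstar_r G Q H" for S T
    unfolding A
    by (rule bounded_bilinear_closure_subset[OF bounded_bilinear_blinfun_compose _ that[unfolded A]])
       (simp add: L local_op_compose)
  have "closed (cstar_r G Q H)" by (simp add: cstar_r_eq)
  then show ?thesis
    unfolding cstar_algebra_def
    using lin adj sc comp subspace_0[OF sub] subspace_add[OF sub] by (simp add: op_adj_eq)
qed

lemma exact_cstar_r:
  assumes "property_A V E"
  shows "exact_cstar_algebra TYPE('i) TYPE('j) (cstar_r G Q H)"
proof (rule property_A_exact[OF cstar_algebra_cstar_r assms bounded_geometry])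
  show "cstar_r G Q H \<subseteq> closure {T. local_op T}" by (simp add: cstar_r_eq)
  show "{T. local_op T} \<subseteq> cstar_r G Q H" unfolding cstar_r_eq by (rule closure_subset)
  show "\<exists>r. propagation V E r (mcoeff T)" if "T \<in> {T. local_op T}" for T
    using that unfolding local_op_def local_radius_def propagation_def by blast
qed

end

theorem proposition7p1:
  fixes G :: "('g, 'm) monoid_scheme" and Q H :: "'g set" and Z :: "'g set set"
  assumes "group G"
    and "finite Q" and "Q \<subseteq> carrier G" and "generate G Q = carrier G"
    and "urs G Z" and "H \<in> Z"
    and "property_A (lcosets\<^bsub>G\<^esub> H) (schreier_adj G Q H)"
  shows "exact_cstar_algebra TYPE('i) TYPE('j) (cstar_r G Q H)"
proof -
  \<comment> \<open>A closed set lies in the underlying space, whose points are subgroups; hence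
    \<open>H\<close> is a subgroup and contained in the carrier.\<close>
  have "closedin (sub_topology G) Z" using \<open>urs G Z\<close> by (simp add: urs_def closed_invariant_def)
  then have "H \<in> topspace (sub_topology G)" using \<open>H \<in> Z\<close> closedin_subset by blast
  then have "subgroup H G" by (simp add: sub_topology_def topspace_pullback_topology)
  then have "schreier_graph G Q H"
    using assms by (intro schreier_graph.intro schreier_graph_axioms.intro) (auto simp: subgroup_def)
  then show ?thesis using assms(7) by (rule schreier_graph.exact_cstar_r)
qed

end
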